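(* Let $G$ be an $X$-generated group with Cayley graph $\Gamma_X$. Then: (1) the category $\mathcal E(X,G)$ of $X$-generated $E$-unitary inverse monoids with greatest group image $G$ is equivalent to the category $\mathcal C(X,G)$ of $G$-invariant finitary closure operators on $(\operatorname{CSub}\Gamma_X,\subseteq)$; (2) the category $\mathcal F(X,G)$ of $X$-generated $F$-inverse monoids with greatest group image $G$ is equivalent to the category $\mathcal S(X,G)$ of $G$-invariant finitary closure operators on $(\operatorname{Sub}\Gamma_X,\subseteq)$. Explicitly, the equivalences are given by $S\mapsto ()^{c_S}$ and $()^c\mapsto S_c$.
   Context: $X$-generated means generated by the image of a map $\iota:X\to S$ (in signature $(\cdot,1,{}^{-1})$ for inverse monoids, $(\cdot,1,{}^{-1},{}^{\mathfrak m})$ for $F$-inverse monoids, where $s^{\mathfrak m}$ is the greatest element of the $\sigma$-class of $s$); a morphism is canonical if it commutes with the generating maps. $\mathcal E(X,G)$ has as objects $X$-generated $E$-unitary inverse monoids $S$ whose greatest group image $S/\sigma$, $X$-generated via $\sigma^\sharp\circ\iota$, is canonically isomorphic to $G$, considered up to canonical isomorphism, with canonical inverse monoid morphisms as morphisms; $\mathcal F(X,G)$ is defined analogously for $F$-inverse monoids with canonical $F$-inverse monoid morphisms. $\Gamma_X$ is the Cayley graph of $G$ (vertices $G$, edge labeled $x$ from $g$ to $gx_G$, $x\in X\cup X^{-1}$, with inverse edges); $\operatorname{Sub}\Gamma_X$, $\operatorname{CSub}\Gamma_X$ are the posets of all, resp. connected, subgraphs (closed under endpoints and inverse edges). A closure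 operator is $G$-invariant if $(g\Delta)^c=g\Delta^c$ and finitary if $\Delta^c=\bigcup\{F^c:F\subseteq\Delta$ finite (connected in the $\operatorname{CSub}$ case)$\}$. In $\mathcal C(X,G)$ and $\mathcal S(X,G)$ there is a (unique) morphism $()^c\to()^{c'}$ iff $\Delta^c\subseteq\Delta^{c'}$ for all $\Delta$. $c_S$ is the closure operator whose closed graphs are those $\Delta$ such that for all words (resp. terms $u_0v_1^{\mathfrak m}u_1\cdots v_n^{\mathfrak m}u_n$) $u,v$ with $u_S=v_S$ and all $g,h\in V(\Delta)$, $u$ labels a path (resp. journey) in $\Delta$ from $g$ to $h$ iff $v$ does; here the journey labeled by such a term from $g$ is the sequence of paths $(g\overline{u_0},g(u_0v_1)_G\overline{u_1},\dots)$ and lies in $\Delta$ if all its paths do. $S_c$ is the monoid of pairs $(\Delta,g)$, $g\in G$, $\Delta=F^c$ for some finite (connected) $F$, $1,g\in V(\Delta)$, with $(\Delta,g)(\Xi,h)=((\Delta\cup g\Xi)^c,gh)$, $(\Delta,g)^{-1}=(g^{-1}\Delta,g^{-1})$, $(\Delta,g)^{\mathfrak m}=(\{1,g\}^c,g)$, generated via $x\mapsto(\langle\overline x\rangle^c,x_G)$.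
   Formalization: Subgraphs are required to be nonempty: if the empty graph is admitted, the constant operator Δ ↦ Γ_X is G-invariant and finitary, yet the empty graph is always c_S-closed, so c_{S_c} ≠ c. *)

theory Defs
  imports "HOL-Algebra.Generated_Groups"
begin

text \<open>Letters of X \<union> X^-1: Inl x stands for x, Inr x for x^-1.\<close>

definition labels :: "'x set \<Rightarrow> ('x + 'x) set" where
  "labels X = Inl ` X \<union> Inr ` X"

definition words :: "'x set \<Rightarrow> ('x + 'x) list set" where
  "words X = {w. set w \<subseteq> labels X}"

definition flip :: "'x + 'x \<Rightarrow> 'x + 'x" where
  "flip a = (case a of Inl x \<Rightarrow> Inr x | Inr x \<Rightarrow> Inl x)"

definition lval :: "('g, 'b) monoid_scheme \<Rightarrow> ('x \<Rightarrow> 'g) \<Rightarrow> 'x + 'x \<Rightarrow> 'g" where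
  "lval G \<iota> a = (case a of Inl x \<Rightarrow> \<iota> x | Inr x \<Rightarrow> inv\<^bsub>G\<^esub> (\<iota> x))"

definition wval :: "('g, 'b) monoid_scheme \<Rightarrow> ('x \<Rightarrow> 'g) \<Rightarrow> ('x + 'x) list \<Rightarrow> 'g" where
  "wval G \<iota> w = foldr (\<lambda>a r. lval G \<iota> a \<otimes>\<^bsub>G\<^esub> r) w \<one>\<^bsub>G\<^esub>"

text \<open>A graph: a vertex set and an edge set; the edge (g,a) goes from g to g a_G
  and is labelled a.\<close>
type_synonym ('g, 'x) graph = "'g set \<times> ('g \<times> ('x + 'x)) set"

definition cayley_edges :: "('g, 'b) monoid_scheme \<Rightarrow> 'x set \<Rightarrow> ('g \<times> ('x + 'x)) set" where
  "cayley_edges G X = {(g, a). g \<in> carrier G \<and> a \<in> labels X}"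

definition etgt :: "('g, 'b) monoid_scheme \<Rightarrow> ('x \<Rightarrow> 'g) \<Rightarrow> 'g \<times> ('x + 'x) \<Rightarrow> 'g" where
  "etgt G \<iota> e = fst e \<otimes>\<^bsub>G\<^esub> lval G \<iota> (snd e)"

definition einv :: "('g, 'b) monoid_scheme \<Rightarrow> ('x \<Rightarrow> 'g) \<Rightarrow> 'g \<times> ('x + 'x) \<Rightarrow> 'g \<times> ('x + 'x)" where
  "einv G \<iota> e = (etgt G \<iota> e, flip (snd e))"

definition is_subgraph :: "('g, 'b) monoid_scheme \<Rightarrow> ('x \<Rightarrow> 'g) \<Rightarrow> 'x set \<Rightarrow> ('g, 'x) graph \<Rightarrow> bool" where
  "is_subgraph G \<iota> X \<Delta> \<longleftrightarrow>
     fst \<Delta> \<noteq> {} \<and> fst \<Delta> \<subseteq> carrier G \<and> snd \<Delta> \<subseteq> cayley_edges G X \<and>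
     (\<forall>e\<in>snd \<Delta>. fst e \<in> fst \<Delta> \<and> etgt G \<iota> e \<in> fst \<Delta> \<and> einv G \<iota> e \<in> snd \<Delta>)"

definition subg_le :: "('g, 'x) graph \<Rightarrow> ('g, 'x) graph \<Rightarrow> bool" where
  "subg_le \<Delta> \<Theta> \<longleftrightarrow> fst \<Delta> \<subseteq> fst \<Theta> \<and> snd \<Delta> \<subseteq> snd \<Theta>"

fun lpath :: "('g, 'b) monoid_scheme \<Rightarrow> ('x \<Rightarrow> 'g) \<Rightarrow> ('g, 'x) graph \<Rightarrow> 'g \<Rightarrow> ('x + 'x) list \<Rightarrow> 'g \<Rightarrow> bool" where
  "lpath G \<iota> \<Delta> g [] h \<longleftrightarrow> g \<in> fst \<Delta> \<and> g = h"
| "lpath G \<iota> \<Delta> g (a # w) h \<longleftrightarrow> (g, a) \<in> snd \<Delta> \<and> lpath G \<iota> \<Delta> (g \<otimes>\<^bsub>G\<^esub> lval G \<iota> a) w h"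

definition connected_graph :: "('g, 'b) monoid_scheme \<Rightarrow> ('x \<Rightarrow> 'g) \<Rightarrow> ('g, 'x) graph \<Rightarrow> bool" where
  "connected_graph G \<iota> \<Delta> \<longleftrightarrow> (\<forall>g\<in>fst \<Delta>. \<forall>h\<in>fst \<Delta>. \<exists>w. lpath G \<iota> \<Delta> g w h)"

definition Sub :: "('g, 'b) monoid_scheme \<Rightarrow> ('x \<Rightarrow> 'g) \<Rightarrow> 'x set \<Rightarrow> ('g, 'x) graph set" where
  "Sub G \<iota> X = {\<Delta>. is_subgraph G \<iota> X \<Delta>}"

definition CSub :: "('g, 'b) monoid_scheme \<Rightarrow> ('x \<Rightarrow> 'g) \<Rightarrow> 'x set \<Rightarrow> ('g, 'x) graph set" where
  "CSub G \<iota> X = {\<Delta>. is_subgraph G \<iota> X \<Delta> \<and> connected_graph G \<iota> \<Delta>}"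

definition gtrans :: "('g, 'b) monoid_scheme \<Rightarrow> 'g \<Rightarrow> ('g, 'x) graph \<Rightarrow> ('g, 'x) graph" where
  "gtrans G g \<Delta> = ((\<lambda>v. g \<otimes>\<^bsub>G\<^esub> v) ` fst \<Delta>, (\<lambda>(v, a). (g \<otimes>\<^bsub>G\<^esub> v, a)) ` snd \<Delta>)"

definition gunion :: "('g, 'x) graph \<Rightarrow> ('g, 'x) graph \<Rightarrow> ('g, 'x) graph" where
  "gunion \<Delta> \<Theta> = (fst \<Delta> \<union> fst \<Theta>, snd \<Delta> \<union> snd \<Theta>)"

definition gUnion :: "('g, 'x) graph set \<Rightarrow> ('g, 'x) graph" where
  "gUnion A = (\<Union> (fst ` A), \<Union> (snd ` A))"

definition finite_graph :: "('g, 'x) graph \<Rightarrow> bool" where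
  "finite_graph \<Delta> \<longleftrightarrow> finite (fst \<Delta>) \<and> finite (snd \<Delta>)"

definition closure_op :: "('g, 'x) graph set \<Rightarrow> (('g, 'x) graph \<Rightarrow> ('g, 'x) graph) \<Rightarrow> bool" where
  "closure_op P c \<longleftrightarrow>
     (\<forall>\<Delta>\<in>P. c \<Delta> \<in> P \<and> subg_le \<Delta> (c \<Delta>)) \<and>
     (\<forall>\<Delta>\<in>P. \<forall>\<Theta>\<in>P. subg_le \<Delta> \<Theta> \<longrightarrow> subg_le (c \<Delta>) (c \<Theta>)) \<and>
     (\<forall>\<Delta>\<in>P. c (c \<Delta>) = c \<Delta>)"

definition G_invariant :: "('g, 'b) monoid_scheme \<Rightarrow> ('g, 'x) graph set \<Rightarrow> (('g, 'x) graph \<Rightarrow> ('g, 'x) graph) \<Rightarrow> bool" where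
  "G_invariant G P c \<longleftrightarrow> (\<forall>g\<in>carrier G. \<forall>\<Delta>\<in>P. c (gtrans G g \<Delta>) = gtrans G g (c \<Delta>))"

definition finitary :: "('g, 'x) graph set \<Rightarrow> (('g, 'x) graph \<Rightarrow> ('g, 'x) graph) \<Rightarrow> bool" where
  "finitary P c \<longleftrightarrow> (\<forall>\<Delta>\<in>P. c \<Delta> = gUnion (c ` {F \<in> P. finite_graph F \<and> subg_le F \<Delta>}))"

definition objC :: "('g, 'b) monoid_scheme \<Rightarrow> ('x \<Rightarrow> 'g) \<Rightarrow> 'x set \<Rightarrow> (('g, 'x) graph \<Rightarrow> ('g, 'x) graph) \<Rightarrow> bool" where
  "objC G \<iota> X c \<longleftrightarrow> closure_op (CSub G \<iota> X) c \<and> G_invariant G (CSub G \<iota> X) c \<and> finitary (CSub G \<iota> X) c"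

definition objS :: "('g, 'b) monoid_scheme \<Rightarrow> ('x \<Rightarrow> 'g) \<Rightarrow> 'x set \<Rightarrow> (('g, 'x) graph \<Rightarrow> ('g, 'x) graph) \<Rightarrow> bool" where
  "objS G \<iota> X c \<longleftrightarrow> closure_op (Sub G \<iota> X) c \<and> G_invariant G (Sub G \<iota> X) c \<and> finitary (Sub G \<iota> X) c"

text \<open>morphism ()^c \<rightarrow> ()^c' exists iff c \<le> c' pointwise on P\<close>
definition clo_le :: "('g, 'x) graph set \<Rightarrow> (('g, 'x) graph \<Rightarrow> ('g, 'x) graph) \<Rightarrow> (('g, 'x) graph \<Rightarrow> ('g, 'x) graph) \<Rightarrow> bool" where
  "clo_le P c c' \<longleftrightarrow> (\<forall>\<Delta>\<in>P. subg_le (c \<Delta>) (c' \<Delta>))"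

definition is_inverse_monoid :: "'s monoid \<Rightarrow> bool" where
  "is_inverse_monoid M \<longleftrightarrow> monoid M \<and>
     (\<forall>a\<in>carrier M. \<exists>!b. b \<in> carrier M \<and> a \<otimes>\<^bsub>M\<^esub> b \<otimes>\<^bsub>M\<^esub> a = a \<and> b \<otimes>\<^bsub>M\<^esub> a \<otimes>\<^bsub>M\<^esub> b = b)"

definition iinv :: "'s monoid \<Rightarrow> 's \<Rightarrow> 's" where
  "iinv M a = (THE b. b \<in> carrier M \<and> a \<otimes>\<^bsub>M\<^esub> b \<otimes>\<^bsub>M\<^esub> a = a \<and> b \<otimes>\<^bsub>M\<^esub> a \<otimes>\<^bsub>M\<^esub> b = b)"

definition idems :: "'s monoid \<Rightarrow> 's set" where
  "idems M = {e \<in> carrier M. e \<otimes>\<^bsub>M\<^esub> e = e}"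

definition sigma :: "'s monoid \<Rightarrow> 's \<Rightarrow> 's \<Rightarrow> bool" where
  "sigma M a b \<longleftrightarrow> (\<exists>e\<in>idems M. e \<otimes>\<^bsub>M\<^esub> a = e \<otimes>\<^bsub>M\<^esub> b)"

definition nat_le :: "'s monoid \<Rightarrow> 's \<Rightarrow> 's \<Rightarrow> bool" where
  "nat_le M a b \<longleftrightarrow> (\<exists>e\<in>idems M. a = e \<otimes>\<^bsub>M\<^esub> b)"

definition E_unitary :: "'s monoid \<Rightarrow> bool" where
  "E_unitary M \<longleftrightarrow> (\<forall>e\<in>idems M. \<forall>s\<in>carrier M. e \<otimes>\<^bsub>M\<^esub> s \<in> idems M \<longrightarrow> s \<in> idems M)"

definition F_inverse :: "'s monoid \<Rightarrow> bool" where
  "F_inverse M \<longleftrightarrow> (\<forall>a\<in>carrier M. \<exists>b\<in>carrier M. sigma M a b \<and>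
      (\<forall>c\<in>carrier M. sigma M a c \<longrightarrow> nat_le M c b))"

definition mop :: "'s monoid \<Rightarrow> 's \<Rightarrow> 's" where
  "mop M a = (THE b. b \<in> carrier M \<and> sigma M a b \<and> (\<forall>c\<in>carrier M. sigma M a c \<longrightarrow> nat_le M c b))"

inductive_set invgen :: "'s monoid \<Rightarrow> ('x \<Rightarrow> 's) \<Rightarrow> 'x set \<Rightarrow> 's set"
  for M :: "'s monoid" and \<iota> :: "'x \<Rightarrow> 's" and X :: "'x set" where
  gen: "x \<in> X \<Longrightarrow> \<iota> x \<in> invgen M \<iota> X"
| one: "\<one>\<^bsub>M\<^esub> \<in> invgen M \<iota> X"
| mult: "a \<in> invgen M \<iota> X \<Longrightarrow> b \<in> invgen M \<iota> X \<Longrightarrow> a \<otimes>\<^bsub>M\<^esub> b \<in> invgen M \<iota> X"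
| inv: "a \<in> invgen M \<iota> X \<Longrightarrow> iinv M a \<in> invgen M \<iota> X"

inductive_set Fgen :: "'s monoid \<Rightarrow> ('x \<Rightarrow> 's) \<Rightarrow> 'x set \<Rightarrow> 's set"
  for M :: "'s monoid" and \<iota> :: "'x \<Rightarrow> 's" and X :: "'x set" where
  gen: "x \<in> X \<Longrightarrow> \<iota> x \<in> Fgen M \<iota> X"
| one: "\<one>\<^bsub>M\<^esub> \<in> Fgen M \<iota> X"
| mult: "a \<in> Fgen M \<iota> X \<Longrightarrow> b \<in> Fgen M \<iota> X \<Longrightarrow> a \<otimes>\<^bsub>M\<^esub> b \<in> Fgen M \<iota> X"
| inv: "a \<in> Fgen M \<iota> X \<Longrightarrow> iinv M a \<in> Fgen M \<iota> X"
| m: "a \<in> Fgen M \<iota> X \<Longrightarrow> mop M a \<in> Fgen M \<iota> X"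

text \<open>greatest group image S/sigma, X-generated via sigma# o iota, canonically isomorphic to G\<close>
definition group_image_is :: "('g, 'b) monoid_scheme \<Rightarrow> ('x \<Rightarrow> 'g) \<Rightarrow> 'x set \<Rightarrow> 's monoid \<Rightarrow> ('x \<Rightarrow> 's) \<Rightarrow> bool" where
  "group_image_is G \<iota>G X M \<iota> \<longleftrightarrow> (\<exists>\<phi>. \<phi> \<in> carrier M \<rightarrow> carrier G \<and>
      (\<forall>a\<in>carrier M. \<forall>b\<in>carrier M. \<phi> (a \<otimes>\<^bsub>M\<^esub> b) = \<phi> a \<otimes>\<^bsub>G\<^esub> \<phi> b) \<and>
      \<phi> \<one>\<^bsub>M\<^esub> = \<one>\<^bsub>G\<^esub> \<and> \<phi> ` carrier M = carrier G \<and>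
      (\<forall>x\<in>X. \<phi> (\<iota> x) = \<iota>G x) \<and>
      (\<forall>a\<in>carrier M. \<forall>b\<in>carrier M. \<phi> a = \<phi> b \<longleftrightarrow> sigma M a b))"

definition objE :: "('g, 'b) monoid_scheme \<Rightarrow> ('x \<Rightarrow> 'g) \<Rightarrow> 'x set \<Rightarrow> 's monoid \<Rightarrow> ('x \<Rightarrow> 's) \<Rightarrow> bool" where
  "objE G \<iota>G X M \<iota> \<longleftrightarrow> is_inverse_monoid M \<and> \<iota> ` X \<subseteq> carrier M \<and> carrier M = invgen M \<iota> X \<and>
     E_unitary M \<and> group_image_is G \<iota>G X M \<iota>"

definition objF :: "('g, 'b) monoid_scheme \<Rightarrow> ('x \<Rightarrow> 'g) \<Rightarrow> 'x set \<Rightarrow> 's monoid \<Rightarrow> ('x \<Rightarrow> 's) \<Rightarrow> bool" where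
  "objF G \<iota>G X M \<iota> \<longleftrightarrow> is_inverse_monoid M \<and> F_inverse M \<and> \<iota> ` X \<subseteq> carrier M \<and> carrier M = Fgen M \<iota> X \<and>
     group_image_is G \<iota>G X M \<iota>"

definition canon_inv_mor :: "'x set \<Rightarrow> 's monoid \<Rightarrow> ('x \<Rightarrow> 's) \<Rightarrow> 't monoid \<Rightarrow> ('x \<Rightarrow> 't) \<Rightarrow> ('s \<Rightarrow> 't) \<Rightarrow> bool" where
  "canon_inv_mor X M \<iota>M N \<iota>N f \<longleftrightarrow> f \<in> carrier M \<rightarrow> carrier N \<and>
     (\<forall>a\<in>carrier M. \<forall>b\<in>carrier M. f (a \<otimes>\<^bsub>M\<^esub> b) = f a \<otimes>\<^bsub>N\<^esub> f b) \<and> f \<one>\<^bsub>M\<^esub> = \<one>\<^bsub>N\<^esub> \<and>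
     (\<forall>a\<in>carrier M. f (iinv M a) = iinv N (f a)) \<and> (\<forall>x\<in>X. f (\<iota>M x) = \<iota>N x)"

definition canon_F_mor :: "'x set \<Rightarrow> 's monoid \<Rightarrow> ('x \<Rightarrow> 's) \<Rightarrow> 't monoid \<Rightarrow> ('x \<Rightarrow> 't) \<Rightarrow> ('s \<Rightarrow> 't) \<Rightarrow> bool" where
  "canon_F_mor X M \<iota>M N \<iota>N f \<longleftrightarrow> canon_inv_mor X M \<iota>M N \<iota>N f \<and>
     (\<forall>a\<in>carrier M. f (mop M a) = mop N (f a))"

definition letter :: "'s monoid \<Rightarrow> ('x \<Rightarrow> 's) \<Rightarrow> 'x + 'x \<Rightarrow> 's" where
  "letter M \<iota> a = (case a of Inl x \<Rightarrow> \<iota> x | Inr x \<Rightarrow> iinv M (\<iota> x))"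

definition weval :: "'s monoid \<Rightarrow> ('x \<Rightarrow> 's) \<Rightarrow> ('x + 'x) list \<Rightarrow> 's" where
  "weval M \<iota> w = foldr (\<lambda>a r. letter M \<iota> a \<otimes>\<^bsub>M\<^esub> r) w \<one>\<^bsub>M\<^esub>"

text \<open>A term u0 v1^m u1 ... vn^m un is represented as (u0, [(v1,u1),...,(vn,un)]).\<close>
type_synonym 'x mterm = "('x + 'x) list \<times> (('x + 'x) list \<times> ('x + 'x) list) list"

definition mterms :: "'x set \<Rightarrow> 'x mterm set" where
  "mterms X = {(u0, r). u0 \<in> words X \<and> (\<forall>(v, u)\<in>set r. v \<in> words X \<and> u \<in> words X)}"

definition teval :: "'s monoid \<Rightarrow> ('x \<Rightarrow> 's) \<Rightarrow> 'x mterm \<Rightarrow> 's" where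
  "teval M \<iota> t = weval M \<iota> (fst t) \<otimes>\<^bsub>M\<^esub>
     foldr (\<lambda>(v, u) acc. mop M (weval M \<iota> v) \<otimes>\<^bsub>M\<^esub> weval M \<iota> u \<otimes>\<^bsub>M\<^esub> acc) (snd t) \<one>\<^bsub>M\<^esub>"

fun journey :: "('g, 'b) monoid_scheme \<Rightarrow> ('x \<Rightarrow> 'g) \<Rightarrow> ('g, 'x) graph \<Rightarrow> 'g \<Rightarrow> ('x + 'x) list
    \<Rightarrow> (('x + 'x) list \<times> ('x + 'x) list) list \<Rightarrow> 'g \<Rightarrow> bool" where
  "journey G \<iota> \<Delta> g u0 [] h \<longleftrightarrow> lpath G \<iota> \<Delta> g u0 h"
| "journey G \<iota> \<Delta> g u0 ((v, u) # r) h \<longleftrightarrow>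
     (\<exists>k. lpath G \<iota> \<Delta> g u0 k \<and> journey G \<iota> \<Delta> (k \<otimes>\<^bsub>G\<^esub> wval G \<iota> v) u r h)"

definition closedE :: "('g, 'b) monoid_scheme \<Rightarrow> ('x \<Rightarrow> 'g) \<Rightarrow> 'x set \<Rightarrow> 's monoid \<Rightarrow> ('x \<Rightarrow> 's) \<Rightarrow> ('g, 'x) graph \<Rightarrow> bool" where
  "closedE G \<iota>G X M \<iota> \<Delta> \<longleftrightarrow> (\<forall>u\<in>words X. \<forall>v\<in>words X. weval M \<iota> u = weval M \<iota> v \<longrightarrow>
     (\<forall>g\<in>fst \<Delta>. \<forall>h\<in>fst \<Delta>. lpath G \<iota>G \<Delta> g u h \<longleftrightarrow> lpath G \<iota>G \<Delta> g v h))"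

definition closedF :: "('g, 'b) monoid_scheme \<Rightarrow> ('x \<Rightarrow> 'g) \<Rightarrow> 'x set \<Rightarrow> 's monoid \<Rightarrow> ('x \<Rightarrow> 's) \<Rightarrow> ('g, 'x) graph \<Rightarrow> bool" where
  "closedF G \<iota>G X M \<iota> \<Delta> \<longleftrightarrow> (\<forall>u\<in>mterms X. \<forall>v\<in>mterms X. teval M \<iota> u = teval M \<iota> v \<longrightarrow>
     (\<forall>g\<in>fst \<Delta>. \<forall>h\<in>fst \<Delta>. journey G \<iota>G \<Delta> g (fst u) (snd u) h \<longleftrightarrow> journey G \<iota>G \<Delta> g (fst v) (snd v) h))"

definition cE :: "('g, 'b) monoid_scheme \<Rightarrow> ('x \<Rightarrow> 'g) \<Rightarrow> 'x set \<Rightarrow> 's monoid \<Rightarrow> ('x \<Rightarrow> 's) \<Rightarrow> ('g, 'x) graph \<Rightarrow> ('g, 'x) graph" where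
  "cE G \<iota>G X M \<iota> \<Delta> = (THE \<Theta>. \<Theta> \<in> CSub G \<iota>G X \<and> subg_le \<Delta> \<Theta> \<and> closedE G \<iota>G X M \<iota> \<Theta> \<and>
      (\<forall>\<Theta>'\<in>CSub G \<iota>G X. subg_le \<Delta> \<Theta>' \<and> closedE G \<iota>G X M \<iota> \<Theta>' \<longrightarrow> subg_le \<Theta> \<Theta>'))"

definition cF :: "('g, 'b) monoid_scheme \<Rightarrow> ('x \<Rightarrow> 'g) \<Rightarrow> 'x set \<Rightarrow> 's monoid \<Rightarrow> ('x \<Rightarrow> 's) \<Rightarrow> ('g, 'x) graph \<Rightarrow> ('g, 'x) graph" where
  "cF G \<iota>G X M \<iota> \<Delta> = (THE \<Theta>. \<Theta> \<in> Sub G \<iota>G X \<and> subg_le \<Delta> \<Theta> \<and> closedF G \<iota>G X M \<iota> \<Theta> \<and>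
      (\<forall>\<Theta>'\<in>Sub G \<iota>G X. subg_le \<Delta> \<Theta>' \<and> closedF G \<iota>G X M \<iota> \<Theta>' \<longrightarrow> subg_le \<Theta> \<Theta>'))"

text \<open>P is CSub (case E) or Sub (case F).\<close>
definition Sc :: "('g, 'x) graph set \<Rightarrow> ('g, 'b) monoid_scheme \<Rightarrow> (('g, 'x) graph \<Rightarrow> ('g, 'x) graph)
    \<Rightarrow> (('g, 'x) graph \<times> 'g) monoid" where
  "Sc P G c = \<lparr> carrier = {(\<Delta>, g). g \<in> carrier G \<and> (\<exists>F\<in>P. finite_graph F \<and> \<Delta> = c F) \<and>
                                   \<one>\<^bsub>G\<^esub> \<in> fst \<Delta> \<and> g \<in> fst \<Delta>},
               mult = (\<lambda>(\<Delta>, g) (\<Xi>, h). (c (gunion \<Delta> (gtrans G g \<Xi>)), g \<otimes>\<^bsub>G\<^esub> h)),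
               one = (c ({\<one>\<^bsub>G\<^esub>}, {}), \<one>\<^bsub>G\<^esub>) \<rparr>"

definition Sc_gen :: "('g, 'b) monoid_scheme \<Rightarrow> ('x \<Rightarrow> 'g) \<Rightarrow> (('g, 'x) graph \<Rightarrow> ('g, 'x) graph)
    \<Rightarrow> 'x \<Rightarrow> ('g, 'x) graph \<times> 'g" where
  "Sc_gen G \<iota> c x = (c ({\<one>\<^bsub>G\<^esub>, \<iota> x}, {(\<one>\<^bsub>G\<^esub>, Inl x), (\<iota> x, Inr x)}), \<iota> x)"

end

theory Submission
  imports Defs
begin

text \<open>
  Both equivalences are instances of one argument. Adjoin to the letters \<open>X \<union> X\<^sup>-\<^sup>1\<close> of the
  \<open>E\<close>-unitary case a formal letter \<open>v\<^sup>m\<close> for every word \<open>v\<close>, which acts on the Cayley graph as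
  a jump from \<open>g\<close> to \<open>g v\<^sub>G\<close> that needs no edge. Journeys become paths, and any two vertices
  of a subgraph are joined by a jump, so ``connected'' becomes vacuous and \<open>CSub\<close> turns into \<open>Sub\<close>.

  A word \<open>w\<close> from \<open>g\<close> sweeps out a finite graph \<open>\<langle>w\<rangle>\<^sub>g\<close>, and it labels a path in \<open>\<Delta>\<close> iff
  \<open>\<langle>w\<rangle>\<^sub>g \<subseteq> \<Delta>\<close>. Every finite connected part of a graph is contained in some such \<open>\<langle>w\<rangle>\<^sub>g\<close>, so the
  elements of \<open>S\<^sub>c\<close> are exactly the pairs \<open>(\<langle>w\<rangle>\<^sub>1\<^sup>c, w\<^sub>G)\<close>, multiplied by concatenating words.
  The heart of the proof is that \<open>u\<^sub>S = v\<^sub>S\<close> iff \<open>u\<^sub>G = v\<^sub>G\<close> and \<open>\<langle>u\<rangle>\<^sub>1\<close>, \<open>\<langle>v\<rangle>\<^sub>1\<close> have the same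
  \<open>c\<^sub>S\<close>-closure. For the nontrivial direction, the union of all \<open>\<langle>t\<rangle>\<^sub>1\<close> with \<open>t\<^sub>S t\<^sub>S\<^sup>-\<^sup>1 \<ge> e\<close>
  (the Schutzenberger graph of the idempotent \<open>e\<close>) is closed, and by \<open>E\<close>-unitarity it contains
  \<open>\<langle>w\<rangle>\<^sub>1\<close> only if \<open>w\<^sub>S w\<^sub>S\<^sup>-\<^sup>1 \<ge> e\<close>; take \<open>e = u\<^sub>S u\<^sub>S\<^sup>-\<^sup>1\<close>.
\<close>

section \<open>Inverse monoids\<close>

text \<open>E-unitarity of \<open>S\<close> is used in the form of purity: an element with trivial
  group image is idempotent. Therefore words leading to the same vertex of the Schutzenberger graph
  of \<open>e\<close> become equal after left multiplication by \<open>e\<close>, and whether a path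
  can be continued depends on its end vertex alone. This is what allows a mere subgraph of the
  Cayley graph to record multiplication in \<open>S\<close>. Finitarity is the exact counterpart of
  finite words. The monoid \<open>S_c\<close> contains closures of finite graphs only, so it can
  determine \<open>c\<close> only if these do; conversely an equation of \<open>S\<close> compares
  two finite paths, so closedness is tested on finite pieces. Morphisms are implications between
  word equations: a canonical morphism from \<open>S\<close> to \<open>T\<close> exists iff every
  equation between words that holds in \<open>S\<close> holds in \<open>T\<close>. More equations
  leave fewer closed graphs, hence a larger closure, which is the order on closure
  operators.\<close>

locale inverse_monoid = monoid M for M :: "'s monoid" (structure) +
  assumes inverse_monoid: "is_inverse_monoid M"
begin

abbreviation J :: "'s \<Rightarrow> 's" where "J \<equiv> iinv M"

lemma iinv_props:
  assumes "a \<in> carrier M"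
  shows iinv_closed [simp]: "J a \<in> carrier M"
    and mult_iinv_mult: "a \<otimes> J a \<otimes> a = a"
    and iinv_mult_iinv: "J a \<otimes> a \<otimes> J a = J a"
proof -
  have "\<exists>!b. b \<in> carrier M \<and> a \<otimes> b \<otimes> a = a \<and> b \<otimes> a \<otimes> b = b"
    using inverse_monoid assms unfolding is_inverse_monoid_def by blast
  from theI'[OF this, folded iinv_def]
  show "J a \<in> carrier M" "a \<otimes> J a \<otimes> a = a" "J a \<otimes> a \<otimes> J a = J a" by auto
qed

lemma iinv_eqI:
  assumes "a \<in> carrier M" "b \<in> carrier M" "a \<otimes> b \<otimes> a = a" "b \<otimes> a \<otimes> b = b"
  shows "J a = b"
proof -
  have "\<exists>!b. b \<in> carrier M \<and> a \<otimes> b \<otimes> a = a \<and> b \<otimes> a \<otimes> b = b"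
    using inverse_monoid assms unfolding is_inverse_monoid_def by blast
  then show ?thesis
    using assms iinv_props[OF assms(1)] by blast
qed

lemma mult_iinv_mult_assoc:
  assumes "a \<in> carrier M"
  shows "a \<otimes> (J a \<otimes> a) = a" and "J a \<otimes> (a \<otimes> J a) = J a"
  using assms mult_iinv_mult iinv_mult_iinv by (simp_all add: m_assoc)

lemma mult_iinv_mult_left:
  assumes "a \<in> carrier M" "b \<in> carrier M"
  shows "a \<otimes> (J a \<otimes> (a \<otimes> b)) = a \<otimes> b" and "J a \<otimes> (a \<otimes> (J a \<otimes> b)) = J a \<otimes> b"
proof -
  show "a \<otimes> (J a \<otimes> (a \<otimes> b)) = a \<otimes> b"
    by (metis assms iinv_closed m_assoc m_closed mult_iinv_mult)
  show "J a \<otimes> (a \<otimes> (J a \<otimes> b)) = J a \<otimes> b"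
    by (metis assms iinv_closed m_assoc m_closed iinv_mult_iinv)
qed

section \<open>Idempotents and their commutation\<close>

lemma idems_closed [simp]: "e \<in> idems M \<Longrightarrow> e \<in> carrier M"
  unfolding idems_def by blast

lemma idem: "e \<in> idems M \<Longrightarrow> e \<otimes> e = e"
  unfolding idems_def by blast

lemma idemsI: "e \<in> carrier M \<Longrightarrow> e \<otimes> e = e \<Longrightarrow> e \<in> idems M"
  unfolding idems_def by blast

lemma idem_left: "e \<in> idems M \<Longrightarrow> a \<in> carrier M \<Longrightarrow> e \<otimes> (e \<otimes> a) = e \<otimes> a"
  by (simp add: m_assoc [symmetric] idem)

lemma iinv_iinv [simp]: "a \<in> carrier M \<Longrightarrow> J (J a) = a"
  by (rule iinv_eqI) (auto simp: mult_iinv_mult iinv_mult_iinv)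

lemma iinv_idem [simp]: "e \<in> idems M \<Longrightarrow> J e = e"
  by (rule iinv_eqI) (auto simp: idem)

lemma one_idem [simp]: "\<one> \<in> idems M"
  by (rule idemsI) simp_all

lemma mult_iinv_idem [simp]: "a \<in> carrier M \<Longrightarrow> a \<otimes> J a \<in> idems M"
  by (rule idemsI) (simp_all add: m_assoc mult_iinv_mult_left)

lemma iinv_mult_idem [simp]: "a \<in> carrier M \<Longrightarrow> J a \<otimes> a \<in> idems M"
  by (rule idemsI) (simp_all add: m_assoc mult_iinv_mult_left)

text \<open>If \<open>x\<close> is the inverse of \<open>e \<otimes> f\<close>, then so is
  \<open>f \<otimes> x \<otimes> e\<close>. Uniqueness gives
  \<open>x = f \<otimes> x \<otimes> e\<close>, which makes \<open>x\<close> idempotent, hence its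
  own inverse, hence equal to \<open>e \<otimes> f\<close>.\<close>

lemma mult_idems_idem:
  assumes e: "e \<in> idems M" and f: "f \<in> idems M"
  shows "e \<otimes> f \<in> idems M"
proof -
  define x where "x = J (e \<otimes> f)"
  have ef: "e \<in> carrier M" "f \<in> carrier M" using e f by simp_all
  have x: "x \<in> carrier M" using ef x_def by simp
  have x1: "e \<otimes> (f \<otimes> (x \<otimes> (e \<otimes> f))) = e \<otimes> f" and x2: "x \<otimes> (e \<otimes> (f \<otimes> x)) = x"
    using mult_iinv_mult[of "e \<otimes> f"] iinv_mult_iinv[of "e \<otimes> f"] ef x
    by (simp_all add: x_def m_assoc)
  have "J (e \<otimes> f) = f \<otimes> x \<otimes> e"
  proof (rule iinv_eqI)
    show "e \<otimes> f \<otimes> (f \<otimes> x \<otimes> e) \<otimes> (e \<otimes> f) = e \<otimes> f"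
      using ef x x1 e f by (simp add: m_assoc idem_left)
    have "f \<otimes> (x \<otimes> (e \<otimes> (f \<otimes> (x \<otimes> e)))) = f \<otimes> ((x \<otimes> (e \<otimes> (f \<otimes> x))) \<otimes> e)"
      using ef x by (simp add: m_assoc)
    then show "f \<otimes> x \<otimes> e \<otimes> (e \<otimes> f) \<otimes> (f \<otimes> x \<otimes> e) = f \<otimes> x \<otimes> e"
      using ef x x2 e f by (simp add: m_assoc idem_left)
  qed (use ef x in auto)
  then have xeq: "x = f \<otimes> x \<otimes> e" by (simp add: x_def)
  have "x \<otimes> x = (f \<otimes> x \<otimes> e) \<otimes> (f \<otimes> x \<otimes> e)" using xeq by simp
  also have "\<dots> = f \<otimes> (x \<otimes> (e \<otimes> (f \<otimes> x))) \<otimes> e" using ef x by (simp add: m_assoc)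
  also have "\<dots> = x" using x2 xeq by simp
  finally have "x \<in> idems M" using x by (rule idemsI[rotated])
  then have "J x = x" by simp
  then have "e \<otimes> f = x" using ef by (simp add: x_def)
  with \<open>x \<in> idems M\<close> show ?thesis by simp
qed

text \<open>With both products idempotent, \<open>f \<otimes> e\<close> satisfies the equations of
  an inverse of \<open>e \<otimes> f\<close>, while an idempotent is its own inverse.\<close>

lemma idems_comm:
  assumes e: "e \<in> idems M" and f: "f \<in> idems M"
  shows "e \<otimes> f = f \<otimes> e"
proof -
  have ef: "e \<in> carrier M" "f \<in> carrier M" using e f by simp_all
  have i: "e \<otimes> f \<in> idems M" "f \<otimes> e \<in> idems M" using e f mult_idems_idem by auto
  have 1: "e \<otimes> (f \<otimes> (e \<otimes> f)) = e \<otimes> f" "f \<otimes> (e \<otimes> (f \<otimes> e)) = f \<otimes> e"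
    using i[THEN idem] ef by (simp_all add: m_assoc)
  have "J (e \<otimes> f) = f \<otimes> e"
    by (rule iinv_eqI) (use ef 1 e f in \<open>simp_all add: m_assoc idem_left\<close>)
  then show ?thesis using i by simp
qed

lemma idems_comm_left:
  assumes "e \<in> idems M" "f \<in> idems M" "a \<in> carrier M"
  shows "e \<otimes> (f \<otimes> a) = f \<otimes> (e \<otimes> a)"
  using assms idems_comm[of e f] by (simp add: m_assoc [symmetric])

lemma iinv_mult [simp]:
  assumes "a \<in> carrier M" "b \<in> carrier M"
  shows "J (a \<otimes> b) = J b \<otimes> J a"
proof -
  \<comment> \<open>The idempotents \<open>b \<otimes> J b\<close> and
    \<open>J a \<otimes> a\<close> commute; written in the right-nested form that
    \<open>m_assoc\<close> produces.\<close>
  have c: "b \<otimes> (J b \<otimes> (J a \<otimes> (a \<otimes> z))) = J a \<otimes> (a \<otimes> (b \<otimes> (J b \<otimes> z)))"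
    if "z \<in> carrier M" for z
    using idems_comm_left[of "b \<otimes> J b" "J a \<otimes> a" z] assms that by (simp add: m_assoc)
  show ?thesis
  proof (rule iinv_eqI)
    show "a \<otimes> b \<otimes> (J b \<otimes> J a) \<otimes> (a \<otimes> b) = a \<otimes> b"
      using assms by (simp add: m_assoc c mult_iinv_mult_left mult_iinv_mult_assoc)
    show "J b \<otimes> J a \<otimes> (a \<otimes> b) \<otimes> (J b \<otimes> J a) = J b \<otimes> J a"
      using assms by (simp add: m_assoc c[symmetric] mult_iinv_mult_left mult_iinv_mult_assoc)
  qed (use assms in auto)
qed

lemma conj_idem:
  assumes "a \<in> carrier M" "e \<in> idems M"
  shows "a \<otimes> e \<otimes> J a \<in> idems M"
proof -
  have "(a \<otimes> e) \<otimes> J (a \<otimes> e) \<in> idems M" using assms by (intro mult_iinv_idem) auto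
  then show ?thesis using assms by (simp add: m_assoc idem_left)
qed

text \<open>Carries an idempotent from the right of \<open>a\<close> to its left, where
  \<open>nat_le\<close> expects it, at the price of conjugating it.\<close>

lemma mult_idem_eq_conj:
  assumes "a \<in> carrier M" "e \<in> idems M"
  shows "a \<otimes> e = a \<otimes> e \<otimes> J a \<otimes> a"
proof -
  have "a \<otimes> e \<otimes> J a \<otimes> a = a \<otimes> (e \<otimes> (J a \<otimes> a))" using assms by (simp add: m_assoc)
  also have "\<dots> = a \<otimes> ((J a \<otimes> a) \<otimes> e)" using assms idems_comm[of e "J a \<otimes> a"] by simp
  also have "\<dots> = a \<otimes> e" using assms by (simp add: m_assoc mult_iinv_mult_left)
  finally show ?thesis by simp
qed

section \<open>The natural partial order and range idempotents\<close>

lemma nat_le_mult_left: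
  assumes "nat_le M x y" "a \<in> carrier M" "y \<in> carrier M"
  shows "nat_le M (a \<otimes> x) (a \<otimes> y)"
proof -
  obtain e where e: "e \<in> idems M" "x = e \<otimes> y" using assms(1) by (auto simp: nat_le_def)
  have "a \<otimes> x = (a \<otimes> e) \<otimes> y" using assms e by (simp add: m_assoc)
  also have "\<dots> = (a \<otimes> e \<otimes> J a) \<otimes> (a \<otimes> y)"
    using assms e mult_idem_eq_conj[of a e] by (metis idems_closed iinv_closed m_assoc m_closed)
  finally show ?thesis using conj_idem[OF assms(2) e(1)] by (auto simp: nat_le_def)
qed

lemma nat_le_iinv:
  assumes "nat_le M x y" "y \<in> carrier M"
  shows "nat_le M (J x) (J y)"
proof -
  obtain e where e: "e \<in> idems M" "x = e \<otimes> y" using assms(1) by (auto simp: nat_le_def)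
  then have "J x = J y \<otimes> e" using assms by simp
  also have "\<dots> = (J y \<otimes> e \<otimes> y) \<otimes> J y"
    using mult_idem_eq_conj[of "J y" e] assms e by simp
  finally show ?thesis using conj_idem[of "J y" e] assms e by (auto simp: nat_le_def)
qed

lemma nat_le_antisym:
  assumes "nat_le M a b" "nat_le M b a" "a \<in> carrier M" "b \<in> carrier M"
  shows "a = b"
proof -
  obtain e f where e: "e \<in> idems M" "a = e \<otimes> b" and f: "f \<in> idems M" "b = f \<otimes> a"
    using assms(1,2) by (auto simp: nat_le_def)
  have "a = e \<otimes> (f \<otimes> a)" using e f by simp
  also have "\<dots> = f \<otimes> (e \<otimes> a)" using idems_comm_left e f assms by simp
  also have "\<dots> = f \<otimes> a" using idem_left[OF e(1) assms(4)] e(2) by simp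
  finally show ?thesis using f by simp
qed

text \<open>The range idempotent of \<open>s\<close> is \<open>s \<otimes> J s\<close>. For
  idempotent \<open>e\<close>, lying below it means by \<open>le_ran_iff\<close> that
  \<open>e \<otimes> s\<close> is R-related to \<open>e\<close>, that is, a vertex of the
  Schutzenberger graph of \<open>e\<close>.\<close>

definition le_ran :: "'s \<Rightarrow> 's \<Rightarrow> bool" where
  "le_ran e s \<longleftrightarrow> e \<otimes> (s \<otimes> J s) = e"

lemma le_ran_iff:
  assumes "e \<in> idems M" "s \<in> carrier M"
  shows "le_ran e s \<longleftrightarrow> (e \<otimes> s) \<otimes> J (e \<otimes> s) = e"
proof -
  have "(e \<otimes> s) \<otimes> J (e \<otimes> s) = e \<otimes> ((s \<otimes> J s) \<otimes> e)" using assms by (simp add: m_assoc)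
  also have "\<dots> = e \<otimes> (e \<otimes> (s \<otimes> J s))" using assms idems_comm[of e "s \<otimes> J s"] by simp
  also have "\<dots> = e \<otimes> (s \<otimes> J s)" using assms by (simp add: idem_left)
  finally show ?thesis by (simp add: le_ran_def)
qed

lemma le_ran_cong:
  assumes "e \<in> idems M" "s \<in> carrier M" "t \<in> carrier M" "e \<otimes> s = e \<otimes> t"
  shows "le_ran e s \<longleftrightarrow> le_ran e t"
  using assms by (simp add: le_ran_iff)

text \<open>The range of a product lies below that of its first factor. For words: what holds of a
  path holds of its prefixes.\<close>

lemma le_ran_multD:
  assumes "le_ran e (s \<otimes> t)" "e \<in> idems M" "s \<in> carrier M" "t \<in> carrier M"
  shows "le_ran e s"
proof -
  have eq: "e = e \<otimes> (s \<otimes> (t \<otimes> (J t \<otimes> J s)))"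
    using assms by (simp add: le_ran_def m_assoc)
  then have "e \<otimes> (s \<otimes> J s) = e \<otimes> (s \<otimes> (t \<otimes> (J t \<otimes> J s))) \<otimes> (s \<otimes> J s)" by simp
  also have "\<dots> = e \<otimes> (s \<otimes> (t \<otimes> (J t \<otimes> J s)))"
    using assms by (simp add: m_assoc mult_iinv_mult_assoc)
  finally show ?thesis using eq by (simp add: le_ran_def)
qed

text \<open>Since \<open>s \<otimes> t\<close> and \<open>s \<otimes> t \<otimes> J t\<close> have
  the same range, an edge just crossed may be crossed back.\<close>

lemma le_ran_mult_iinv_mult:
  assumes "le_ran e (s \<otimes> t)" "e \<in> idems M" "s \<in> carrier M" "t \<in> carrier M"
  shows "le_ran e (s \<otimes> t \<otimes> J t)"
  using assms by (simp add: le_ran_def m_assoc mult_iinv_mult_left)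

text \<open>Ranges increase with the natural order: for \<open>x = f \<otimes> y\<close> the range
  of \<open>x\<close> is \<open>f\<close> times that of \<open>y\<close>.\<close>

lemma le_ran_nat_le:
  assumes "le_ran e x" "nat_le M x y" "e \<in> idems M" "y \<in> carrier M"
  shows "le_ran e y"
proof -
  obtain f where f: "f \<in> idems M" "x = f \<otimes> y" using assms(2) by (auto simp: nat_le_def)
  define r where "r = y \<otimes> J y"
  have r: "r \<in> idems M" using assms by (simp add: r_def)
  have "x \<otimes> J x = f \<otimes> (r \<otimes> f)" using f assms by (simp add: r_def m_assoc)
  also have "\<dots> = f \<otimes> r" using idems_comm[OF r f(1)] f r by (simp add: idem_left)
  finally have eq: "e = e \<otimes> (f \<otimes> r)" using assms(1) by (simp add: le_ran_def)
  then have "e \<otimes> r = e \<otimes> (f \<otimes> r) \<otimes> r" by simp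
  also have "\<dots> = e \<otimes> (f \<otimes> r)" using assms f r idem[OF r] by (simp add: m_assoc)
  finally show ?thesis using eq by (simp add: le_ran_def r_def)
qed

lemma nat_le_one_idem: "nat_le M a \<one> \<Longrightarrow> a \<in> idems M"
  by (auto simp: nat_le_def)

lemma one_nat_le_eq:
  assumes "nat_le M \<one> b" "b \<in> carrier M" shows "b = \<one>"
proof -
  obtain f where f: "f \<in> idems M" "\<one> = f \<otimes> b" using assms(1) by (auto simp: nat_le_def)
  have "f = f \<otimes> (f \<otimes> b)" using f by (metis idems_closed r_one)
  also have "\<dots> = \<one>" using f assms by (simp add: idem_left)
  finally show ?thesis using f assms by (metis l_one)
qed

end

lemma inverse_monoidI: "is_inverse_monoid M \<Longrightarrow> inverse_monoid M"
  by (simp add: inverse_monoid_def inverse_monoid_axioms_def is_inverse_monoid_def)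

text \<open>A multiplicative map carries the two equations that define the inverse into
  \<open>N\<close>, where they determine it.\<close>

lemma inverse_monoid_hom_iinv:
  assumes "inverse_monoid M" "inverse_monoid N" "f \<in> carrier M \<rightarrow> carrier N"
    and hom: "\<And>a b. a \<in> carrier M \<Longrightarrow> b \<in> carrier M \<Longrightarrow> f (a \<otimes>\<^bsub>M\<^esub> b) = f a \<otimes>\<^bsub>N\<^esub> f b"
    and a: "a \<in> carrier M"
  shows "f (iinv M a) = iinv N (f a)"
proof -
  interpret M: inverse_monoid M by fact
  interpret N: inverse_monoid N by fact
  have c: "f a \<in> carrier N" "f (iinv M a) \<in> carrier N"
    using a assms(3) by (auto dest: funcset_mem)
  have "iinv N (f a) = f (iinv M a)"
    by (rule N.iinv_eqI) (use a c in \<open>simp_all add: hom[symmetric] M.mult_iinv_mult M.iinv_mult_iinv\<close>)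
  then show ?thesis by simp
qed

section \<open>Paths and jumps in the Cayley graph\<close>

text \<open>\<open>Inl a\<close> is an ordinary letter, \<open>Inr v\<close> is the jump \<open>v\<^sup>m\<close>.\<close>

type_synonym 'x elet = "('x + 'x) + ('x + 'x) list"

text \<open>Inversion sends the greatest element over \<open>g\<close> to the greatest one over the
  inverse of \<open>g\<close> (\<open>iinv_mop\<close>), so the inverse of \<open>v^m\<close> is the
  jump along the formal inverse of \<open>v\<close>.\<close>

definition elinv :: "'x elet \<Rightarrow> 'x elet" where
  "elinv x = (case x of Inl a \<Rightarrow> Inl (flip a) | Inr v \<Rightarrow> Inr (rev (map flip v)))"

definition winv :: "'x elet list \<Rightarrow> 'x elet list" where
  "winv w = rev (map elinv w)"

lemma flip_flip [simp]: "flip (flip a) = a"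
  by (simp add: flip_def split: sum.splits)

lemma flip_labels [simp]: "flip a \<in> labels X \<longleftrightarrow> a \<in> labels X"
  by (auto simp: flip_def labels_def split: sum.splits)

lemma words_Cons [simp]: "a # w \<in> words X \<longleftrightarrow> a \<in> labels X \<and> w \<in> words X"
  and words_Nil [simp]: "[] \<in> words X"
  and words_append [simp]: "u @ w \<in> words X \<longleftrightarrow> u \<in> words X \<and> w \<in> words X"
  by (auto simp: words_def)

lemma rev_flip_words [simp]: "w \<in> words X \<Longrightarrow> rev (map flip w) \<in> words X"
  by (auto simp: words_def)

lemma subg_le_refl [simp]: "subg_le A A"
  by (simp add: subg_le_def)

lemma subg_le_trans: "subg_le A B \<Longrightarrow> subg_le B C \<Longrightarrow> subg_le A C"
  by (auto simp: subg_le_def)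

lemma subg_le_antisym: "subg_le A B \<Longrightarrow> subg_le B A \<Longrightarrow> A = B"
  by (auto simp: subg_le_def prod_eq_iff)

lemma gunion_le_iff [simp]: "subg_le (gunion A B) C \<longleftrightarrow> subg_le A C \<and> subg_le B C"
  by (auto simp: subg_le_def gunion_def)

lemma le_gunion [simp]: "subg_le A (gunion A B)" "subg_le B (gunion A B)"
  by (auto simp: subg_le_def gunion_def)

lemma gUnion_le_iff: "subg_le (gUnion D) C \<longleftrightarrow> (\<forall>A\<in>D. subg_le A C)"
  by (auto simp: subg_le_def gUnion_def)

lemma le_gUnion: "A \<in> D \<Longrightarrow> subg_le A (gUnion D)"
  by (auto simp: subg_le_def gUnion_def)

text \<open>Compactness of finite graphs. Vertices and edges are caught by separate members, which
  directedness joins at the end. \<open>A\<close> may be any pair of finite sets, such as two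
  vertices with no path between them.\<close>

lemma finite_le_directed_gUnion:
  assumes "finite_graph A" "subg_le A (gUnion D)" "D \<noteq> {}"
    and directed: "\<And>B C. B \<in> D \<Longrightarrow> C \<in> D \<Longrightarrow> \<exists>E\<in>D. subg_le B E \<and> subg_le C E"
  shows "\<exists>B\<in>D. subg_le A B"
proof -
  have V: "\<exists>B\<in>D. S \<subseteq> fst B" if "finite S" "S \<subseteq> \<Union> (fst ` D)" for S
    using that
  proof (induction S rule: finite_induct)
    case empty
    then show ?case using assms(3) by auto
  next
    case (insert x S)
    then obtain B C where "B \<in> D" "S \<subseteq> fst B" "C \<in> D" "x \<in> fst C" by auto
    with directed[of B C] show ?case by (force simp: subg_le_def)
  qed
  have E: "\<exists>B\<in>D. S \<subseteq> snd B" if "finite S" "S \<subseteq> \<Union> (snd ` D)" for S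
    using that
  proof (induction S rule: finite_induct)
    case empty
    then show ?case using assms(3) by auto
  next
    case (insert x S)
    then obtain B C where "B \<in> D" "S \<subseteq> snd B" "C \<in> D" "x \<in> snd C" by auto
    with directed[of B C] show ?case by (force simp: subg_le_def)
  qed
  obtain B where B: "B \<in> D" "fst A \<subseteq> fst B"
    using V[of "fst A"] assms(1,2) by (auto simp: finite_graph_def subg_le_def gUnion_def)
  obtain C where C: "C \<in> D" "snd A \<subseteq> snd C"
    using E[of "snd A"] assms(1,2) by (auto simp: finite_graph_def subg_le_def gUnion_def)
  obtain E where "E \<in> D" "subg_le B E" "subg_le C E" using directed[OF B(1) C(1)] by blast
  then show ?thesis using B C by (intro bexI[of _ E]) (auto simp: subg_le_def)
qed

text \<open>\<open>L\<close> is either the set of ordinary letters over \<open>X\<close> or the set of these and all jumps;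
  \<open>Inr [] \<in> L\<close> distinguishes the second case.\<close>

locale cayley = group G for G :: "('g, 'b) monoid_scheme" (structure) +
  fixes \<iota> :: "'x \<Rightarrow> 'g" and X :: "'x set" and L :: "'x elet set"
  assumes gens: "\<iota> ` X \<subseteq> carrier G" and generated: "generate G (\<iota> ` X) = carrier G"
    and Inl_L [simp]: "Inl a \<in> L \<longleftrightarrow> a \<in> labels X"
    and Inr_L_words: "Inr v \<in> L \<Longrightarrow> v \<in> words X"
    and Inr_L: "Inr u \<in> L \<Longrightarrow> v \<in> words X \<Longrightarrow> Inr v \<in> L"
begin

definition W :: "'x elet list set" where "W = lists L"

lemma W_simps [simp]:
  "[] \<in> W" "x # w \<in> W \<longleftrightarrow> x \<in> L \<and> w \<in> W" "u @ w \<in> W \<longleftrightarrow> u \<in> W \<and> w \<in> W"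
  by (auto simp: W_def)

lemma map_Inl_W [simp]: "map Inl u \<in> W \<longleftrightarrow> u \<in> words X"
  by (induction u) auto

lemma W_map_Inl:
  assumes "\<And>v. Inr v \<notin> L" "w \<in> W" shows "\<exists>u\<in>words X. w = map Inl u"
  using assms(2)
proof (induction w)
  case (Cons x w)
  then obtain u where u: "u \<in> words X" "w = map Inl u" by auto
  obtain a where "x = Inl a" "a \<in> labels X" using Cons.prems assms(1) by (cases x) auto
  then show ?case using u by (intro bexI[of _ "a # u"]) auto
qed simp

lemma elinv_L [simp]: "x \<in> L \<Longrightarrow> elinv x \<in> L"
  by (cases x) (auto simp: elinv_def dest: Inr_L_words intro: Inr_L rev_flip_words)

lemma winv_W [simp]: "w \<in> W \<Longrightarrow> winv w \<in> W"
  by (induction w) (auto simp: winv_def)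

abbreviation lv :: "'x + 'x \<Rightarrow> 'g" where "lv \<equiv> lval G \<iota>"

definition gl :: "'x elet \<Rightarrow> 'g" where
  "gl x = (case x of Inl a \<Rightarrow> lv a | Inr v \<Rightarrow> wval G \<iota> v)"

primrec gv :: "'x elet list \<Rightarrow> 'g" where
  "gv [] = \<one>"
| "gv (x # w) = gl x \<otimes> gv w"

lemma lval_closed [simp]: "a \<in> labels X \<Longrightarrow> lv a \<in> carrier G"
  using gens by (auto simp: lval_def labels_def)

lemma lval_flip [simp]: "a \<in> labels X \<Longrightarrow> lv (flip a) = inv (lv a)"
  using gens by (auto simp: lval_def labels_def flip_def)

lemma wval_simps [simp]:
  "wval G \<iota> [] = \<one>" "wval G \<iota> (a # w) = lv a \<otimes> wval G \<iota> w"
  by (simp_all add: wval_def)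

lemma wval_closed [simp]: "w \<in> words X \<Longrightarrow> wval G \<iota> w \<in> carrier G"
  by (induction w) auto

lemma wval_append [simp]:
  "u \<in> words X \<Longrightarrow> w \<in> words X \<Longrightarrow> wval G \<iota> (u @ w) = wval G \<iota> u \<otimes> wval G \<iota> w"
  by (induction u) (auto simp: m_assoc)

lemma wval_rev_flip [simp]:
  "w \<in> words X \<Longrightarrow> wval G \<iota> (rev (map flip w)) = inv (wval G \<iota> w)"
  by (induction w) (auto simp: inv_mult_group)

lemma gv_map_Inl [simp]: "gv (map Inl w) = wval G \<iota> w"
  by (induction w) (auto simp: gl_def)

text \<open>Supplies the label of a jump between any two given vertices.\<close>

lemma ex_word:
  assumes "g \<in> carrier G" shows "\<exists>w\<in>words X. wval G \<iota> w = g"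
proof -
  have "g \<in> generate G (\<iota> ` X)" using assms generated by simp
  then show ?thesis
  proof (induction rule: generate.induct)
    case one
    then show ?case by (intro bexI[of _ "[]"]) auto
  next
    case (incl h)
    then obtain x where "x \<in> X" "h = \<iota> x" by auto
    then show ?case using gens by (intro bexI[of _ "[Inl x]"]) (auto simp: lval_def labels_def)
  next
    case (inv h)
    then obtain x where "x \<in> X" "h = \<iota> x" by auto
    then show ?case using gens by (intro bexI[of _ "[Inr x]"]) (auto simp: lval_def labels_def)
  next
    case (eng h1 h2)
    then obtain u v where "u \<in> words X" "v \<in> words X" "wval G \<iota> u = h1" "wval G \<iota> v = h2" by auto
    then show ?case by (intro bexI[of _ "u @ v"]) auto
  qed
qed

lemma gl_closed [simp]: "x \<in> L \<Longrightarrow> gl x \<in> carrier G"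
  by (cases x) (auto simp: gl_def Inr_L_words)

lemma gv_closed [simp]: "w \<in> W \<Longrightarrow> gv w \<in> carrier G"
  by (induction w) auto

lemma gv_append [simp]: "u \<in> W \<Longrightarrow> w \<in> W \<Longrightarrow> gv (u @ w) = gv u \<otimes> gv w"
  by (induction u) (auto simp: m_assoc)

lemma gl_elinv [simp]: "x \<in> L \<Longrightarrow> gl (elinv x) = inv (gl x)"
  by (cases x) (auto simp: gl_def elinv_def Inr_L_words)

lemma winv_simps [simp]: "winv [] = []" "winv (x # w) = winv w @ [elinv x]"
  by (simp_all add: winv_def)

lemma gv_winv [simp]: "w \<in> W \<Longrightarrow> gv (winv w) = inv (gv w)"
  by (induction w) (auto simp: inv_mult_group)

text \<open>The graph swept out by the path (or journey) labelled \<open>w\<close> from \<open>g\<close>; a jump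
  \<open>v\<^sup>m\<close> contributes its end points only.\<close>

definition ledges :: "'g \<Rightarrow> 'x elet \<Rightarrow> ('g \<times> ('x + 'x)) set" where
  "ledges g x = (case x of Inl a \<Rightarrow> {(g, a), (g \<otimes> lv a, flip a)} | Inr v \<Rightarrow> {})"

primrec pverts :: "'g \<Rightarrow> 'x elet list \<Rightarrow> 'g set" where
  "pverts g [] = {g}"
| "pverts g (x # w) = insert g (pverts (g \<otimes> gl x) w)"

primrec pedges :: "'g \<Rightarrow> 'x elet list \<Rightarrow> ('g \<times> ('x + 'x)) set" where
  "pedges g [] = {}"
| "pedges g (x # w) = ledges g x \<union> pedges (g \<otimes> gl x) w"

definition pgraph :: "'g \<Rightarrow> 'x elet list \<Rightarrow> ('g, 'x) graph" where
  "pgraph g w = (pverts g w, pedges g w)"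

lemma fst_pgraph [simp]: "fst (pgraph g w) = pverts g w"
  and snd_pgraph [simp]: "snd (pgraph g w) = pedges g w"
  by (simp_all add: pgraph_def)

lemma start_in_pverts [simp]: "g \<in> pverts g w"
  by (cases w) auto

lemma end_in_pverts [simp]: "g \<in> carrier G \<Longrightarrow> w \<in> W \<Longrightarrow> g \<otimes> gv w \<in> pverts g w"
  by (induction w arbitrary: g) (auto simp: m_assoc [symmetric])

lemma finite_pgraph [simp]: "finite_graph (pgraph g w)"
proof -
  have "finite (pverts g w)" by (induction w arbitrary: g) auto
  moreover have "finite (pedges g w)"
    by (induction w arbitrary: g) (auto simp: ledges_def split: sum.splits)
  ultimately show ?thesis by (simp add: finite_graph_def)
qed

lemma pverts_closed: "g \<in> carrier G \<Longrightarrow> w \<in> W \<Longrightarrow> pverts g w \<subseteq> carrier G"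
  by (induction w arbitrary: g) auto

lemma pedges_closed: "g \<in> carrier G \<Longrightarrow> w \<in> W \<Longrightarrow> pedges g w \<subseteq> cayley_edges G X"
proof (induction w arbitrary: g)
  case (Cons x w)
  then show ?case by (cases x) (auto simp: ledges_def cayley_edges_def)
qed simp

lemma is_subgraph_pgraph [simp]:
  assumes "g \<in> carrier G" "w \<in> W" shows "is_subgraph G \<iota> X (pgraph g w)"
proof -
  have "\<forall>e\<in>pedges g w. fst e \<in> pverts g w \<and> etgt G \<iota> e \<in> pverts g w \<and> einv G \<iota> e \<in> pedges g w"
    using assms
  proof (induction w arbitrary: g)
    case (Cons x w)
    then have "g \<otimes> gl x \<in> carrier G" by auto
    note IH = Cons.IH[OF this]
    show ?case
    proof (cases x)
      case (Inl a)
      then show ?thesis using IH Cons.prems start_in_pverts[of "g \<otimes> lv a" w]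
        by (auto simp: ledges_def etgt_def einv_def gl_def m_assoc)
    next
      case (Inr v)
      then show ?thesis using IH Cons.prems by (auto simp: ledges_def)
    qed
  qed simp
  moreover have "pverts g w \<noteq> {}" using start_in_pverts[of g w] by blast
  ultimately show ?thesis
    using assms by (simp add: is_subgraph_def pverts_closed pedges_closed)
qed

lemma pverts_append [simp]:
  "g \<in> carrier G \<Longrightarrow> u \<in> W \<Longrightarrow> w \<in> W \<Longrightarrow> pverts g (u @ w) = pverts g u \<union> pverts (g \<otimes> gv u) w"
  by (induction u arbitrary: g) (auto simp: m_assoc)

lemma pedges_append [simp]:
  "g \<in> carrier G \<Longrightarrow> u \<in> W \<Longrightarrow> w \<in> W \<Longrightarrow> pedges g (u @ w) = pedges g u \<union> pedges (g \<otimes> gv u) w"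
  by (induction u arbitrary: g) (auto simp: m_assoc)

lemma pgraph_append:
  "g \<in> carrier G \<Longrightarrow> u \<in> W \<Longrightarrow> w \<in> W \<Longrightarrow>
     pgraph g (u @ w) = gunion (pgraph g u) (pgraph (g \<otimes> gv u) w)"
  by (simp add: pgraph_def gunion_def)

lemma ledges_elinv: "g \<in> carrier G \<Longrightarrow> x \<in> L \<Longrightarrow> ledges (g \<otimes> gl x) (elinv x) = ledges g x"
  by (cases x) (auto simp: ledges_def elinv_def gl_def m_assoc)

text \<open>Reading a word backwards retraces its graph, because \<open>ledges\<close> contains both
  orientations of an edge. Hence the loop \<open>w @ winv w\<close> sweeps out no more than
  \<open>w\<close> while its group value is 1; it is the source of the idempotents and coverings
  below.\<close>

lemma pgraph_winv:
  assumes "g \<in> carrier G" "w \<in> W" shows "pgraph (g \<otimes> gv w) (winv w) = pgraph g w"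
  using assms
proof (induction w arbitrary: g)
  case Nil
  then show ?case by simp
next
  case (Cons x w)
  then have x: "x \<in> L" "w \<in> W" "g \<otimes> gl x \<in> carrier G" by auto
  have *: "g \<otimes> gl x \<otimes> gv w \<otimes> inv (gv w) = g \<otimes> gl x" "g \<otimes> gl x \<otimes> inv (gl x) = g"
    using x Cons.prems by (simp_all add: m_assoc)
  have IH: "pgraph (g \<otimes> gl x \<otimes> gv w) (winv w) = pgraph (g \<otimes> gl x) w"
    by (rule Cons.IH) (use x in auto)
  have "pgraph (g \<otimes> gv (x # w)) (winv (x # w)) =
      gunion (pgraph (g \<otimes> gl x \<otimes> gv w) (winv w)) (pgraph (g \<otimes> gl x \<otimes> gv w \<otimes> inv (gv w)) [elinv x])"
    using x Cons.prems pgraph_append[of "g \<otimes> gl x \<otimes> gv w" "winv w" "[elinv x]"]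
    by (simp add: m_assoc)
  also have "\<dots> = gunion (pgraph (g \<otimes> gl x) w) (pgraph (g \<otimes> gl x) [elinv x])"
    by (simp only: IH *)
  also have "\<dots> = pgraph g (x # w)"
    using x Cons.prems * by (auto simp: pgraph_def gunion_def ledges_elinv)
  finally show ?case .
qed

lemma gtrans_pgraph:
  assumes "k \<in> carrier G" "g \<in> carrier G" "w \<in> W"
  shows "gtrans G k (pgraph g w) = pgraph (k \<otimes> g) w"
proof -
  have "(\<lambda>v. k \<otimes> v) ` pverts g w = pverts (k \<otimes> g) w"
    using assms(2,3) by (induction w arbitrary: g) (use assms(1) in \<open>auto simp: m_assoc\<close>)
  moreover have "(\<lambda>(v, a). (k \<otimes> v, a)) ` ledges g x = ledges (k \<otimes> g) x"
    if "g \<in> carrier G" "x \<in> L" for g x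
    using that assms(1) by (cases x) (auto simp: ledges_def m_assoc)
  then have "(\<lambda>(v, a). (k \<otimes> v, a)) ` pedges g w = pedges (k \<otimes> g) w"
    using assms(2,3) by (induction w arbitrary: g) (use assms(1) in \<open>simp_all add: m_assoc image_Un\<close>)
  ultimately show ?thesis by (simp add: gtrans_def pgraph_def)
qed

lemma pverts_split:
  assumes "h \<in> pverts g w" "g \<in> carrier G" "w \<in> W"
  shows "\<exists>p q. w = p @ q \<and> p \<in> W \<and> q \<in> W \<and> h = g \<otimes> gv p"
  using assms
proof (induction w arbitrary: g)
  case Nil
  then show ?case by auto
next
  case (Cons x w)
  show ?case
  proof (cases "h = g")
    case True
    then show ?thesis using Cons.prems by (intro exI[of _ "[]"] exI[of _ "x # w"]) auto
  next
    case False
    then have "h \<in> pverts (g \<otimes> gl x) w" using Cons.prems by auto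
    from Cons.IH[OF this] Cons.prems obtain p q
      where "w = p @ q" "p \<in> W" "q \<in> W" "h = g \<otimes> gl x \<otimes> gv p" by auto
    then show ?thesis using Cons.prems
      by (intro exI[of _ "x # p"] exI[of _ q]) (auto simp: m_assoc)
  qed
qed

text \<open>A path over an edge also sweeps out the inverse edge, so the letter \<open>c\<close>
  responsible for the edge is its label or the flipped label; in the latter case the edge starts
  where that letter ends.\<close>

lemma pedges_split:
  assumes "(h, a) \<in> pedges g w" "g \<in> carrier G" "w \<in> W"
  shows "\<exists>p q c. w = p @ Inl c # q \<and> p \<in> W \<and> q \<in> W \<and> c \<in> labels X \<and>
    (c = a \<and> h = g \<otimes> gv p \<or> c = flip a \<and> h = g \<otimes> gv p \<otimes> lv c)"
  using assms
proof (induction w arbitrary: g)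
  case Nil
  then show ?case by auto
next
  case (Cons x w)
  show ?case
  proof (cases "(h, a) \<in> ledges g x")
    case True
    then obtain c where "x = Inl c" "c = a \<and> h = g \<or> c = flip a \<and> h = g \<otimes> lv c"
      by (auto simp: ledges_def split: sum.splits)
    then show ?thesis using Cons.prems by (intro exI[of _ "[]"] exI[of _ w] exI[of _ c]) auto
  next
    case False
    then have "(h, a) \<in> pedges (g \<otimes> gl x) w" using Cons.prems by auto
    from Cons.IH[OF this] Cons.prems obtain p q c
      where "w = p @ Inl c # q" "p \<in> W" "q \<in> W" "c \<in> labels X"
       "c = a \<and> h = g \<otimes> gl x \<otimes> gv p \<or> c = flip a \<and> h = g \<otimes> gl x \<otimes> gv p \<otimes> lv c" by auto
    then show ?thesis using Cons.prems
      by (intro exI[of _ "x # p"] exI[of _ q] exI[of _ c]) (auto simp: m_assoc)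
  qed
qed

section \<open>Connectivity by words over \<open>L\<close>\<close>

definition reach :: "('g, 'x) graph \<Rightarrow> 'g \<Rightarrow> 'g \<Rightarrow> bool" where
  "reach \<Delta> g h \<longleftrightarrow> (\<exists>w\<in>W. subg_le (pgraph g w) \<Delta> \<and> h = g \<otimes> gv w)"

text \<open>Without jumps in \<open>L\<close> these are the connected subgraphs; with jumps any two vertices
  are joined, so these are all subgraphs.\<close>

definition LSub :: "('g, 'x) graph set" where
  "LSub = {\<Delta>. is_subgraph G \<iota> X \<Delta> \<and> (\<forall>g\<in>fst \<Delta>. \<forall>h\<in>fst \<Delta>. reach \<Delta> g h)}"

lemma subgraph_verts: "is_subgraph G \<iota> X \<Delta> \<Longrightarrow> g \<in> fst \<Delta> \<Longrightarrow> g \<in> carrier G"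
  by (auto simp: is_subgraph_def)

lemma subgraph_edge:
  assumes "is_subgraph G \<iota> X \<Delta>" "(h, a) \<in> snd \<Delta>"
  shows "h \<in> fst \<Delta>" "a \<in> labels X" "h \<otimes> lv a \<in> fst \<Delta>" "(h \<otimes> lv a, flip a) \<in> snd \<Delta>"
proof -
  have e: "(h, a) \<in> cayley_edges G X" using assms by (auto simp: is_subgraph_def)
  have "fst (h, a) \<in> fst \<Delta> \<and> etgt G \<iota> (h, a) \<in> fst \<Delta> \<and> einv G \<iota> (h, a) \<in> snd \<Delta>"
    using assms unfolding is_subgraph_def by blast
  then show "h \<in> fst \<Delta>" "a \<in> labels X" "h \<otimes> lv a \<in> fst \<Delta>" "(h \<otimes> lv a, flip a) \<in> snd \<Delta>"
    using e by (auto simp: cayley_edges_def etgt_def einv_def)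
qed

lemma subgraphI:
  assumes "k \<in> fst \<Delta>" "\<And>h. h \<in> fst \<Delta> \<Longrightarrow> h \<in> carrier G"
    and "\<And>h a. (h, a) \<in> snd \<Delta> \<Longrightarrow>
      h \<in> fst \<Delta> \<and> a \<in> labels X \<and> h \<otimes> lv a \<in> fst \<Delta> \<and> (h \<otimes> lv a, flip a) \<in> snd \<Delta>"
  shows "is_subgraph G \<iota> X \<Delta>"
proof -
  have "snd \<Delta> \<subseteq> cayley_edges G X" using assms(2,3) by (auto simp: cayley_edges_def)
  moreover have "\<forall>e\<in>snd \<Delta>. fst e \<in> fst \<Delta> \<and> etgt G \<iota> e \<in> fst \<Delta> \<and> einv G \<iota> e \<in> snd \<Delta>"
    using assms(3) by (auto simp: etgt_def einv_def)
  ultimately show ?thesis using assms(1,2) by (auto simp: is_subgraph_def)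
qed

lemma reach_mono: "reach \<Delta> g h \<Longrightarrow> subg_le \<Delta> \<Theta> \<Longrightarrow> reach \<Theta> g h"
  by (auto simp: reach_def intro: subg_le_trans)

lemma reach_sym:
  assumes "reach \<Delta> g h" "g \<in> carrier G" shows "reach \<Delta> h g"
proof -
  obtain w where w: "w \<in> W" "subg_le (pgraph g w) \<Delta>" "h = g \<otimes> gv w"
    using assms by (auto simp: reach_def)
  then show ?thesis using assms pgraph_winv[of g w]
    unfolding reach_def by (intro bexI[of _ "winv w"]) (auto simp: m_assoc)
qed

lemma reach_trans:
  assumes "reach \<Delta> g h" "reach \<Delta> h k" "g \<in> carrier G" shows "reach \<Delta> g k"
proof -
  obtain u where u: "u \<in> W" "subg_le (pgraph g u) \<Delta>" "h = g \<otimes> gv u"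
    using assms by (auto simp: reach_def)
  obtain w where w: "w \<in> W" "subg_le (pgraph h w) \<Delta>" "k = h \<otimes> gv w"
    using assms by (auto simp: reach_def)
  show ?thesis using u w assms(3) unfolding reach_def
    by (intro bexI[of _ "u @ w"]) (auto simp: m_assoc pgraph_append)
qed

text \<open>Reachability is symmetric and transitive, so one base vertex suffices.\<close>

lemma LSubI:
  assumes "is_subgraph G \<iota> X \<Delta>" "k \<in> fst \<Delta>" "\<And>h. h \<in> fst \<Delta> \<Longrightarrow> reach \<Delta> k h"
  shows "\<Delta> \<in> LSub"
  unfolding LSub_def using assms subgraph_verts[OF assms(1)]
  by (blast intro: reach_trans reach_sym)

lemma LSub_subgraph: "\<Delta> \<in> LSub \<Longrightarrow> is_subgraph G \<iota> X \<Delta>"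
  by (simp add: LSub_def)

lemma LSub_reach: "\<Delta> \<in> LSub \<Longrightarrow> g \<in> fst \<Delta> \<Longrightarrow> h \<in> fst \<Delta> \<Longrightarrow> reach \<Delta> g h"
  by (simp add: LSub_def)

lemma LSub_verts [simp]: "\<Delta> \<in> LSub \<Longrightarrow> g \<in> fst \<Delta> \<Longrightarrow> g \<in> carrier G"
  by (blast dest: LSub_subgraph subgraph_verts)

lemma LSub_nonempty: "\<Delta> \<in> LSub \<Longrightarrow> \<exists>g. g \<in> fst \<Delta>"
  by (auto simp: LSub_def is_subgraph_def)

lemma is_subgraph_gUnion:
  assumes "D \<noteq> {}" "\<And>A. A \<in> D \<Longrightarrow> is_subgraph G \<iota> X A"
  shows "is_subgraph G \<iota> X (gUnion D)"
proof -
  obtain A where A: "A \<in> D" using assms(1) by blast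
  obtain k where k: "k \<in> fst A" using assms(2)[OF A] by (auto simp: is_subgraph_def)
  show ?thesis
  proof (rule subgraphI[where k = k])
    show "k \<in> fst (gUnion D)" using A k by (auto simp: gUnion_def)
    show "h \<in> carrier G" if h: "h \<in> fst (gUnion D)" for h
    proof -
      obtain B where "B \<in> D" "h \<in> fst B" using h by (auto simp: gUnion_def)
      then show ?thesis using subgraph_verts[OF assms(2)] by blast
    qed
    fix h a assume "(h, a) \<in> snd (gUnion D)"
    then obtain B where B: "B \<in> D" "(h, a) \<in> snd B" by (auto simp: gUnion_def)
    show "h \<in> fst (gUnion D) \<and> a \<in> labels X \<and> h \<otimes> lv a \<in> fst (gUnion D) \<and>
        (h \<otimes> lv a, flip a) \<in> snd (gUnion D)"
      using subgraph_edge[OF assms(2)[OF B(1)] B(2)] le_gUnion[OF B(1)]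
      by (auto simp: subg_le_def)
  qed
qed

lemma gunion_eq: "gunion A B = gUnion {A, B}"
  by (simp add: gunion_def gUnion_def)

lemma reach_pgraph:
  assumes "h \<in> pverts g w" "g \<in> carrier G" "w \<in> W" shows "reach (pgraph g w) g h"
proof -
  obtain p q where "w = p @ q" "p \<in> W" "q \<in> W" "h = g \<otimes> gv p"
    using pverts_split[OF assms] by blast
  then show ?thesis unfolding reach_def using assms
    by (intro bexI[of _ p]) (auto simp: pgraph_append)
qed

text \<open>All members contain \<open>g\<close> and are connected to it. The Schutzenberger graphs
  and the least closed graphs below are built as such unions.\<close>

lemma gUnion_pgraph_LSub:
  assumes "T \<subseteq> W" "T \<noteq> {}" "g \<in> carrier G"
  shows "gUnion (pgraph g ` T) \<in> LSub"
proof (rule LSubI[where k = g])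
  show "is_subgraph G \<iota> X (gUnion (pgraph g ` T))"
    using assms by (intro is_subgraph_gUnion) auto
  show "g \<in> fst (gUnion (pgraph g ` T))" using assms by (auto simp: gUnion_def)
  fix h assume "h \<in> fst (gUnion (pgraph g ` T))"
  then obtain t where t: "t \<in> T" "h \<in> pverts g t" by (auto simp: gUnion_def)
  then have "reach (pgraph g t) g h" using assms by (intro reach_pgraph) auto
  then show "reach (gUnion (pgraph g ` T)) g h"
    by (rule reach_mono) (use t in \<open>auto intro: le_gUnion\<close>)
qed

lemma pgraph_LSub [simp]: "g \<in> carrier G \<Longrightarrow> w \<in> W \<Longrightarrow> pgraph g w \<in> LSub"
  using gUnion_pgraph_LSub[of "{w}" g] by (simp add: gUnion_def pgraph_def)

text \<open>The common vertex \<open>k\<close> keeps the union connected in the case without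
  jumps.\<close>

lemma gunion_LSub:
  assumes "A \<in> LSub" "B \<in> LSub" "k \<in> fst A" "k \<in> fst B" shows "gunion A B \<in> LSub"
proof (rule LSubI[where k = k])
  show "is_subgraph G \<iota> X (gunion A B)"
    unfolding gunion_eq using assms by (intro is_subgraph_gUnion) (auto simp: LSub_subgraph)
  show "k \<in> fst (gunion A B)" using assms by (simp add: gunion_def)
  fix h assume "h \<in> fst (gunion A B)"
  then have "reach A k h \<or> reach B k h" using assms LSub_reach[of A k h] LSub_reach[of B k h] by (auto simp: gunion_def)
  then show "reach (gunion A B) k h" by (auto intro: reach_mono)
qed

section \<open>Translation by group elements\<close>

lemma gtrans_le:
  "subg_le A B \<Longrightarrow> subg_le (gtrans G g A) (gtrans G g B)"
  by (auto simp: subg_le_def gtrans_def)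

lemma gtrans_gtrans:
  assumes "is_subgraph G \<iota> X A" "g \<in> carrier G" "h \<in> carrier G"
  shows "gtrans G g (gtrans G h A) = gtrans G (g \<otimes> h) A"
proof -
  have V: "v \<in> carrier G" if "v \<in> fst A" for v using assms(1) that by (auto simp: is_subgraph_def)
  have E: "v \<in> carrier G" if "(v, a) \<in> snd A" for v a
    using assms(1) that by (auto simp: is_subgraph_def cayley_edges_def)
  show ?thesis unfolding gtrans_def using V E assms(2,3)
    by (auto simp: image_image m_assoc intro!: image_cong split: prod.splits)
qed

lemma gtrans_one:
  assumes "is_subgraph G \<iota> X A"
  shows "gtrans G \<one> A = A"
proof -
  have V: "v \<in> carrier G" if "v \<in> fst A" for v using assms(1) that by (auto simp: is_subgraph_def)
  have E: "v \<in> carrier G" if "(v, a) \<in> snd A" for v a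
    using assms(1) that by (auto simp: is_subgraph_def cayley_edges_def)
  have "(\<lambda>v. \<one> \<otimes> v) ` fst A = (\<lambda>v. v) ` fst A" by (rule image_cong) (use V in auto)
  moreover have "(\<lambda>(v, a). (\<one> \<otimes> v, a)) ` snd A = (\<lambda>v. v) ` snd A" by (rule image_cong) (use E in auto)
  ultimately show ?thesis by (simp add: gtrans_def)
qed

lemma is_subgraph_gtrans:
  assumes "is_subgraph G \<iota> X A" "g \<in> carrier G" shows "is_subgraph G \<iota> X (gtrans G g A)"
proof -
  obtain k where k: "k \<in> fst A" using assms(1) by (auto simp: is_subgraph_def)
  show ?thesis
  proof (rule subgraphI[where k = "g \<otimes> k"])
    show "g \<otimes> k \<in> fst (gtrans G g A)" using k by (simp add: gtrans_def)
    show "h \<in> carrier G" if "h \<in> fst (gtrans G g A)" for h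
      using that assms subgraph_verts[OF assms(1)] by (auto simp: gtrans_def)
    fix h a assume "(h, a) \<in> snd (gtrans G g A)"
    then obtain v where v: "(v, a) \<in> snd A" "h = g \<otimes> v" by (auto simp: gtrans_def)
    note e = subgraph_edge[OF assms(1) v(1)]
    have "h \<otimes> lv a = g \<otimes> (v \<otimes> lv a)"
      using v e assms subgraph_verts[OF assms(1)] by (simp add: m_assoc)
    then show "h \<in> fst (gtrans G g A) \<and> a \<in> labels X \<and> h \<otimes> lv a \<in> fst (gtrans G g A) \<and>
        (h \<otimes> lv a, flip a) \<in> snd (gtrans G g A)"
      using e v by (force simp: gtrans_def)
  qed
qed

lemma gtrans_LSub:
  assumes "A \<in> LSub" "g \<in> carrier G" shows "gtrans G g A \<in> LSub"
proof -
  obtain k where k: "k \<in> fst A" using LSub_nonempty assms by blast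
  show ?thesis
  proof (rule LSubI[where k = "g \<otimes> k"])
    show "is_subgraph G \<iota> X (gtrans G g A)" using assms by (simp add: is_subgraph_gtrans LSub_subgraph)
    show "g \<otimes> k \<in> fst (gtrans G g A)" using k by (simp add: gtrans_def)
    fix h assume "h \<in> fst (gtrans G g A)"
    then obtain h' where h': "h' \<in> fst A" "h = g \<otimes> h'" by (auto simp: gtrans_def)
    obtain w where w: "w \<in> W" "subg_le (pgraph k w) A" "h' = k \<otimes> gv w"
      using LSub_reach[OF assms(1) k h'(1)] by (auto simp: reach_def)
    then show "reach (gtrans G g A) (g \<otimes> k) h"
      unfolding reach_def using gtrans_le[OF w(2), of g] h' k assms
      by (intro bexI[of _ w]) (auto simp: gtrans_pgraph m_assoc)
  qed
qed

lemma gtrans_le_iff: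
  assumes "is_subgraph G \<iota> X A" "is_subgraph G \<iota> X B" "g \<in> carrier G"
  shows "subg_le (gtrans G g A) B \<longleftrightarrow> subg_le A (gtrans G (inv g) B)"
proof
  assume "subg_le (gtrans G g A) B"
  from gtrans_le[OF this, of "inv g"] show "subg_le A (gtrans G (inv g) B)"
    using assms by (simp add: gtrans_gtrans gtrans_one)
next
  assume "subg_le A (gtrans G (inv g) B)"
  from gtrans_le[OF this, of "g"] show "subg_le (gtrans G g A) B"
    using assms by (simp add: gtrans_gtrans gtrans_one)
qed

section \<open>Covering finite graphs by loops\<close>

lemma loop_through_vertex:
  assumes "\<Delta> \<in> LSub" "k \<in> fst \<Delta>" "h \<in> fst \<Delta>"
  shows "\<exists>t\<in>W. subg_le (pgraph k t) \<Delta> \<and> gv t = \<one> \<and> h \<in> pverts k t"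
proof -
  obtain w where w: "w \<in> W" "subg_le (pgraph k w) \<Delta>" "h = k \<otimes> gv w"
    using LSub_reach[OF assms] by (auto simp: reach_def)
  have "k \<in> carrier G" using assms by simp
  then show ?thesis using w pgraph_winv[of k w]
    by (intro bexI[of _ "w @ winv w"]) (auto simp: pgraph_append)
qed

lemma pgraph_edge_le:
  assumes "is_subgraph G \<iota> X \<Delta>" "(h, a) \<in> snd \<Delta>"
  shows "subg_le (pgraph h [Inl a]) \<Delta>"
  using subgraph_edge[OF assms] assms(2) by (auto simp: subg_le_def ledges_def gl_def)

lemma loop_through_edge:
  assumes "\<Delta> \<in> LSub" "k \<in> fst \<Delta>" "(h, a) \<in> snd \<Delta>"
  shows "\<exists>t\<in>W. subg_le (pgraph k t) \<Delta> \<and> gv t = \<one> \<and> (h, a) \<in> pedges k t"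
proof -
  note e = subgraph_edge[OF LSub_subgraph[OF assms(1)] assms(3)]
  obtain w where w: "w \<in> W" "subg_le (pgraph k w) \<Delta>" "h = k \<otimes> gv w"
    using LSub_reach[OF assms(1,2) e(1)] by (auto simp: reach_def)
  have k: "k \<in> carrier G" using assms by simp
  define t where "t = w @ [Inl a]"
  have t: "t \<in> W" using w e by (simp add: t_def)
  have "subg_le (pgraph k t) \<Delta>" "(h, a) \<in> pedges k t"
    using w e k pgraph_edge_le[OF LSub_subgraph[OF assms(1)] assms(3)]
    by (simp_all add: t_def pgraph_append) (simp add: ledges_def)
  then show ?thesis using t k pgraph_winv[of k t]
    by (intro bexI[of _ "t @ winv t"]) (auto simp: pgraph_append)
qed

text \<open>For a possibly disconnected \<open>F\<close>, loops at \<open>k\<close> through its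
  vertices and edges are concatenated. The condition \<open>gv t = \<one>\<close> brings each loop
  back to \<open>k\<close>, where the next one starts and where a path to any vertex can be appended
  later.\<close>

lemma finite_cover:
  assumes "\<Delta> \<in> LSub" "k \<in> fst \<Delta>" "finite_graph F" "subg_le F \<Delta>"
  shows "\<exists>t\<in>W. subg_le (pgraph k t) \<Delta> \<and> gv t = \<one> \<and> subg_le F (pgraph k t)"
proof -
  have k: "k \<in> carrier G" using assms by simp
  have V: "\<exists>t\<in>W. subg_le (pgraph k t) \<Delta> \<and> gv t = \<one> \<and> A \<subseteq> pverts k t"
    if "finite A" "A \<subseteq> fst \<Delta>" for A
    using that
  proof (induction A rule: finite_induct)
    case empty
    show ?case using assms by (intro bexI[of _ "[]"]) (auto simp: subg_le_def)
  next
    case (insert h A)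
    then obtain t where "t \<in> W" "subg_le (pgraph k t) \<Delta>" "gv t = \<one>" "A \<subseteq> pverts k t" by auto
    moreover obtain u where "u \<in> W" "subg_le (pgraph k u) \<Delta>" "gv u = \<one>" "h \<in> pverts k u"
      using loop_through_vertex[OF assms(1,2), of h] insert by auto
    ultimately show ?case using k by (intro bexI[of _ "t @ u"]) (auto simp: pgraph_append)
  qed
  have E: "\<exists>t\<in>W. subg_le (pgraph k t) \<Delta> \<and> gv t = \<one> \<and> A \<subseteq> pedges k t"
    if "finite A" "A \<subseteq> snd \<Delta>" for A
    using that
  proof (induction A rule: finite_induct)
    case empty
    show ?case using assms by (intro bexI[of _ "[]"]) (auto simp: subg_le_def)
  next
    case (insert e A)
    then obtain t where "t \<in> W" "subg_le (pgraph k t) \<Delta>" "gv t = \<one>" "A \<subseteq> pedges k t" by auto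
    moreover obtain u where "u \<in> W" "subg_le (pgraph k u) \<Delta>" "gv u = \<one>" "e \<in> pedges k u"
      using loop_through_edge[OF assms(1,2), of "fst e" "snd e"] insert by auto
    ultimately show ?case using k by (intro bexI[of _ "t @ u"]) (auto simp: pgraph_append)
  qed
  obtain t where t: "t \<in> W" "subg_le (pgraph k t) \<Delta>" "gv t = \<one>" "fst F \<subseteq> pverts k t"
    using V[of "fst F"] assms by (auto simp: finite_graph_def subg_le_def)
  obtain u where u: "u \<in> W" "subg_le (pgraph k u) \<Delta>" "gv u = \<one>" "snd F \<subseteq> pedges k u"
    using E[of "snd F"] assms by (auto simp: finite_graph_def subg_le_def)
  show ?thesis
    by (rule bexI[of _ "t @ u"]) (use t u k in \<open>auto simp: pgraph_append subg_le_def gunion_def\<close>)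
qed

end

section \<open>The monoid of a closure operator\<close>

definition elval :: "'s monoid \<Rightarrow> ('x \<Rightarrow> 's) \<Rightarrow> 'x elet \<Rightarrow> 's" where
  "elval M \<iota> x = (case x of Inl a \<Rightarrow> letter M \<iota> a | Inr v \<Rightarrow> mop M (weval M \<iota> v))"

primrec eev :: "'s monoid \<Rightarrow> ('x \<Rightarrow> 's) \<Rightarrow> 'x elet list \<Rightarrow> 's" where
  "eev M \<iota> [] = \<one>\<^bsub>M\<^esub>"
| "eev M \<iota> (x # w) = elval M \<iota> x \<otimes>\<^bsub>M\<^esub> eev M \<iota> w"

lemma weval_simps [simp]:
  "weval M \<iota> [] = \<one>\<^bsub>M\<^esub>" "weval M \<iota> (a # w) = letter M \<iota> a \<otimes>\<^bsub>M\<^esub> weval M \<iota> w"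
  by (simp_all add: weval_def)

lemma weval_eq_eev: "weval M \<iota> w = eev M \<iota> (map Inl w)"
  by (induction w) (auto simp: elval_def)

lemma weval_in_invgen:
  assumes "w \<in> words X" shows "weval M \<iota> w \<in> invgen M \<iota> X"
proof -
  have "letter M \<iota> a \<in> invgen M \<iota> X" if "a \<in> labels X" for a
    using that invgen.gen[of _ X \<iota> M] invgen.inv[OF invgen.gen[of _ X \<iota> M]]
    by (auto simp: letter_def labels_def)
  then show ?thesis using assms by (induction w) (auto intro: invgen.one invgen.mult)
qed

lemma weval_in_Fgen:
  assumes "w \<in> words X" shows "weval M \<iota> w \<in> Fgen M \<iota> X"
proof -
  have "letter M \<iota> a \<in> Fgen M \<iota> X" if "a \<in> labels X" for a
    using that Fgen.gen[of _ X \<iota> M] Fgen.inv[OF Fgen.gen[of _ X \<iota> M]]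
    by (auto simp: letter_def labels_def)
  then show ?thesis using assms by (induction w) (auto intro: Fgen.one Fgen.mult)
qed

lemma gunion_idem [simp]: "gunion A A = A"
  by (simp add: gunion_def)

lemma (in inverse_monoid) mop_eqI:
  assumes "b \<in> carrier M" "sigma M a b" "\<And>c. c \<in> carrier M \<Longrightarrow> sigma M a c \<Longrightarrow> nat_le M c b"
  shows "mop M a = b"
  unfolding mop_def using assms by (blast intro: nat_le_antisym)

lemma (in inverse_monoid) invgen_closed:
  assumes "\<iota> ` X \<subseteq> carrier M" shows "invgen M \<iota> X \<subseteq> carrier M"
proof
  fix a assume "a \<in> invgen M \<iota> X"
  then show "a \<in> carrier M" by induction (use assms in auto)
qed

lemma (in inverse_monoid) Fgen_closed:
  assumes "\<iota> ` X \<subseteq> carrier M" "\<And>a. a \<in> carrier M \<Longrightarrow> mop M a \<in> carrier M"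
  shows "Fgen M \<iota> X \<subseteq> carrier M"
proof
  fix a assume "a \<in> Fgen M \<iota> X"
  then show "a \<in> carrier M" by induction (use assms in auto)
qed

context cayley
begin

text \<open>The closed graphs of the closure operator \<open>c\<^sub>S\<close>, with \<open>lpath\<close> and \<open>journey\<close>
  replaced by containment of the traversed graph.\<close>

definition clsd :: "'s monoid \<Rightarrow> ('x \<Rightarrow> 's) \<Rightarrow> ('g, 'x) graph \<Rightarrow> bool" where
  "clsd M \<iota>M \<Delta> \<longleftrightarrow> (\<forall>u\<in>W. \<forall>v\<in>W. eev M \<iota>M u = eev M \<iota>M v \<longrightarrow>
     (\<forall>g\<in>fst \<Delta>. subg_le (pgraph g u) \<Delta> \<longrightarrow> subg_le (pgraph g v) \<Delta>))"

definition cl :: "'s monoid \<Rightarrow> ('x \<Rightarrow> 's) \<Rightarrow> ('g, 'x) graph \<Rightarrow> ('g, 'x) graph" where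
  "cl M \<iota>M \<Delta> = (THE \<Theta>. \<Theta> \<in> LSub \<and> subg_le \<Delta> \<Theta> \<and> clsd M \<iota>M \<Theta> \<and>
      (\<forall>\<Theta>'\<in>LSub. subg_le \<Delta> \<Theta>' \<and> clsd M \<iota>M \<Theta>' \<longrightarrow> subg_le \<Theta> \<Theta>'))"

lemma cl_eqI:
  assumes "\<Theta> \<in> LSub" "subg_le \<Delta> \<Theta>" "clsd M \<iota>M \<Theta>"
    and "\<And>\<Theta>'. \<Theta>' \<in> LSub \<Longrightarrow> subg_le \<Delta> \<Theta>' \<Longrightarrow> clsd M \<iota>M \<Theta>' \<Longrightarrow> subg_le \<Theta> \<Theta>'"
  shows "cl M \<iota>M \<Delta> = \<Theta>"
  unfolding cl_def using assms by (blast intro: subg_le_antisym)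

text \<open>Moves the base point of a path to 1, where the graphs of elements of \<open>S_c\<close>
  are based.\<close>

lemma pgraph_le_gtrans_iff:
  assumes "g \<in> carrier G" "w \<in> W" "is_subgraph G \<iota> X \<Delta>"
  shows "subg_le (pgraph \<one> w) (gtrans G (inv g) \<Delta>) \<longleftrightarrow> subg_le (pgraph g w) \<Delta>"
  using gtrans_le_iff[of "pgraph \<one> w" \<Delta> g] assms by (simp add: gtrans_pgraph)

lemma pgraph_loop:
  assumes "g \<in> carrier G" "w \<in> W"
  shows "pgraph g (w @ winv w) = pgraph g w"
    and "gv (w @ winv w) = \<one>"
  using assms pgraph_winv[OF assms] by (simp_all add: pgraph_append)

end

locale cayley_closure = cayley G \<iota> X L
  for G :: "('g, 'b) monoid_scheme" (structure) and \<iota> :: "'x \<Rightarrow> 'g" and X L +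
  fixes c :: "('g, 'x) graph \<Rightarrow> ('g, 'x) graph"
  assumes closure: "closure_op LSub c" and invariant: "G_invariant G LSub c" and finitary: "finitary LSub c"
begin

section \<open>Rules for the closure operator\<close>

lemma c_LSub [simp]: "\<Delta> \<in> LSub \<Longrightarrow> c \<Delta> \<in> LSub"
  using closure by (simp add: closure_op_def)

lemma c_ext [simp]: "\<Delta> \<in> LSub \<Longrightarrow> subg_le \<Delta> (c \<Delta>)"
  using closure by (simp add: closure_op_def)

lemma c_mono: "\<Delta> \<in> LSub \<Longrightarrow> \<Theta> \<in> LSub \<Longrightarrow> subg_le \<Delta> \<Theta> \<Longrightarrow> subg_le (c \<Delta>) (c \<Theta>)"
  using closure by (simp add: closure_op_def)

lemma c_idem [simp]: "\<Delta> \<in> LSub \<Longrightarrow> c (c \<Delta>) = c \<Delta>"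
  using closure by (simp add: closure_op_def)

lemma c_gtrans: "\<Delta> \<in> LSub \<Longrightarrow> g \<in> carrier G \<Longrightarrow> c (gtrans G g \<Delta>) = gtrans G g (c \<Delta>)"
  using invariant by (simp add: G_invariant_def)

lemma c_le_iff: "\<Delta> \<in> LSub \<Longrightarrow> \<Theta> \<in> LSub \<Longrightarrow> subg_le (c \<Delta>) (c \<Theta>) \<longleftrightarrow> subg_le \<Delta> (c \<Theta>)"
  using c_mono[of \<Delta> "c \<Theta>"] c_ext[of \<Delta>] subg_le_trans[of \<Delta> "c \<Delta>" "c \<Theta>"] by auto

text \<open>Both sides are the least closed graph above \<open>A\<close> and \<open>B\<close>. The
  common vertex \<open>k\<close> puts both unions into \<open>LSub\<close>, where the closure axioms
  apply.\<close>

lemma c_gunion: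
  assumes "A \<in> LSub" "B \<in> LSub" "k \<in> fst A" "k \<in> fst B"
  shows "c (gunion (c A) (c B)) = c (gunion A B)"
proof (rule subg_le_antisym)
  have k: "k \<in> fst (c A)" "k \<in> fst (c B)" using assms c_ext[of A] c_ext[of B] by (auto simp: subg_le_def)
  have P: "gunion A B \<in> LSub" "gunion (c A) (c B) \<in> LSub"
    using assms k by (auto intro: gunion_LSub)
  show "subg_le (c (gunion (c A) (c B))) (c (gunion A B))"
    using assms P c_ext[OF P(1), unfolded gunion_le_iff] by (simp add: c_le_iff)
  show "subg_le (c (gunion A B)) (c (gunion (c A) (c B)))"
    using assms P c_ext[OF P(2), unfolded gunion_le_iff] c_ext[OF assms(1)] c_ext[OF assms(2)]
      subg_le_trans[of _ "c A"] subg_le_trans[of _ "c B"]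
    by (metis c_le_iff gunion_le_iff)
qed

text \<open>By \<open>eev_Sc\<close> this is the value of the word \<open>t\<close> at the
  generators of \<open>S_c\<close>.\<close>

definition E :: "'x elet list \<Rightarrow> ('g, 'x) graph \<times> 'g" where
  "E t = (c (pgraph \<one> t), gv t)"

abbreviation N :: "(('g, 'x) graph \<times> 'g) monoid" where
  "N \<equiv> Sc LSub G c"

lemma snd_E [simp]: "snd (E t) = gv t"
  by (simp add: E_def)

lemma E_cong: "pgraph \<one> t = pgraph \<one> u \<Longrightarrow> gv t = gv u \<Longrightarrow> E t = E u"
  by (simp add: E_def)

lemma carrier_Sc: "carrier N = E ` W"
proof (intro equalityI subsetI)
  fix a assume "a \<in> carrier N"
  then obtain F g where a: "a = (c F, g)" "g \<in> carrier G" "F \<in> LSub" "finite_graph F"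
    "\<one> \<in> fst (c F)" "g \<in> fst (c F)"
    by (auto simp: Sc_def)
  \<comment> \<open>The graph \<open>F\<close> may miss 1 and \<open>g\<close>, but
    \<open>c F\<close> contains both. A loop \<open>t\<close> at 1 inside \<open>c F\<close> covers
    \<open>F\<close>, and a path \<open>w\<close> inside \<open>c F\<close> leads on to
    \<open>g\<close>; the graph of \<open>t @ w\<close> lies between \<open>F\<close> and
    \<open>c F\<close>, so its closure is \<open>c F\<close>.\<close>
  obtain t where t: "t \<in> W" "subg_le (pgraph \<one> t) (c F)" "gv t = \<one>" "subg_le F (pgraph \<one> t)"
    using finite_cover[of "c F" \<one> F] a by auto
  obtain w where w: "w \<in> W" "subg_le (pgraph \<one> w) (c F)" "g = \<one> \<otimes> gv w"
    using LSub_reach[of "c F" \<one> g] a by (auto simp: reach_def)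
  have le: "subg_le (pgraph \<one> (t @ w)) (c F)" "subg_le F (pgraph \<one> (t @ w))"
    using t w by (auto simp: pgraph_append intro: subg_le_trans)
  have P: "pgraph \<one> (t @ w) \<in> LSub" using t w by simp
  have "c (pgraph \<one> (t @ w)) = c F"
  proof (rule subg_le_antisym)
    show "subg_le (c (pgraph \<one> (t @ w))) (c F)" using le P a by (simp only: c_le_iff)
    show "subg_le (c F) (c (pgraph \<one> (t @ w)))" using le P a by (intro c_mono)
  qed
  then have "a = E (t @ w)" using t w a by (simp add: E_def)
  then show "a \<in> E ` W" using t w by simp
next
  fix a assume "a \<in> E ` W"
  then obtain t where t: "t \<in> W" "a = E t" by auto
  have "subg_le (pgraph \<one> t) (c (pgraph \<one> t))" using t by simp
  then have "\<one> \<in> fst (c (pgraph \<one> t))" "gv t \<in> fst (c (pgraph \<one> t))"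
    using t start_in_pverts[of \<one> t] end_in_pverts[of \<one> t] by (auto simp: subg_le_def)
  then show "a \<in> carrier N" using t by (auto simp: Sc_def E_def intro: bexI[of _ "pgraph \<one> t"])
qed

lemma E_closed [simp]: "t \<in> W \<Longrightarrow> E t \<in> carrier N"
  by (simp add: carrier_Sc)

lemma E_mult [simp]:
  assumes "t \<in> W" "u \<in> W" shows "E t \<otimes>\<^bsub>N\<^esub> E u = E (t @ u)"
proof -
  have "c (gunion (c (pgraph \<one> t)) (gtrans G (gv t) (c (pgraph \<one> u)))) =
      c (gunion (c (pgraph \<one> t)) (c (pgraph (gv t) u)))"
    using assms by (simp add: c_gtrans [symmetric] gtrans_pgraph)
  also have "\<dots> = c (gunion (pgraph \<one> t) (pgraph (gv t) u))"
    using assms end_in_pverts[of \<one> t] by (intro c_gunion[where k = "gv t"]) auto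
  also have "\<dots> = c (pgraph \<one> (t @ u))" using assms by (simp add: pgraph_append)
  finally show ?thesis using assms by (simp add: E_def Sc_def)
qed

lemma one_Sc: "\<one>\<^bsub>N\<^esub> = E []"
  by (simp add: Sc_def E_def pgraph_def)

text \<open>The laws are inherited from concatenation of words through
  \<open>E_mult\<close>.\<close>

lemma monoid_Sc: "monoid N"
  by (rule monoidI) (auto simp: carrier_Sc one_Sc)

lemma E_winv:
  assumes "t \<in> W" shows "E (t @ winv t @ t) = E t" and "E (winv t @ t @ winv t) = E (winv t)"
proof -
  have w: "winv t \<in> W" using assms by simp
  have 1: "pgraph (gv t) (winv t) = pgraph \<one> t" using pgraph_winv[of \<one> t] assms by simp
  have 2: "pgraph (inv (gv t)) t = pgraph \<one> (winv t)" using pgraph_winv[of "inv (gv t)" t] assms by simp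
  show "E (t @ winv t @ t) = E t"
    using assms w 1 by (intro E_cong) (simp_all add: pgraph_append gunion_def)
  show "E (winv t @ t @ winv t) = E (winv t)"
    using assms w 2 by (intro E_cong) (simp_all add: pgraph_append gunion_def)
qed

text \<open>In \<open>t @ u @ t\<close> the word \<open>u\<close> is read from \<open>gv t\<close>;
  translating back to 1 puts its graph into the closure of that of \<open>winv t\<close>. In
  \<open>u @ t @ u\<close> the word \<open>t\<close> is read from the inverse of \<open>gv t\<close>
  and sweeps out the graph of \<open>winv t\<close>, which gives the other inclusion.\<close>

lemma E_inverse_unique:
  assumes t: "t \<in> W" and u: "u \<in> W" and 1: "E (t @ u @ t) = E t" and 2: "E (u @ t @ u) = E u"
  shows "E u = E (winv t)"
proof -
  have "gv t \<otimes> (gv u \<otimes> gv t) = gv t" using 1 t u by (simp add: E_def)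
  then have "gv u \<otimes> gv t = \<one>" using t u by simp
  then have gu: "gv u = inv (gv t)" using t u inv_equality by simp
  have winv: "pgraph (inv (gv t)) t = pgraph \<one> (winv t)" using pgraph_winv[of "inv (gv t)" t] t by simp
  have "subg_le (pgraph \<one> (t @ u @ t)) (c (pgraph \<one> t))"
    using 1 t u c_ext[of "pgraph \<one> (t @ u @ t)"] by (simp add: E_def)
  then have "subg_le (pgraph (gv t) u) (c (pgraph \<one> t))"
    using t u by (simp add: pgraph_append)
  then have "subg_le (pgraph \<one> u) (gtrans G (inv (gv t)) (c (pgraph \<one> t)))"
    using t u by (simp add: pgraph_le_gtrans_iff LSub_subgraph)
  also have "gtrans G (inv (gv t)) (c (pgraph \<one> t)) = c (pgraph \<one> (winv t))"
    using t winv by (simp add: c_gtrans [symmetric] gtrans_pgraph)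
  finally have le1: "subg_le (c (pgraph \<one> u)) (c (pgraph \<one> (winv t)))"
    using t u by (simp add: c_le_iff)
  have "subg_le (pgraph \<one> (u @ t @ u)) (c (pgraph \<one> u))"
    using 2 t u c_ext[of "pgraph \<one> (u @ t @ u)"] by (simp add: E_def)
  then have "subg_le (pgraph \<one> (winv t)) (c (pgraph \<one> u))"
    using t u gu winv by (simp add: pgraph_append)
  then have "subg_le (c (pgraph \<one> (winv t))) (c (pgraph \<one> u))"
    using t u by (simp add: c_le_iff)
  with le1 have "c (pgraph \<one> u) = c (pgraph \<one> (winv t))" by (rule subg_le_antisym)
  then show ?thesis using gu t by (simp add: E_def)
qed

lemma is_inverse_monoid_Sc: "is_inverse_monoid N"
  unfolding is_inverse_monoid_def
proof (intro conjI ballI monoid_Sc)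
  fix a assume "a \<in> carrier N"
  then obtain t where t: "t \<in> W" "a = E t" by (auto simp: carrier_Sc)
  show "\<exists>!b. b \<in> carrier N \<and> a \<otimes>\<^bsub>N\<^esub> b \<otimes>\<^bsub>N\<^esub> a = a \<and> b \<otimes>\<^bsub>N\<^esub> a \<otimes>\<^bsub>N\<^esub> b = b"
  proof (rule ex1I[of _ "E (winv t)"])
    show "E (winv t) \<in> carrier N \<and> a \<otimes>\<^bsub>N\<^esub> E (winv t) \<otimes>\<^bsub>N\<^esub> a = a \<and>
        E (winv t) \<otimes>\<^bsub>N\<^esub> a \<otimes>\<^bsub>N\<^esub> E (winv t) = E (winv t)"
      using t E_winv[of t] by simp
    fix b assume b: "b \<in> carrier N \<and> a \<otimes>\<^bsub>N\<^esub> b \<otimes>\<^bsub>N\<^esub> a = a \<and> b \<otimes>\<^bsub>N\<^esub> a \<otimes>\<^bsub>N\<^esub> b = b"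
    then obtain u where u: "u \<in> W" "b = E u" by (auto simp: carrier_Sc)
    then show "b = E (winv t)" using b t E_inverse_unique[of t u] by simp
  qed
qed

sublocale N: inverse_monoid N
  by (rule inverse_monoidI, rule is_inverse_monoid_Sc)

lemma iinv_E: "t \<in> W \<Longrightarrow> iinv N (E t) = E (winv t)"
  by (rule N.iinv_eqI) (auto simp: E_winv)

text \<open>Repeating a loop sweeps out nothing new, and in a group only 1 is idempotent.\<close>

lemma E_idem_iff: assumes "t \<in> W" shows "E t \<in> idems N \<longleftrightarrow> gv t = \<one>"
proof
  assume "E t \<in> idems N"
  then have "E (t @ t) = E t" using N.idem[of "E t"] assms by simp
  then have "gv (t @ t) = gv t" by (metis snd_E)
  then show "gv t = \<one>" using assms by simp
next
  assume "gv t = \<one>"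
  then have "E (t @ t) = E t" using assms by (intro E_cong) (simp_all add: pgraph_append gunion_def)
  then show "E t \<in> idems N" using assms by (intro N.idemsI) auto
qed

lemma sigma_E_iff:
  assumes "t \<in> W" "u \<in> W" shows "sigma N (E t) (E u) \<longleftrightarrow> gv t = gv u"
proof
  assume "sigma N (E t) (E u)"
  then obtain e where e: "e \<in> idems N" "e \<otimes>\<^bsub>N\<^esub> E t = e \<otimes>\<^bsub>N\<^esub> E u"
    by (auto simp: sigma_def)
  then obtain i where i: "i \<in> W" "e = E i" using N.idems_closed[OF e(1)] by (auto simp: carrier_Sc)
  then have "gv (i @ t) = gv (i @ u)" using e assms by (metis E_mult snd_E)
  then show "gv t = gv u" using i assms by simp
next
  assume g: "gv t = gv u"
  \<comment> \<open>A loop over both graphs: after multiplication by \<open>E i\<close> either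
    element has the closure of their union as its graph.\<close>
  define i where "i = (t @ winv t) @ (u @ winv u)"
  have i: "i \<in> W" "gv i = \<one>" using assms by (auto simp: i_def)
  have pi: "pgraph \<one> i = gunion (pgraph \<one> t) (pgraph \<one> u)"
    using assms pgraph_loop[of \<one> t] pgraph_loop[of \<one> u]
    unfolding i_def by (subst pgraph_append) auto
  have "E (i @ t) = E (i @ u)"
    using i assms g pi by (intro E_cong) (auto simp: pgraph_append gunion_def)
  then show "sigma N (E t) (E u)"
    unfolding sigma_def using i assms E_idem_iff by (intro bexI[of _ "E i"]) auto
qed

lemma E_unitary_Sc: "E_unitary N"
  unfolding E_unitary_def
proof (intro ballI impI)
  fix e s assume a: "e \<in> idems N" "s \<in> carrier N" "e \<otimes>\<^bsub>N\<^esub> s \<in> idems N"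
  then obtain i t where t: "i \<in> W" "t \<in> W" "e = E i" "s = E t" using N.idems_closed[OF a(1)]
    by (auto simp: carrier_Sc)
  then show "s \<in> idems N" using a E_idem_iff[of i] E_idem_iff[of t] E_idem_iff[of "i @ t"] by simp
qed

text \<open>The graph of \<open>[Inr v]\<close> consists of the vertices 1 and
  \<open>wval G \<iota> v\<close> only. Every word of that group value sweeps out both, so the loop
  \<open>u @ winv u\<close> followed by the jump sweeps out just the graph of
  \<open>u\<close>.\<close>

lemma nat_le_E:
  assumes "u \<in> W" "Inr v \<in> L" "gv u = wval G \<iota> v"
  shows "nat_le N (E u) (E [Inr v])"
proof -
  have v: "v \<in> words X" using assms Inr_L_words by auto
  have "E ((u @ winv u) @ [Inr v]) = E u"
  proof (rule E_cong)
    have "\<one> \<in> pverts \<one> u" "wval G \<iota> v \<in> pverts \<one> u"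
      using assms v end_in_pverts[of \<one> u] by auto
    then show "pgraph \<one> ((u @ winv u) @ [Inr v]) = pgraph \<one> u"
      using assms v pgraph_loop[of \<one> u] by (subst pgraph_append) (auto simp: pgraph_def gunion_def gl_def ledges_def)
    show "gv ((u @ winv u) @ [Inr v]) = gv u" using assms v by (simp add: gl_def)
  qed
  moreover have "E (u @ winv u) \<in> idems N" using E_idem_iff[of "u @ winv u"] assms v by simp
  ultimately show ?thesis unfolding nat_le_def using assms
    by (intro bexI[of _ "E (u @ winv u)"]) auto
qed

text \<open>This is the prescribed formula for \<open>^m\<close> in \<open>S_c\<close>: the graph of
  \<open>[Inr v]\<close> is the bare pair of vertices 1 and \<open>g\<close>, where \<open>g\<close>
  is the group value.\<close>

lemma mop_E:
  assumes "t \<in> W" "Inr v \<in> L" "gv t = wval G \<iota> v"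
  shows "mop N (E t) = E [Inr v]"
proof (rule N.mop_eqI)
  have v: "v \<in> words X" using assms Inr_L_words by auto
  show "E [Inr v] \<in> carrier N" using assms by simp
  show "sigma N (E t) (E [Inr v])" using assms v by (simp add: sigma_E_iff gl_def)
  fix a assume "a \<in> carrier N" "sigma N (E t) a"
  then show "nat_le N a (E [Inr v])" using assms by (auto simp: carrier_Sc sigma_E_iff intro: nat_le_E)
qed

lemma F_inverse_Sc:
  assumes "Inr [] \<in> L" shows "F_inverse N"
  unfolding F_inverse_def
proof
  fix a assume "a \<in> carrier N"
  then obtain t where t: "t \<in> W" "a = E t" by (auto simp: carrier_Sc)
  obtain v where v: "v \<in> words X" "wval G \<iota> v = gv t" using ex_word[of "gv t"] t by auto
  then have L: "Inr v \<in> L" using assms Inr_L by blast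
  show "\<exists>b\<in>carrier N. sigma N a b \<and> (\<forall>d\<in>carrier N. sigma N a d \<longrightarrow> nat_le N d b)"
    using t v L nat_le_E by (intro bexI[of _ "E [Inr v]"]) (auto simp: sigma_E_iff gl_def carrier_Sc)
qed

section \<open>Generators of the monoid and values of words\<close>

abbreviation gen :: "'x \<Rightarrow> ('g, 'x) graph \<times> 'g" where
  "gen \<equiv> Sc_gen G \<iota> c"

lemma gen_eq: "x \<in> X \<Longrightarrow> gen x = E [Inl (Inl x)]"
  using gens by (auto simp: Sc_gen_def E_def pgraph_def ledges_def gl_def lval_def flip_def)

lemma letter_Sc: "a \<in> labels X \<Longrightarrow> letter N gen a = E [Inl a]"
  by (auto simp: labels_def letter_def gen_eq iinv_E elinv_def flip_def)

lemma weval_Sc: "w \<in> words X \<Longrightarrow> weval N gen w = E (map Inl w)"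
  by (induction w) (auto simp: one_Sc letter_Sc)

lemma eev_Sc: "w \<in> W \<Longrightarrow> eev N gen w = E w"
proof (induction w)
  case Nil
  then show ?case by (simp add: one_Sc)
next
  case (Cons x w)
  have "elval N gen x = E [x]"
  proof (cases x)
    case (Inl a)
    then show ?thesis using Cons.prems by (simp add: elval_def letter_Sc)
  next
    case (Inr v)
    then have "v \<in> words X" using Cons.prems Inr_L_words by auto
    then show ?thesis using Inr Cons.prems by (simp add: elval_def weval_Sc mop_E)
  qed
  then show ?case using Cons by simp
qed

lemma gen_closed: "gen ` X \<subseteq> carrier N"
  by (auto simp: gen_eq labels_def)

lemma group_image_Sc: "group_image_is G \<iota> X N gen"
  unfolding group_image_is_def
proof (intro exI[of _ snd] conjI ballI)
  show "snd \<in> carrier N \<rightarrow> carrier G" by (auto simp: carrier_Sc)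
  show "snd (a \<otimes>\<^bsub>N\<^esub> b) = snd a \<otimes> snd b" if "a \<in> carrier N" "b \<in> carrier N" for a b
    using that by (auto simp: carrier_Sc)
  show "snd \<one>\<^bsub>N\<^esub> = \<one>" by (simp add: one_Sc)
  show "snd ` carrier N = carrier G"
  proof
    show "snd ` carrier N \<subseteq> carrier G" by (auto simp: carrier_Sc)
    show "carrier G \<subseteq> snd ` carrier N"
    proof
      fix g assume "g \<in> carrier G"
      then obtain w where w: "w \<in> words X" "wval G \<iota> w = g" using ex_word by blast
      then have "g = snd (E (map Inl w))" by simp
      then show "g \<in> snd ` carrier N" using w by (intro image_eqI[of _ _ "E (map Inl w)"]) auto
    qed
  qed
  show "snd (gen x) = \<iota> x" if "x \<in> X" for x by (simp add: Sc_gen_def)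
  show "snd a = snd b \<longleftrightarrow> sigma N a b" if "a \<in> carrier N" "b \<in> carrier N" for a b
    using that by (auto simp: carrier_Sc sigma_E_iff)
qed

text \<open>Here finitarity enters: for a graph closed under the equations of \<open>S_c\<close> it
  reduces the claim to \<open>c F\<close> lying in \<open>\<Delta>\<close> for finite
  \<open>F\<close> in \<open>\<Delta>\<close>. The converse moves the base point to 1, where equal
  elements of \<open>S_c\<close> have equal closures.\<close>

lemma clsd_Sc_iff:
  assumes D: "\<Delta> \<in> LSub" shows "clsd N gen \<Delta> \<longleftrightarrow> c \<Delta> = \<Delta>"
proof
  assume cD: "c \<Delta> = \<Delta>"
  show "clsd N gen \<Delta>"
    unfolding clsd_def
  proof (intro ballI impI)
    fix u v g assume u: "u \<in> W" and v: "v \<in> W" and eq: "eev N gen u = eev N gen v"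
      and g: "g \<in> fst \<Delta>" and le: "subg_le (pgraph g u) \<Delta>"
    have gc: "g \<in> carrier G" using g D by simp
    define \<Theta> where "\<Theta> = gtrans G (inv g) \<Delta>"
    have T: "\<Theta> \<in> LSub" "c \<Theta> = \<Theta>" using D gc cD by (simp_all add: \<Theta>_def gtrans_LSub c_gtrans)
    have "subg_le (pgraph \<one> u) \<Theta>"
      using le gc u D by (simp add: \<Theta>_def pgraph_le_gtrans_iff LSub_subgraph)
    then have "subg_le (c (pgraph \<one> u)) \<Theta>" using c_le_iff[of "pgraph \<one> u" \<Theta>] T u by simp
    moreover have "c (pgraph \<one> u) = c (pgraph \<one> v)" using eq u v by (simp add: eev_Sc E_def)
    moreover have "subg_le (pgraph \<one> v) (c (pgraph \<one> v))" using v by simp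
    ultimately have "subg_le (pgraph \<one> v) \<Theta>" by (metis subg_le_trans)
    then show "subg_le (pgraph g v) \<Delta>"
      using gc v D by (simp add: \<Theta>_def pgraph_le_gtrans_iff LSub_subgraph)
  qed
next
  assume cl: "clsd N gen \<Delta>"
  have "subg_le (c F) \<Delta>" if F: "F \<in> LSub" "finite_graph F" "subg_le F \<Delta>" for F
  proof -
    obtain g where g: "g \<in> fst F" using LSub_nonempty F by blast
    have gc: "g \<in> carrier G" "g \<in> fst \<Delta>" using g F by (auto simp: subg_le_def)
    obtain t where t: "t \<in> W" "subg_le (pgraph g t) F" "gv t = \<one>" "subg_le F (pgraph g t)"
      using finite_cover[of F g F] F g by auto
    \<comment> \<open>The covering loop stays inside \<open>F\<close>, so \<open>F\<close> is itself
      the graph of a word.\<close>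
    have Ft: "F = pgraph g t" using t subg_le_antisym by blast
    have tr: "c (pgraph g w) = gtrans G g (c (pgraph \<one> w))" if "w \<in> W" for w
      using that gc by (simp add: c_gtrans [symmetric] gtrans_pgraph)
    \<comment> \<open>A loop between \<open>F\<close> and \<open>c F\<close> has the same closure as
      \<open>t\<close>, hence the same value in \<open>S_c\<close>; closedness of
      \<open>\<Delta>\<close> then passes from \<open>t\<close> to \<open>u\<close>.\<close>
    have *: "subg_le (pgraph g u) \<Delta>" if u: "u \<in> W" "gv u = \<one>" "subg_le (pgraph g u) (c F)"
      "subg_le F (pgraph g u)" for u
    proof -
      have "c (pgraph g u) = c (pgraph g t)"
      proof (rule subg_le_antisym)
        show "subg_le (c (pgraph g u)) (c (pgraph g t))" using u gc F Ft by (simp add: c_le_iff)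
        show "subg_le (c (pgraph g t)) (c (pgraph g u))" using u gc F Ft by (simp add: c_mono)
      qed
      then have "gtrans G (inv g) (gtrans G g (c (pgraph \<one> u))) =
          gtrans G (inv g) (gtrans G g (c (pgraph \<one> t)))" using tr u t by simp
      then have "c (pgraph \<one> u) = c (pgraph \<one> t)"
        using u t gc by (simp add: gtrans_gtrans LSub_subgraph gtrans_one)
      then have "eev N gen t = eev N gen u" using u t by (simp add: eev_Sc E_def)
      then show ?thesis using cl F(3) Ft t(1) u(1) gc(2) unfolding clsd_def by blast
    qed
    have gcF: "g \<in> fst (c F)" using c_ext[OF F(1)] g by (auto simp: subg_le_def)
    \<comment> \<open>Joining \<open>F\<close> to \<open>A\<close> makes the covering loop contain
      \<open>F\<close>, as \<open>*\<close> demands.\<close>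
    have sub: "\<exists>u\<in>W. subg_le (pgraph g u) \<Delta> \<and> subg_le A (pgraph g u)"
      if A: "finite_graph A" "subg_le A (c F)" for A
    proof -
      have "finite_graph (gunion F A)" "subg_le (gunion F A) (c F)"
        using A F by (simp_all add: finite_graph_def) (simp_all add: gunion_def)
      from finite_cover[OF _ gcF this] F obtain u where
        "u \<in> W" "subg_le (pgraph g u) (c F)" "gv u = \<one>" "subg_le (gunion F A) (pgraph g u)" by auto
      then show ?thesis using * by auto
    qed
    have "fst (c F) \<subseteq> fst \<Delta>"
    proof
      fix h assume "h \<in> fst (c F)"
      then show "h \<in> fst \<Delta>" using sub[of "({h}, {})"] by (auto simp: finite_graph_def subg_le_def)
    qed
    moreover have "snd (c F) \<subseteq> snd \<Delta>"
    proof
      fix e assume "e \<in> snd (c F)"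
      then show "e \<in> snd \<Delta>" using sub[of "({}, {e})"] by (auto simp: finite_graph_def subg_le_def)
    qed
    ultimately show ?thesis by (simp add: subg_le_def)
  qed
  then have "subg_le (gUnion (c ` {F \<in> LSub. finite_graph F \<and> subg_le F \<Delta>})) \<Delta>"
    unfolding gUnion_le_iff by blast
  moreover have "c \<Delta> = gUnion (c ` {F \<in> LSub. finite_graph F \<and> subg_le F \<Delta>})"
    using finitary D unfolding finitary_def by (rule bspec)
  ultimately have "subg_le (c \<Delta>) \<Delta>" by simp
  then show "c \<Delta> = \<Delta>" using D by (intro subg_le_antisym) auto
qed

lemma cl_Sc:
  assumes "\<Delta> \<in> LSub" shows "cl N gen \<Delta> = c \<Delta>"
proof (rule cl_eqI)
  show "c \<Delta> \<in> LSub" "subg_le \<Delta> (c \<Delta>)" "clsd N gen (c \<Delta>)" using assms by (simp_all add: clsd_Sc_iff)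
  show "subg_le (c \<Delta>) \<Theta>" if "\<Theta> \<in> LSub" "subg_le \<Delta> \<Theta>" "clsd N gen \<Theta>" for \<Theta>
    using that assms by (metis c_mono clsd_Sc_iff)
qed

lemma carrier_eq_invgen:
  assumes "\<And>v. Inr v \<notin> L" shows "carrier N = invgen N gen X"
proof
  show "invgen N gen X \<subseteq> carrier N" by (rule N.invgen_closed) (rule gen_closed)
  show "carrier N \<subseteq> invgen N gen X"
  proof
    fix a assume "a \<in> carrier N"
    then obtain t where t: "t \<in> W" "a = E t" by (auto simp: carrier_Sc)
    obtain w where w: "w \<in> words X" "t = map Inl w" using W_map_Inl[OF assms t(1)] by blast
    then show "a \<in> invgen N gen X" using t w weval_in_invgen[of w X N gen] by (simp add: weval_Sc)
  qed
qed

lemma carrier_eq_Fgen: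
  assumes "Inr [] \<in> L" shows "carrier N = Fgen N gen X"
proof
  show "Fgen N gen X \<subseteq> carrier N"
  proof (rule N.Fgen_closed[OF gen_closed])
    fix a assume "a \<in> carrier N"
    then obtain t where t: "t \<in> W" "a = E t" by (auto simp: carrier_Sc)
    obtain v where v: "v \<in> words X" "wval G \<iota> v = gv t" using ex_word[of "gv t"] t by auto
    then have "Inr v \<in> L" using assms Inr_L by blast
    then show "mop N a \<in> carrier N" using t v mop_E[of t v] by simp
  qed
  show "carrier N \<subseteq> Fgen N gen X"
  proof
    fix a assume "a \<in> carrier N"
    then obtain t where t: "t \<in> W" "a = E t" by (auto simp: carrier_Sc)
    have "eev N gen t \<in> Fgen N gen X" using t(1)
    proof (induction t)
      case Nil
      then show ?case by (auto intro: Fgen.one)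
    next
      case (Cons x t)
      have "elval N gen x \<in> Fgen N gen X"
      proof (cases x)
        case (Inl a)
        then have "weval N gen [a] \<in> Fgen N gen X" using Cons.prems by (intro weval_in_Fgen) simp
        then show ?thesis using Inl Cons.prems by (simp add: weval_Sc elval_def letter_Sc)
      next
        case (Inr v)
        then have "v \<in> words X" using Cons.prems Inr_L_words by auto
        then show ?thesis using Inr by (auto simp: elval_def intro: Fgen.m weval_in_Fgen)
      qed
      then show ?case using Cons by (auto intro: Fgen.mult)
    qed
    then show "a \<in> Fgen N gen X" using t by (simp add: eev_Sc)
  qed
qed

end

section \<open>The closure operator of a monoid\<close>

text \<open>What the closure operator depends on in both cases: \<open>\<phi>\<close> is the map to
  the greatest group image, \<open>\<phi>_pure\<close> is E-unitarity, and
  \<open>mop_greatest\<close> describes \<open>^m\<close> by fibres of \<open>\<phi>\<close> in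
  place of \<open>sigma\<close>. Generation of \<open>S\<close> is added in
  \<open>cayley_obj\<close>.\<close>

locale cayley_image = cayley G \<iota> X L + S: inverse_monoid S
  for G :: "('g, 'b) monoid_scheme" (structure) and \<iota> :: "'x \<Rightarrow> 'g" and X L and S :: "'s monoid" +
  fixes \<iota>S :: "'x \<Rightarrow> 's" and \<phi> :: "'s \<Rightarrow> 'g"
  assumes gen_closed: "x \<in> X \<Longrightarrow> \<iota>S x \<in> carrier S"
    and \<phi>_closed [simp]: "a \<in> carrier S \<Longrightarrow> \<phi> a \<in> carrier G"
    and \<phi>_mult [simp]: "a \<in> carrier S \<Longrightarrow> b \<in> carrier S \<Longrightarrow> \<phi> (a \<otimes>\<^bsub>S\<^esub> b) = \<phi> a \<otimes> \<phi> b"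
    and \<phi>_gen: "x \<in> X \<Longrightarrow> \<phi> (\<iota>S x) = \<iota> x"
    and \<phi>_pure: "a \<in> carrier S \<Longrightarrow> \<phi> a = \<one> \<Longrightarrow> a \<in> idems S"
    and mop_greatest: "Inr [] \<in> L \<Longrightarrow> a \<in> carrier S \<Longrightarrow>
      mop S a \<in> carrier S \<and> \<phi> (mop S a) = \<phi> a \<and> (\<forall>b\<in>carrier S. \<phi> b = \<phi> a \<longrightarrow> nat_le S b (mop S a))"
begin

abbreviation ev :: "'x elet list \<Rightarrow> 's" where "ev \<equiv> eev S \<iota>S"

lemma \<phi>_idem [simp]: "e \<in> idems S \<Longrightarrow> \<phi> e = \<one>"
  using \<phi>_mult[of e e] S.idem[of e] by simp

lemma \<phi>_iinv [simp]:
  assumes "a \<in> carrier S" shows "\<phi> (iinv S a) = inv (\<phi> a)"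
proof -
  have "\<phi> (iinv S a) \<otimes> \<phi> a = \<phi> (iinv S a \<otimes>\<^bsub>S\<^esub> a)"
    using assms by (subst \<phi>_mult) simp_all
  also have "\<dots> = \<one>" using assms by (intro \<phi>_idem) simp
  finally show ?thesis using assms inv_equality[of "\<phi> (iinv S a)" "\<phi> a"] by simp
qed

lemma mop_cong:
  assumes "Inr [] \<in> L" "a \<in> carrier S" "b \<in> carrier S" "\<phi> a = \<phi> b"
  shows "mop S a = mop S b"
  using mop_greatest[OF assms(1,2)] mop_greatest[OF assms(1,3)] assms(4)
  by (intro S.nat_le_antisym) auto

text \<open>Inversion preserves the natural order and exchanges the fibres over
  \<open>\<phi> a\<close> and its inverse, hence also their greatest elements.\<close>

lemma iinv_mop:
  assumes "Inr [] \<in> L" "a \<in> carrier S"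
  shows "iinv S (mop S a) = mop S (iinv S a)"
proof (rule S.nat_le_antisym)
  have ia: "iinv S a \<in> carrier S" using assms by simp
  note A = mop_greatest[OF assms] and B = mop_greatest[OF assms(1) ia]
  show "nat_le S (iinv S (mop S a)) (mop S (iinv S a))" using A B assms by simp
  have "nat_le S (iinv S (mop S (iinv S a))) (mop S a)" using A B assms by simp
  from S.nat_le_iinv[OF this] show "nat_le S (mop S (iinv S a)) (iinv S (mop S a))" using A B by simp
  show "iinv S (mop S a) \<in> carrier S" "mop S (iinv S a) \<in> carrier S" using A B by auto
qed

lemma letter_props:
  assumes "a \<in> labels X"
  shows "letter S \<iota>S a \<in> carrier S" "\<phi> (letter S \<iota>S a) = lv a"
    "iinv S (letter S \<iota>S a) = letter S \<iota>S (flip a)"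
  using assms gen_closed \<phi>_gen by (auto simp: letter_def labels_def lval_def flip_def)

lemma weval_closed: "w \<in> words X \<Longrightarrow> weval S \<iota>S w \<in> carrier S"
  by (induction w) (auto simp: letter_props)

lemma \<phi>_weval: "w \<in> words X \<Longrightarrow> \<phi> (weval S \<iota>S w) = wval G \<iota> w"
  by (induction w) (auto simp: letter_props weval_closed)

lemma weval_append:
  "u \<in> words X \<Longrightarrow> w \<in> words X \<Longrightarrow> weval S \<iota>S (u @ w) = weval S \<iota>S u \<otimes>\<^bsub>S\<^esub> weval S \<iota>S w"
  by (induction u) (auto simp: letter_props weval_closed S.m_assoc)

lemma iinv_weval: "w \<in> words X \<Longrightarrow> iinv S (weval S \<iota>S w) = weval S \<iota>S (rev (map flip w))"
  by (induction w) (auto simp: letter_props weval_closed weval_append)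

lemma elval_props:
  assumes "x \<in> L"
  shows "elval S \<iota>S x \<in> carrier S" "\<phi> (elval S \<iota>S x) = gl x"
    "iinv S (elval S \<iota>S x) = elval S \<iota>S (elinv x)"
proof -
  have "elval S \<iota>S x \<in> carrier S \<and> \<phi> (elval S \<iota>S x) = gl x \<and>
    iinv S (elval S \<iota>S x) = elval S \<iota>S (elinv x)"
  proof (cases x)
    case (Inl a)
    then show ?thesis using assms by (simp add: elval_def gl_def elinv_def letter_props)
  next
    case (Inr v)
    then have v: "v \<in> words X" "Inr [] \<in> L" using assms Inr_L_words[of v] Inr_L[of v "[]"] by auto
    have "mop S (weval S \<iota>S v) \<in> carrier S" "\<phi> (mop S (weval S \<iota>S v)) = wval G \<iota> v"
      using mop_greatest[OF v(2) weval_closed[OF v(1)]] \<phi>_weval[OF v(1)] by simp_all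
    moreover have "iinv S (mop S (weval S \<iota>S v)) = mop S (weval S \<iota>S (rev (map flip v)))"
      using iinv_mop[OF v(2) weval_closed[OF v(1)]] iinv_weval[OF v(1)] by simp
    ultimately show ?thesis using Inr by (simp add: elval_def gl_def elinv_def)
  qed
  then show "elval S \<iota>S x \<in> carrier S" "\<phi> (elval S \<iota>S x) = gl x"
    "iinv S (elval S \<iota>S x) = elval S \<iota>S (elinv x)" by auto
qed

lemma ev_closed [simp]: "w \<in> W \<Longrightarrow> ev w \<in> carrier S"
  by (induction w) (auto simp: elval_props)

lemma \<phi>_ev [simp]: "w \<in> W \<Longrightarrow> \<phi> (ev w) = gv w"
  by (induction w) (auto simp: elval_props)

lemma ev_append [simp]: "u \<in> W \<Longrightarrow> w \<in> W \<Longrightarrow> ev (u @ w) = ev u \<otimes>\<^bsub>S\<^esub> ev w"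
  by (induction u) (auto simp: elval_props S.m_assoc)

lemma ev_winv: "w \<in> W \<Longrightarrow> ev (winv w) = iinv S (ev w)"
  by (induction w) (auto simp: elval_props)

lemma invgen_subset_ev: "invgen S \<iota>S X \<subseteq> ev ` W"
proof
  fix a assume "a \<in> invgen S \<iota>S X"
  then show "a \<in> ev ` W"
  proof induction
    case (gen x)
    then show ?case using gen_closed
      by (intro image_eqI[of _ _ "[Inl (Inl x)]"]) (auto simp: elval_def letter_def labels_def)
  next
    case one
    then show ?case by (intro image_eqI[of _ _ "[]"]) auto
  next
    case (mult a b)
    then obtain u v where "u \<in> W" "v \<in> W" "a = ev u" "b = ev v" by auto
    then show ?case by (intro image_eqI[of _ _ "u @ v"]) auto
  next
    case (inv a)
    then obtain u where "u \<in> W" "a = ev u" by auto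
    then show ?case by (intro image_eqI[of _ _ "winv u"]) (auto simp: ev_winv)
  qed
qed

text \<open>By \<open>mop_cong\<close> only the group image matters, and that is the value of an
  ordinary word. So \<open>mop\<close> of a value containing jumps is a single jump, and nesting
  \<open>^m\<close> yields nothing new.\<close>

lemma mop_ev:
  assumes "Inr [] \<in> L" "u \<in> W"
  shows "\<exists>v. Inr v \<in> L \<and> wval G \<iota> v = gv u \<and> mop S (ev u) = ev [Inr v]"
proof -
  obtain v where v: "v \<in> words X" "wval G \<iota> v = gv u" using ex_word[of "gv u"] assms by auto
  then have L: "Inr v \<in> L" using assms Inr_L by blast
  have "mop S (ev u) = mop S (weval S \<iota>S v)"
    by (rule mop_cong) (use assms v in \<open>auto simp: weval_closed \<phi>_weval\<close>)
  also have "\<dots> = ev [Inr v]"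
    using mop_greatest[OF assms(1) weval_closed[OF v(1)]] by (simp add: elval_def)
  finally show ?thesis using v L by blast
qed

lemma Fgen_subset_ev:
  assumes "Inr [] \<in> L" shows "Fgen S \<iota>S X \<subseteq> ev ` W"
proof
  fix a assume "a \<in> Fgen S \<iota>S X"
  then show "a \<in> ev ` W"
  proof induction
    case (gen x)
    then show ?case using gen_closed
      by (intro image_eqI[of _ _ "[Inl (Inl x)]"]) (auto simp: elval_def letter_def labels_def)
  next
    case one
    then show ?case by (intro image_eqI[of _ _ "[]"]) auto
  next
    case (mult a b)
    then obtain u v where "u \<in> W" "v \<in> W" "a = ev u" "b = ev v" by auto
    then show ?case by (intro image_eqI[of _ _ "u @ v"]) auto
  next
    case (inv a)
    then obtain u where "u \<in> W" "a = ev u" by auto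
    then show ?case by (intro image_eqI[of _ _ "winv u"]) (auto simp: ev_winv)
  next
    case (m a)
    then obtain u where u: "u \<in> W" "a = ev u" by auto
    then obtain v where "Inr v \<in> L" "mop S (ev u) = ev [Inr v]" using mop_ev assms by blast
    then show ?case using u by (intro image_eqI[of _ _ "[Inr v]"]) auto
  qed
qed

text \<open>Elements with the same group image are compatible (this is \<open>E\<close>-unitarity), so they
  agree on any idempotent below both their ranges.\<close>

lemma le_ran_eq:
  assumes e: "e \<in> idems S" and s: "s \<in> carrier S" "S.le_ran e s"
    and t: "t \<in> carrier S" "S.le_ran e t" and eq: "\<phi> s = \<phi> t"
  shows "e \<otimes>\<^bsub>S\<^esub> s = e \<otimes>\<^bsub>S\<^esub> t"
proof -
  define i where "i = iinv S s \<otimes>\<^bsub>S\<^esub> t"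
  have i: "i \<in> idems S" unfolding i_def using s t eq by (intro \<phi>_pure) auto
  have "iinv S i = iinv S t \<otimes>\<^bsub>S\<^esub> s" using s t by (simp add: i_def)
  then have i': "i = iinv S t \<otimes>\<^bsub>S\<^esub> s" using i by simp
  have "e \<otimes>\<^bsub>S\<^esub> t = e \<otimes>\<^bsub>S\<^esub> (s \<otimes>\<^bsub>S\<^esub> iinv S s) \<otimes>\<^bsub>S\<^esub> t" using s by (simp add: S.le_ran_def)
  then have 1: "e \<otimes>\<^bsub>S\<^esub> t = e \<otimes>\<^bsub>S\<^esub> s \<otimes>\<^bsub>S\<^esub> i" using e s t by (simp add: i_def S.m_assoc)
  have "e \<otimes>\<^bsub>S\<^esub> s = e \<otimes>\<^bsub>S\<^esub> (t \<otimes>\<^bsub>S\<^esub> iinv S t) \<otimes>\<^bsub>S\<^esub> s" using t by (simp add: S.le_ran_def)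
  then have "e \<otimes>\<^bsub>S\<^esub> s = e \<otimes>\<^bsub>S\<^esub> t \<otimes>\<^bsub>S\<^esub> i" using e s t by (simp add: i' S.m_assoc)
  also have "\<dots> = e \<otimes>\<^bsub>S\<^esub> s \<otimes>\<^bsub>S\<^esub> i" unfolding 1 using e s i S.idem[OF i] by (simp add: S.m_assoc)
  finally show ?thesis using 1 by simp
qed

text \<open>By \<open>le_ran_eq\<close> the words \<open>t\<close> of this set with a common end
  vertex share the product of \<open>e\<close> and \<open>ev t\<close>; the vertices thus stand for
  the elements R-related to \<open>e\<close> that words reach from \<open>e\<close>.\<close>

definition schutz :: "'s \<Rightarrow> ('g, 'x) graph" where
  "schutz e = gUnion (pgraph \<one> ` {t \<in> W. S.le_ran e (ev t)})"

lemma le_schutz: "t \<in> W \<Longrightarrow> S.le_ran e (ev t) \<Longrightarrow> subg_le (pgraph \<one> t) (schutz e)"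
  unfolding schutz_def by (rule le_gUnion) auto

lemma schutz_LSub:
  assumes "e \<in> idems S" shows "schutz e \<in> LSub"
  unfolding schutz_def
proof (rule gUnion_pgraph_LSub)
  have "[] \<in> {t \<in> W. S.le_ran e (ev t)}" using assms by (simp add: S.le_ran_def)
  then show "{t \<in> W. S.le_ran e (ev t)} \<noteq> {}" by blast
qed auto

text \<open>A vertex ends a prefix of some \<open>t\<close>, and prefixes inherit the condition by
  \<open>le_ran_multD\<close>.\<close>

lemma schutz_vertex:
  assumes "e \<in> idems S" "g \<in> fst (schutz e)"
  shows "\<exists>p\<in>W. gv p = g \<and> S.le_ran e (ev p)"
proof -
  obtain t where t: "t \<in> W" "S.le_ran e (ev t)" "g \<in> pverts \<one> t"
    using assms(2) by (auto simp: schutz_def gUnion_def)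
  obtain p q where p: "t = p @ q" "p \<in> W" "q \<in> W" "g = \<one> \<otimes> gv p"
    using pverts_split[OF t(3)] t by auto
  then have "S.le_ran e (ev p)" using t assms S.le_ran_multD[of e "ev p" "ev q"] by simp
  then show ?thesis using p by auto
qed

lemma schutz_edge:
  assumes "e \<in> idems S" "(g, a) \<in> snd (schutz e)"
  shows "\<exists>p\<in>W. gv p = g \<and> S.le_ran e (ev (p @ [Inl a]))"
proof -
  obtain t where t: "t \<in> W" "S.le_ran e (ev t)" "(g, a) \<in> pedges \<one> t"
    using assms(2) by (auto simp: schutz_def gUnion_def)
  obtain p q b where p: "t = p @ Inl b # q" "p \<in> W" "q \<in> W" "b \<in> labels X"
    "b = a \<and> g = \<one> \<otimes> gv p \<or> b = flip a \<and> g = \<one> \<otimes> gv p \<otimes> lv b"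
    using pedges_split[OF t(3)] t by auto
  then have tt: "t = (p @ [Inl b]) @ q" by simp
  have pb: "p @ [Inl b] \<in> W" using p by simp
  have b: "S.le_ran e (ev (p @ [Inl b]))"
    using t(2) S.le_ran_multD[OF _ assms(1) ev_closed[OF pb] ev_closed[OF p(3)]]
    unfolding tt ev_append[OF pb p(3)] by blast
  show ?thesis
  proof (cases "b = a \<and> g = \<one> \<otimes> gv p")
    case True
    then show ?thesis using p b by (intro bexI[of _ p]) auto
  next
    case False
    then have f: "b = flip a" "g = gv p \<otimes> lv b" using p by auto
    \<comment> \<open>Here \<open>t\<close> crosses the edge against its direction: it arrives by
      \<open>b\<close> at the vertex where the edge starts. Crossing back reads
      \<open>a\<close>.\<close>
    have ia: "ev [Inl a] = iinv S (ev [Inl b])"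
      using ev_winv[of "[Inl b]"] f p by (simp add: elinv_def)
    have "S.le_ran e (ev p \<otimes>\<^bsub>S\<^esub> ev [Inl b])" using b p by (simp del: eev.simps)
    then have "S.le_ran e (ev p \<otimes>\<^bsub>S\<^esub> ev [Inl b] \<otimes>\<^bsub>S\<^esub> iinv S (ev [Inl b]))"
      using p assms(1) by (intro S.le_ran_mult_iinv_mult) (auto simp del: eev.simps)
    then have "S.le_ran e (ev ((p @ [Inl b]) @ [Inl a]))"
      using p pb f ia by (simp del: eev.simps append_assoc)
    then show ?thesis using pb f p by (intro bexI[of _ "p @ [Inl b]"]) (auto simp: gl_def)
  qed
qed

text \<open>An edge of \<open>schutz e\<close> at the current vertex is witnessed by some word
  \<open>p\<close> to that vertex, in general unrelated to \<open>t\<close>; by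
  \<open>le_ran_eq\<close>, \<open>p\<close> and \<open>t\<close> are interchangeable after
  \<open>e\<close>. Jumps rest on the maximality of \<open>^m\<close> instead.\<close>

lemma le_ran_of_path:
  assumes "e \<in> idems S" "w \<in> W" "t \<in> W" "S.le_ran e (ev t)" "subg_le (pgraph (gv t) w) (schutz e)"
  shows "S.le_ran e (ev (t @ w))"
  using assms(2-)
proof (induction w arbitrary: t)
  case Nil
  then show ?case by simp
next
  case (Cons x w)
  have x: "x \<in> L" "w \<in> W" using Cons.prems by auto
  then have tx: "t @ [x] \<in> W" using Cons.prems by simp
  have le: "subg_le (pgraph (gv (t @ [x])) w) (schutz e)"
    using Cons.prems x by (auto simp: subg_le_def)
  have "S.le_ran e (ev (t @ [x]))"
  proof (cases x)
    case (Inl a)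
    have "(gv t, a) \<in> snd (schutz e)" using Cons.prems Inl by (auto simp: subg_le_def ledges_def)
    from schutz_edge[OF assms(1) this] obtain p where p: "p \<in> W" "gv p = gv t"
      "S.le_ran e (ev (p @ [x]))" using Inl by auto
    have pr: "S.le_ran e (ev p)"
      using p x S.le_ran_multD[of e "ev p" "ev [x]"] assms(1) by (simp del: eev.simps)
    have "e \<otimes>\<^bsub>S\<^esub> ev p = e \<otimes>\<^bsub>S\<^esub> ev t"
      by (rule le_ran_eq) (use assms(1) p pr Cons.prems in auto)
    then have "e \<otimes>\<^bsub>S\<^esub> ev p \<otimes>\<^bsub>S\<^esub> ev [x] = e \<otimes>\<^bsub>S\<^esub> ev t \<otimes>\<^bsub>S\<^esub> ev [x]" by simp
    then have "e \<otimes>\<^bsub>S\<^esub> ev (p @ [x]) = e \<otimes>\<^bsub>S\<^esub> ev (t @ [x])"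
      using p x Cons.prems assms(1) by (simp add: S.m_assoc del: eev.simps)
    moreover have "ev (p @ [x]) \<in> carrier S" "ev (t @ [x]) \<in> carrier S"
      using p x tx by (auto intro!: ev_closed simp del: ev_append)
    ultimately show ?thesis
      using S.le_ran_cong[of e "ev (p @ [x])" "ev (t @ [x])"] p(3) assms(1) by blast
  next
    case (Inr v)
    have v: "v \<in> words X" "Inr [] \<in> L" using x Inr Inr_L_words[of v] Inr_L[of v "[]"] by auto
    have "gv t \<otimes> gl x \<in> fst (schutz e)"
      using Cons.prems start_in_pverts[of "gv t \<otimes> gl x" w] by (auto simp: subg_le_def)
    from schutz_vertex[OF assms(1) this] obtain p where p: "p \<in> W" "gv p = gv t \<otimes> gl x"
      "S.le_ran e (ev p)" by auto
    \<comment> \<open>In \<open>S\<close>, \<open>y\<close> leads from \<open>ev t\<close> towards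
      the value of the word \<open>p\<close> that witnesses the target. It lies over the group value
      of the jump, hence below \<open>v^m\<close>; and as \<open>e\<close> is below the range of
      \<open>ev t\<close>, multiplying \<open>e\<close> by \<open>ev t\<close> and \<open>y\<close>
      gives the product of \<open>e\<close> and \<open>ev p\<close>.\<close>
    define y where "y = iinv S (ev t) \<otimes>\<^bsub>S\<^esub> ev p"
    have y: "y \<in> carrier S" "\<phi> y = gl x"
      using p Cons.prems x by (auto simp: y_def m_assoc [symmetric])
    have evx: "ev [x] = mop S (weval S \<iota>S v)"
      using Inr mop_greatest[OF v(2) weval_closed[OF v(1)]] by (simp add: elval_def)
    have "nat_le S y (ev [x])"
      using mop_greatest[OF v(2) weval_closed[OF v(1)]] y v Inr
      unfolding evx by (simp add: \<phi>_weval gl_def)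
    then have ty: "nat_le S (ev t \<otimes>\<^bsub>S\<^esub> y) (ev t \<otimes>\<^bsub>S\<^esub> ev [x])"
      using Cons.prems x by (intro S.nat_le_mult_left) (auto simp del: eev.simps)
    have "e \<otimes>\<^bsub>S\<^esub> (ev t \<otimes>\<^bsub>S\<^esub> y) = e \<otimes>\<^bsub>S\<^esub> (ev t \<otimes>\<^bsub>S\<^esub> iinv S (ev t)) \<otimes>\<^bsub>S\<^esub> ev p"
      using assms(1) p Cons.prems by (simp add: y_def S.m_assoc)
    also have "\<dots> = e \<otimes>\<^bsub>S\<^esub> ev p" using Cons.prems by (simp add: S.le_ran_def)
    finally have "S.le_ran e (ev t \<otimes>\<^bsub>S\<^esub> y)"
      using S.le_ran_cong[of e "ev t \<otimes>\<^bsub>S\<^esub> y" "ev p"] assms(1) p y Cons.prems by simp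
    from S.le_ran_nat_le[OF this ty assms(1)] show ?thesis
      using Cons.prems x by (simp del: eev.simps)
  qed
  then have "S.le_ran e (ev ((t @ [x]) @ w))" using Cons.IH[OF x(2) tx _ le] by simp
  then show ?case by simp
qed

lemma clsdI:
  assumes "\<And>u v g. u \<in> W \<Longrightarrow> v \<in> W \<Longrightarrow> ev u = ev v \<Longrightarrow> gv u = gv v \<Longrightarrow> g \<in> fst \<Delta> \<Longrightarrow>
    subg_le (pgraph g u) \<Delta> \<Longrightarrow> subg_le (pgraph g v) \<Delta>"
  shows "clsd S \<iota>S \<Delta>"
  unfolding clsd_def using assms by (metis \<phi>_ev)

text \<open>By \<open>le_ran_of_path\<close> a word \<open>p\<close> leading to \<open>g\<close> can
  be continued by \<open>u\<close>; in the value of \<open>p @ u\<close> one may replace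
  \<open>u\<close> by \<open>v\<close>.\<close>

lemma clsd_schutz:
  assumes "e \<in> idems S" shows "clsd S \<iota>S (schutz e)"
proof (rule clsdI)
  fix u v g assume u: "u \<in> W" "v \<in> W" "ev u = ev v" "gv u = gv v"
    and g: "g \<in> fst (schutz e)" and le: "subg_le (pgraph g u) (schutz e)"
  obtain p where p: "p \<in> W" "gv p = g" "S.le_ran e (ev p)" using schutz_vertex[OF assms g] by auto
  have "S.le_ran e (ev (p @ u))" using le_ran_of_path[OF assms u(1) p(1,3)] le p by simp
  then have "S.le_ran e (ev (p @ v))" using p u by simp
  then have "subg_le (pgraph \<one> (p @ v)) (schutz e)" using p u by (intro le_schutz) auto
  moreover have "g \<in> carrier G" using p by auto
  ultimately show "subg_le (pgraph g v) (schutz e)" using p u by (simp add: pgraph_append)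
qed

text \<open>The intersection of the closed graphs above \<open>\<Delta>\<close> may be disconnected; the least closed
  connected graph is its component containing \<open>\<Delta>\<close>.\<close>

lemma ex_least_clsd:
  assumes D: "\<Delta> \<in> LSub"
  shows "\<exists>\<Theta>. \<Theta> \<in> LSub \<and> subg_le \<Delta> \<Theta> \<and> clsd S \<iota>S \<Theta> \<and>
      (\<forall>\<Theta>'\<in>LSub. subg_le \<Delta> \<Theta>' \<and> clsd S \<iota>S \<Theta>' \<longrightarrow> subg_le \<Theta> \<Theta>')"
proof -
  obtain g where g: "g \<in> fst \<Delta>" using LSub_nonempty D by blast
  have gc: "g \<in> carrier G" using g D by simp
  define above where "above = {\<Theta> \<in> LSub. subg_le \<Delta> \<Theta> \<and> clsd S \<iota>S \<Theta>}"
  \<comment> \<open>The words readable from \<open>g\<close> in every closed graph above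
    \<open>\<Delta>\<close>; their graphs make up the component of \<open>g\<close> in the
    intersection.\<close>
  define T where "T = {t \<in> W. \<forall>\<Theta>\<in>above. subg_le (pgraph g t) \<Theta>}"
  define N where "N = gUnion (pgraph g ` T)"
  have T: "t \<in> T" if "t \<in> W" "subg_le (pgraph g t) \<Delta>" for t
    using that by (auto simp: T_def above_def intro: subg_le_trans)
  have "[] \<in> T" using T[of "[]"] g by (simp add: subg_le_def)
  then have "T \<noteq> {}" by blast
  then have NP: "N \<in> LSub" unfolding N_def using gc by (intro gUnion_pgraph_LSub) (auto simp: T_def)
  have le: "subg_le N \<Theta>" if "\<Theta> \<in> above" for \<Theta>
    using that unfolding N_def gUnion_le_iff by (auto simp: T_def)
  have NT: "subg_le (pgraph g t) N" if "t \<in> T" for t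
    unfolding N_def by (rule le_gUnion) (use that in auto)
  have ex_path: "\<exists>t\<in>T. g \<otimes> gv t = h \<and> subg_le (pgraph g t) \<Delta>" if "h \<in> fst \<Delta>" for h
    using LSub_reach[OF D g that] T by (auto simp: reach_def)
  have "fst \<Delta> \<subseteq> fst N"
  proof
    fix h assume "h \<in> fst \<Delta>"
    then obtain t where "t \<in> T" "g \<otimes> gv t = h" using ex_path by blast
    then show "h \<in> fst N" using NT[of t] end_in_pverts[of g t] gc by (auto simp: T_def subg_le_def)
  qed
  moreover have "snd \<Delta> \<subseteq> snd N"
  proof
    fix e assume e: "e \<in> snd \<Delta>"
    obtain h a where ha: "e = (h, a)" by force
    have h: "h \<in> fst \<Delta>" "a \<in> labels X" using subgraph_edge[OF LSub_subgraph[OF D]] e ha by auto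
    then obtain t where t: "t \<in> W" "g \<otimes> gv t = h" "subg_le (pgraph g t) \<Delta>"
      using ex_path[of h] by (auto simp: T_def)
    have "subg_le (pgraph g (t @ [Inl a])) \<Delta>"
      using t h gc pgraph_edge_le[OF LSub_subgraph[OF D]] e ha by (simp add: pgraph_append)
    then have "t @ [Inl a] \<in> T" using t h by (intro T) auto
    from NT[OF this] show "e \<in> snd N" using t h gc ha by (auto simp: subg_le_def ledges_def)
  qed
  ultimately have DN: "subg_le \<Delta> N" by (simp add: subg_le_def)
  have "clsd S \<iota>S N"
  proof (rule clsdI)
    fix u v h assume u: "u \<in> W" "v \<in> W" "ev u = ev v" "gv u = gv v"
      and h: "h \<in> fst N" and hu: "subg_le (pgraph h u) N"
    obtain t where t: "t \<in> T" "h \<in> pverts g t" using h by (auto simp: N_def gUnion_def)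
    have tW: "t \<in> W" using t by (simp add: T_def)
    obtain p q where p: "t = p @ q" "p \<in> W" "q \<in> W" "h = g \<otimes> gv p"
      using pverts_split[OF t(2) gc tW] by blast
    \<comment> \<open>Each \<open>\<Theta>\<close> admits \<open>v\<close> at \<open>h\<close>; the
      prefix \<open>p\<close> ties this to the base point \<open>g\<close>, so the new path stays in
      the component.\<close>
    have "subg_le (pgraph g (p @ v)) \<Theta>" if \<Theta>: "\<Theta> \<in> above" for \<Theta>
    proof -
      have "subg_le (pgraph g t) \<Theta>" using t \<Theta> by (auto simp: T_def)
      then have gp: "subg_le (pgraph g p) \<Theta>" using p gc by (simp add: pgraph_append)
      have hT: "h \<in> fst \<Theta>" using le[OF \<Theta>] h by (auto simp: subg_le_def)
      have "subg_le (pgraph h u) \<Theta>" using hu le[OF \<Theta>] by (rule subg_le_trans)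
      then have "subg_le (pgraph h v) \<Theta>"
        using \<Theta> u hT unfolding above_def clsd_def by blast
      then show ?thesis using gp p u gc by (simp add: pgraph_append)
    qed
    then have "p @ v \<in> T" using p u by (simp add: T_def)
    from NT[OF this] show "subg_le (pgraph h v) N" using p u gc by (simp add: pgraph_append)
  qed
  then show ?thesis using NP DN le by (intro exI[of _ N]) (auto simp: above_def)
qed

section \<open>The operator \<open>c_S\<close>, and equality in \<open>S\<close> in terms of
  it\<close>

abbreviation clS :: "('g, 'x) graph \<Rightarrow> ('g, 'x) graph" where "clS \<equiv> cl S \<iota>S"

lemma cl_props:
  assumes "\<Delta> \<in> LSub"
  shows cl_LSub: "clS \<Delta> \<in> LSub" and cl_ext: "subg_le \<Delta> (clS \<Delta>)" and clsd_cl: "clsd S \<iota>S (clS \<Delta>)"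
    and cl_least: "\<And>\<Theta>. \<Theta> \<in> LSub \<Longrightarrow> subg_le \<Delta> \<Theta> \<Longrightarrow> clsd S \<iota>S \<Theta> \<Longrightarrow> subg_le (clS \<Delta>) \<Theta>"
proof -
  obtain \<Theta> where T: "\<Theta> \<in> LSub" "subg_le \<Delta> \<Theta>" "clsd S \<iota>S \<Theta>"
    "\<And>\<Theta>'. \<Theta>' \<in> LSub \<Longrightarrow> subg_le \<Delta> \<Theta>' \<Longrightarrow> clsd S \<iota>S \<Theta>' \<Longrightarrow> subg_le \<Theta> \<Theta>'"
    using ex_least_clsd[OF assms] by blast
  then have eq: "clS \<Delta> = \<Theta>" by (rule cl_eqI)
  show "clS \<Delta> \<in> LSub" "subg_le \<Delta> (clS \<Delta>)" "clsd S \<iota>S (clS \<Delta>)"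
    "\<And>\<Theta>. \<Theta> \<in> LSub \<Longrightarrow> subg_le \<Delta> \<Theta> \<Longrightarrow> clsd S \<iota>S \<Theta> \<Longrightarrow> subg_le (clS \<Delta>) \<Theta>"
    unfolding eq by (fact T)+
qed

lemma cl_mono:
  assumes "\<Delta> \<in> LSub" "\<Theta> \<in> LSub" "subg_le \<Delta> \<Theta>" shows "subg_le (clS \<Delta>) (clS \<Theta>)"
  using assms cl_props[OF assms(2)] by (blast intro: cl_least subg_le_trans)

lemma closure_cl: "closure_op LSub clS"
  unfolding closure_op_def
  by (intro conjI ballI impI cl_LSub cl_ext cl_mono subg_le_antisym[OF cl_least])
    (auto intro: cl_LSub clsd_cl cl_ext)

lemma clsd_gtrans:
  assumes "\<Delta> \<in> LSub" "clsd S \<iota>S \<Delta>" "k \<in> carrier G" shows "clsd S \<iota>S (gtrans G k \<Delta>)"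
proof (rule clsdI)
  fix u v g assume u: "u \<in> W" "v \<in> W" "ev u = ev v" and g: "g \<in> fst (gtrans G k \<Delta>)"
    and le: "subg_le (pgraph g u) (gtrans G k \<Delta>)"
  obtain h where h: "h \<in> fst \<Delta>" "g = k \<otimes> h" using g by (auto simp: gtrans_def)
  have hc: "h \<in> carrier G" using h assms by simp
  have tr: "subg_le (pgraph g w) (gtrans G k \<Delta>) \<longleftrightarrow> subg_le (pgraph h w) \<Delta>" if "w \<in> W" for w
    using gtrans_le_iff[of "pgraph h w" "gtrans G k \<Delta>" k] that assms hc h
    by (simp add: gtrans_pgraph gtrans_gtrans gtrans_one LSub_subgraph is_subgraph_gtrans)
  show "subg_le (pgraph g v) (gtrans G k \<Delta>)"
    using assms(2) u h le tr unfolding clsd_def by blast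
qed

lemma invariant_cl: "G_invariant G LSub clS"
proof -
  have 1: "subg_le (clS (gtrans G g \<Delta>)) (gtrans G g (clS \<Delta>))"
    if "g \<in> carrier G" "\<Delta> \<in> LSub" for g \<Delta>
    using that by (intro cl_least) (auto intro: gtrans_LSub cl_LSub clsd_gtrans clsd_cl gtrans_le cl_ext)
  have "clS (gtrans G g \<Delta>) = gtrans G g (clS \<Delta>)" if g: "g \<in> carrier G" and D: "\<Delta> \<in> LSub" for g \<Delta>
  proof (rule subg_le_antisym[OF 1[OF g D]])
    \<comment> \<open>The inclusion \<open>1\<close>, for the inverse of \<open>g\<close> and the
      translated graph, yields the reverse one.\<close>
    have "subg_le (clS (gtrans G (inv g) (gtrans G g \<Delta>))) (gtrans G (inv g) (clS (gtrans G g \<Delta>)))"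
      using 1[of "inv g" "gtrans G g \<Delta>"] g D by (simp add: gtrans_LSub)
    then have "subg_le (clS \<Delta>) (gtrans G (inv g) (clS (gtrans G g \<Delta>)))"
      using g D by (simp add: gtrans_gtrans gtrans_one LSub_subgraph)
    then show "subg_le (gtrans G g (clS \<Delta>)) (clS (gtrans G g \<Delta>))"
      using g D by (simp add: gtrans_le_iff LSub_subgraph cl_LSub gtrans_LSub)
  qed
  then show ?thesis by (simp add: G_invariant_def)
qed

text \<open>A test for closedness involves one finite graph \<open>pgraph h u\<close>, which lies in
  a single member of a directed union; so the union \<open>U\<close> of the closures of finite
  subgraphs is closed.\<close>

lemma finitary_cl: "finitary LSub clS"
  unfolding finitary_def
proof
  fix \<Delta> assume D: "\<Delta> \<in> LSub"
  obtain g where g: "g \<in> fst \<Delta>" using LSub_nonempty D by blast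
  have gc: "g \<in> carrier G" using g D by simp
  define Fs where "Fs = {F \<in> LSub. finite_graph F \<and> subg_le F \<Delta>}"
  define U where "U = gUnion (clS ` Fs)"
  have cover: "\<exists>F\<in>Fs. subg_le A F" if A: "finite_graph A" "subg_le A \<Delta>" for A
  proof -
    obtain t where "t \<in> W" "subg_le (pgraph g t) \<Delta>" "subg_le A (pgraph g t)"
      using finite_cover[OF D g A] by blast
    then show ?thesis using gc by (intro bexI[of _ "pgraph g t"]) (auto simp: Fs_def)
  qed
  \<comment> \<open>The union of two finite connected graphs may be disconnected;
    \<open>cover\<close> encloses it in a finite member of \<open>LSub\<close> inside
    \<open>\<Delta>\<close>.\<close>
  have dir: "\<exists>E\<in>clS ` Fs. subg_le B E \<and> subg_le C E" if BC: "B \<in> clS ` Fs" "C \<in> clS ` Fs" for B C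
  proof -
    obtain F1 F2 where F: "F1 \<in> Fs" "F2 \<in> Fs" "B = clS F1" "C = clS F2" using BC by blast
    have "finite_graph (gunion F1 F2)" "subg_le (gunion F1 F2) \<Delta>"
      using F by (auto simp: Fs_def finite_graph_def gunion_def subg_le_def)
    from cover[OF this] obtain F3 where F3: "F3 \<in> Fs" "subg_le F1 F3" "subg_le F2 F3" by auto
    have "subg_le B (clS F3)" "subg_le C (clS F3)" using F F3 by (auto simp: Fs_def intro: cl_mono)
    then show ?thesis using F3 by blast
  qed
  have ne: "Fs \<noteq> {}" using cover[of "({}, {})"] by (auto simp: finite_graph_def subg_le_def)
  have FsP: "\<Theta> \<in> LSub" "clsd S \<iota>S \<Theta>" if "\<Theta> \<in> clS ` Fs" for \<Theta>
    using that by (auto simp: Fs_def intro: cl_LSub clsd_cl)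
  have UP: "U \<in> LSub"
    unfolding LSub_def
  proof (intro CollectI conjI ballI)
    show "is_subgraph G \<iota> X U" unfolding U_def
      using ne FsP LSub_subgraph by (intro is_subgraph_gUnion) blast+
    fix h k assume hk: "h \<in> fst U" "k \<in> fst U"
    then have fin: "finite_graph ({h, k}, {})" "subg_le ({h, k}, {}) U"
      by (auto simp: finite_graph_def subg_le_def)
    then obtain E where E: "E \<in> clS ` Fs" "subg_le ({h, k}, {}) E"
      using finite_le_directed_gUnion[OF fin(1) _ _ dir] ne unfolding U_def by blast
    have "reach E h k" using FsP(1)[OF E(1)] E(2) by (intro LSub_reach) (auto simp: subg_le_def)
    then show "reach U h k" unfolding U_def by (rule reach_mono[OF _ le_gUnion[OF E(1)]])
  qed
  have "clsd S \<iota>S U"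
  proof (rule clsdI)
    fix u v h assume u: "u \<in> W" "v \<in> W" "ev u = ev v" and le: "subg_le (pgraph h u) U"
    obtain E where E: "E \<in> clS ` Fs" "subg_le (pgraph h u) E"
      using finite_le_directed_gUnion[OF finite_pgraph _ _ dir] le ne unfolding U_def by blast
    have "h \<in> fst E" using E(2) start_in_pverts[of h u] by (auto simp: subg_le_def)
    then have "subg_le (pgraph h v) E" using FsP(2)[OF E(1)] E(2) u unfolding clsd_def by blast
    then show "subg_le (pgraph h v) U" using le_gUnion[OF E(1)] unfolding U_def by (rule subg_le_trans)
  qed
  moreover have "subg_le \<Delta> U"
  proof -
    have sub: "subg_le A U" if A: "finite_graph A" "subg_le A \<Delta>" for A
    proof -
      obtain F where F: "F \<in> Fs" "subg_le A F" using cover[OF A] by blast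
      have "subg_le A (clS F)" using F cl_ext[of F] by (auto simp: Fs_def intro: subg_le_trans)
      also have "subg_le (clS F) U" unfolding U_def using F by (intro le_gUnion) auto
      finally (subg_le_trans) show ?thesis .
    qed
    have "h \<in> fst U" if "h \<in> fst \<Delta>" for h
      using sub[of "({h}, {})"] that by (auto simp: finite_graph_def subg_le_def)
    moreover have "e \<in> snd U" if "e \<in> snd \<Delta>" for e
      using sub[of "({}, {e})"] that by (auto simp: finite_graph_def subg_le_def)
    ultimately show ?thesis by (auto simp: subg_le_def)
  qed
  ultimately have "subg_le (clS \<Delta>) U" using D UP by (intro cl_least)
  moreover have "subg_le U (clS \<Delta>)" unfolding U_def gUnion_le_iff
    using D by (auto simp: Fs_def intro: cl_mono)
  ultimately have "clS \<Delta> = U" by (rule subg_le_antisym)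
  then show "clS \<Delta> = gUnion (clS ` {F \<in> LSub. finite_graph F \<and> subg_le F \<Delta>})"
    by (simp add: U_def Fs_def)
qed

lemma cayley_closure_cl: "cayley_closure G \<iota> X L clS"
  by unfold_locales (fact closure_cl invariant_cl finitary_cl)+

lemma ev_eq_iff:
  assumes u: "u \<in> W" and v: "v \<in> W"
  shows "ev u = ev v \<longleftrightarrow> gv u = gv v \<and> clS (pgraph \<one> u) = clS (pgraph \<one> v)"
proof
  assume eq: "ev u = ev v"
  have le: "subg_le (clS (pgraph \<one> u)) (clS (pgraph \<one> v))"
    if u: "u \<in> W" and v: "v \<in> W" and eq: "ev u = ev v" for u v
  proof (rule cl_least)
    have "subg_le (pgraph \<one> v) (clS (pgraph \<one> v))" "clsd S \<iota>S (clS (pgraph \<one> v))"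
      using v by (auto intro: cl_ext clsd_cl)
    moreover have "\<one> \<in> fst (clS (pgraph \<one> v))"
      using calculation(1) start_in_pverts[of \<one> v] by (auto simp: subg_le_def)
    ultimately show "subg_le (pgraph \<one> u) (clS (pgraph \<one> v))"
      using u v eq[symmetric] unfolding clsd_def by blast
  qed (use u v in \<open>auto intro: cl_LSub clsd_cl\<close>)
  have "gv u = gv v" using eq u v by (metis \<phi>_ev)
  moreover have "clS (pgraph \<one> u) = clS (pgraph \<one> v)"
    using le[OF u v eq] le[OF v u eq[symmetric]] by (rule subg_le_antisym)
  ultimately show "gv u = gv v \<and> clS (pgraph \<one> u) = clS (pgraph \<one> v)" ..
next
  assume eq: "gv u = gv v \<and> clS (pgraph \<one> u) = clS (pgraph \<one> v)"
  have ran: "S.le_ran (ev u \<otimes>\<^bsub>S\<^esub> iinv S (ev u)) (ev v)"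
    if u: "u \<in> W" and v: "v \<in> W" and eq: "clS (pgraph \<one> u) = clS (pgraph \<one> v)" for u v
  proof -
    define e where "e = ev u \<otimes>\<^bsub>S\<^esub> iinv S (ev u)"
    have e: "e \<in> idems S" using u by (simp add: e_def)
    have "S.le_ran e (ev u)" using S.idem[OF e] by (simp add: S.le_ran_def e_def)
    then have "subg_le (pgraph \<one> u) (schutz e)" using u by (intro le_schutz)
    then have "subg_le (clS (pgraph \<one> u)) (schutz e)"
      using u e by (intro cl_least) (auto intro: schutz_LSub clsd_schutz)
    moreover have "subg_le (pgraph \<one> v) (clS (pgraph \<one> v))" using v by (intro cl_ext) auto
    ultimately have "subg_le (pgraph \<one> v) (schutz e)" unfolding eq by (rule subg_le_trans[rotated])
    then have "S.le_ran e (ev ([] @ v))"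
      using e v by (intro le_ran_of_path) (auto simp: S.le_ran_def)
    then show ?thesis by (simp add: e_def)
  qed
  define e where "e = ev u \<otimes>\<^bsub>S\<^esub> iinv S (ev u)"
  define f where "f = ev v \<otimes>\<^bsub>S\<^esub> iinv S (ev v)"
  have ef: "e \<in> idems S" "f \<in> idems S" using u v by (auto simp: e_def f_def)
  have r: "S.le_ran e (ev v)" "S.le_ran f (ev u)"
    using ran[OF u v] ran[OF v u] eq by (auto simp: e_def f_def)
  then have "e = e \<otimes>\<^bsub>S\<^esub> f" "f = f \<otimes>\<^bsub>S\<^esub> e" by (auto simp: S.le_ran_def e_def f_def)
  \<comment> \<open>The two ranges lie below each other. Elements with equal range and equal group
    image coincide by \<open>le_ran_eq\<close>.\<close>
  then have "e = f" using S.idems_comm[OF ef] by simp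
  have "S.le_ran e (ev u)" using r \<open>e = f\<close> by simp
  then have "e \<otimes>\<^bsub>S\<^esub> ev u = e \<otimes>\<^bsub>S\<^esub> ev v"
    using r(1) ef u v eq by (intro le_ran_eq) auto
  moreover have "e \<otimes>\<^bsub>S\<^esub> ev u = ev u" using u by (simp add: e_def S.mult_iinv_mult)
  moreover have "e \<otimes>\<^bsub>S\<^esub> ev v = ev v" unfolding \<open>e = f\<close> using v by (simp add: f_def S.mult_iinv_mult)
  ultimately show "ev u = ev v" by simp
qed

end

section \<open>Canonical morphisms\<close>

locale cayley_obj = cayley_image G \<iota> X L S \<iota>S \<phi>
  for G :: "('g, 'b) monoid_scheme" (structure) and \<iota> :: "'x \<Rightarrow> 'g" and X L
    and S :: "'s monoid" and \<iota>S \<phi> +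
  assumes ev_surj: "carrier S \<subseteq> eev S \<iota>S ` W"

context cayley
begin

text \<open>One notion for both cases: the presence of jumps in \<open>L\<close> demands
  compatibility with \<open>mop\<close>.\<close>

definition cmor :: "'s monoid \<Rightarrow> ('x \<Rightarrow> 's) \<Rightarrow> 't monoid \<Rightarrow> ('x \<Rightarrow> 't) \<Rightarrow> ('s \<Rightarrow> 't) \<Rightarrow> bool" where
  "cmor S \<iota>S T \<iota>T f \<longleftrightarrow> canon_inv_mor X S \<iota>S T \<iota>T f \<and>
     (Inr [] \<in> L \<longrightarrow> (\<forall>a\<in>carrier S. f (mop S a) = mop T (f a)))"

text \<open>A canonical morphism is forced on values of words, so it preserves their equations and
  is unique on a generated monoid.\<close>

lemma cmor_ev:
  assumes "cayley_image G \<iota> X L S \<iota>S \<phi>" "cmor S \<iota>S T \<iota>T f" "w \<in> W"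
  shows "f (eev S \<iota>S w) = eev T \<iota>T w"
proof -
  interpret S: cayley_image G \<iota> X L S \<iota>S \<phi> by fact
  have f: "\<And>a b. a \<in> carrier S \<Longrightarrow> b \<in> carrier S \<Longrightarrow> f (a \<otimes>\<^bsub>S\<^esub> b) = f a \<otimes>\<^bsub>T\<^esub> f b"
    "f \<one>\<^bsub>S\<^esub> = \<one>\<^bsub>T\<^esub>" "\<And>a. a \<in> carrier S \<Longrightarrow> f (iinv S a) = iinv T (f a)"
    "\<And>x. x \<in> X \<Longrightarrow> f (\<iota>S x) = \<iota>T x"
    "\<And>a. Inr [] \<in> L \<Longrightarrow> a \<in> carrier S \<Longrightarrow> f (mop S a) = mop T (f a)"
    using assms(2) by (auto simp: cmor_def canon_inv_mor_def)
  have l: "f (letter S \<iota>S a) = letter T \<iota>T a" if "a \<in> labels X" for a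
    using that f S.gen_closed by (auto simp: letter_def labels_def)
  have wv: "f (weval S \<iota>S v) = weval T \<iota>T v" if "v \<in> words X" for v
    using that by (induction v) (auto simp: f l S.letter_props S.weval_closed)
  have e: "f (elval S \<iota>S x) = elval T \<iota>T x" if "x \<in> L" for x
  proof (cases x)
    case (Inl a)
    then show ?thesis using that l by (simp add: elval_def)
  next
    case (Inr v)
    then have "v \<in> words X" "Inr [] \<in> L" using that Inr_L_words[of v] Inr_L[of v "[]"] by auto
    then show ?thesis using Inr f(5) wv S.weval_closed by (simp add: elval_def)
  qed
  show ?thesis using assms(3) by (induction w) (auto simp: f e S.elval_props)
qed

text \<open>Each element of \<open>S\<close> is the value of a word, and \<open>imp\<close> makes
  the value of that word in \<open>T\<close> independent of the choice.\<close>

lemma ex_cmor: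
  assumes "cayley_obj G \<iota> X L S \<iota>S \<phi>" "cayley_obj G \<iota> X L T \<iota>T \<psi>"
    and imp: "\<And>u v. u \<in> W \<Longrightarrow> v \<in> W \<Longrightarrow> eev S \<iota>S u = eev S \<iota>S v \<Longrightarrow> eev T \<iota>T u = eev T \<iota>T v"
  shows "\<exists>f. cmor S \<iota>S T \<iota>T f \<and> (\<forall>w\<in>W. f (eev S \<iota>S w) = eev T \<iota>T w)"
proof -
  interpret S: cayley_obj G \<iota> X L S \<iota>S \<phi> by fact
  interpret T: cayley_obj G \<iota> X L T \<iota>T \<psi> by fact
  define f where "f a = eev T \<iota>T (SOME w. w \<in> W \<and> eev S \<iota>S w = a)" for a
  have f: "f (eev S \<iota>S w) = eev T \<iota>T w" if "w \<in> W" for w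
  proof -
    have "(SOME u. u \<in> W \<and> eev S \<iota>S u = eev S \<iota>S w) \<in> W \<and>
        eev S \<iota>S (SOME u. u \<in> W \<and> eev S \<iota>S u = eev S \<iota>S w) = eev S \<iota>S w"
      by (rule someI[of _ w]) (use that in auto)
    then show ?thesis unfolding f_def using that by (intro imp) auto
  qed
  have rep: "\<exists>w\<in>W. a = eev S \<iota>S w" if "a \<in> carrier S" for a using S.ev_surj that by auto
  have cl: "f \<in> carrier S \<rightarrow> carrier T"
  proof
    fix a assume "a \<in> carrier S"
    then obtain w where "w \<in> W" "a = eev S \<iota>S w" using rep by blast
    then show "f a \<in> carrier T" by (simp add: f)
  qed
  have hom: "f (a \<otimes>\<^bsub>S\<^esub> b) = f a \<otimes>\<^bsub>T\<^esub> f b" if ab: "a \<in> carrier S" "b \<in> carrier S" for a b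
  proof -
    obtain u v where "u \<in> W" "v \<in> W" "a = eev S \<iota>S u" "b = eev S \<iota>S v" using rep ab by blast
    then show ?thesis using f[of "u @ v"] f[of u] f[of v] by simp
  qed
  \<comment> \<open>By \<open>mop_ev\<close>, \<open>mop S a\<close> is one jump along an ordinary
    word \<open>v\<close>; in \<open>T\<close> this jump is \<open>mop\<close> of an element with
    the group image of \<open>f a\<close>.\<close>
  have "f (mop S a) = mop T (f a)" if m: "Inr [] \<in> L" and a: "a \<in> carrier S" for a
  proof -
    obtain u where u: "u \<in> W" "a = eev S \<iota>S u" using rep a by blast
    obtain v where v: "Inr v \<in> L" "wval G \<iota> v = gv u" "mop S a = eev S \<iota>S [Inr v]"
      using S.mop_ev[OF m u(1)] u by auto
    have vw: "v \<in> words X" using v Inr_L_words by blast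
    have "f (mop S a) = eev T \<iota>T [Inr v]" using v f[of "[Inr v]"] by simp
    also have "\<dots> = mop T (weval T \<iota>T v)"
      using T.mop_greatest[OF m T.weval_closed[OF vw]] by (simp add: elval_def)
    also have "\<dots> = mop T (f a)"
      by (rule T.mop_cong) (use m u v vw f in \<open>auto simp: T.weval_closed T.\<phi>_weval\<close>)
    finally show ?thesis .
  qed
  moreover have "f (\<iota>S x) = \<iota>T x" if "x \<in> X" for x
  proof -
    have "eev S \<iota>S [Inl (Inl x)] = \<iota>S x" "eev T \<iota>T [Inl (Inl x)] = \<iota>T x"
      using that S.gen_closed T.gen_closed by (auto simp: elval_def letter_def)
    moreover have "[Inl (Inl x)] \<in> W" using that by (simp add: labels_def)
    ultimately show ?thesis using f[of "[Inl (Inl x)]"] by simp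
  qed
  moreover have "f \<one>\<^bsub>S\<^esub> = \<one>\<^bsub>T\<^esub>" using f[of "[]"] by simp
  moreover have "f (iinv S a) = iinv T (f a)" if "a \<in> carrier S" for a
    using S.S.inverse_monoid_axioms T.S.inverse_monoid_axioms cl hom that
    by (rule inverse_monoid_hom_iinv)
  ultimately have "cmor S \<iota>S T \<iota>T f" using cl hom by (auto simp: cmor_def canon_inv_mor_def)
  then show ?thesis using f by blast
qed

lemma ex_cmor_bij:
  assumes "cayley_obj G \<iota> X L S \<iota>S \<phi>" "cayley_obj G \<iota> X L T \<iota>T \<psi>"
    and iff: "\<And>u v. u \<in> W \<Longrightarrow> v \<in> W \<Longrightarrow> eev S \<iota>S u = eev S \<iota>S v \<longleftrightarrow> eev T \<iota>T u = eev T \<iota>T v"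
  shows "\<exists>f. cmor S \<iota>S T \<iota>T f \<and> bij_betw f (carrier S) (carrier T)"
proof -
  interpret S: cayley_obj G \<iota> X L S \<iota>S \<phi> by fact
  interpret T: cayley_obj G \<iota> X L T \<iota>T \<psi> by fact
  obtain f where f: "cmor S \<iota>S T \<iota>T f" "\<And>w. w \<in> W \<Longrightarrow> f (eev S \<iota>S w) = eev T \<iota>T w"
    using ex_cmor[OF assms(1,2)] iff by blast
  have S: "carrier S = eev S \<iota>S ` W" using S.ev_surj by auto
  have T: "carrier T = eev T \<iota>T ` W" using T.ev_surj by auto
  have "inj_on f (carrier S)" unfolding S using f(2) iff by (auto simp: inj_on_def)
  moreover have "f ` carrier S = carrier T" unfolding S T using f(2) by (force simp: image_image)
  ultimately show ?thesis using f(1) by (auto simp: bij_betw_def)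
qed

text \<open>A morphism carries the equations of \<open>S\<close> to \<open>T\<close>, so graphs
  closed for \<open>T\<close> are closed for \<open>S\<close> and the least closed graphs compare.
  Conversely, if \<open>u\<close> and \<open>v\<close> agree in \<open>S\<close>, the graph of
  \<open>u\<close> lies in the \<open>S\<close>-closure of that of \<open>v\<close>, hence in its
  \<open>T\<close>-closure, and \<open>ev_eq_iff\<close> gives equality in \<open>T\<close>.\<close>

lemma ex_cmor_iff_clo_le:
  assumes "cayley_obj G \<iota> X L S \<iota>S \<phi>" "cayley_obj G \<iota> X L T \<iota>T \<psi>"
  shows "(\<exists>f. cmor S \<iota>S T \<iota>T f) \<longleftrightarrow> clo_le LSub (cl S \<iota>S) (cl T \<iota>T)"
proof
  interpret S: cayley_obj G \<iota> X L S \<iota>S \<phi> by fact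
  interpret T: cayley_obj G \<iota> X L T \<iota>T \<psi> by fact
  assume "\<exists>f. cmor S \<iota>S T \<iota>T f"
  then obtain f where f: "\<And>w. w \<in> W \<Longrightarrow> f (eev S \<iota>S w) = eev T \<iota>T w"
    using cmor_ev[OF S.cayley_image_axioms] by blast
  have "clsd S \<iota>S \<Delta>" if "clsd T \<iota>T \<Delta>" for \<Delta>
    using that f unfolding clsd_def by metis
  then show "clo_le LSub (cl S \<iota>S) (cl T \<iota>T)"
    unfolding clo_le_def by (blast intro: S.cl_least T.cl_LSub T.cl_ext T.clsd_cl)
next
  interpret S: cayley_obj G \<iota> X L S \<iota>S \<phi> by fact
  interpret T: cayley_obj G \<iota> X L T \<iota>T \<psi> by fact
  assume le: "clo_le LSub (cl S \<iota>S) (cl T \<iota>T)"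
  have "eev T \<iota>T u = eev T \<iota>T v" if u: "u \<in> W" and v: "v \<in> W" and eq: "eev S \<iota>S u = eev S \<iota>S v" for u v
  proof -
    interpret c: cayley_closure G \<iota> X L "cl T \<iota>T" by (rule T.cayley_closure_cl)
    have S: "cl S \<iota>S (pgraph \<one> u) = cl S \<iota>S (pgraph \<one> v)" "gv u = gv v"
      using S.ev_eq_iff[OF u v] eq by auto
    have *: "subg_le (cl T \<iota>T (pgraph \<one> w)) (cl T \<iota>T (pgraph \<one> w'))"
      if w: "w \<in> W" "w' \<in> W" "cl S \<iota>S (pgraph \<one> w) = cl S \<iota>S (pgraph \<one> w')" for w w'
    proof -
      have "subg_le (pgraph \<one> w) (cl S \<iota>S (pgraph \<one> w'))" using S.cl_ext[of "pgraph \<one> w"] w by simp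
      also have "subg_le (cl S \<iota>S (pgraph \<one> w')) (cl T \<iota>T (pgraph \<one> w'))"
        using le w by (simp add: clo_le_def)
      finally (subg_le_trans) show ?thesis using w by (simp add: c.c_le_iff)
    qed
    have "cl T \<iota>T (pgraph \<one> u) = cl T \<iota>T (pgraph \<one> v)"
      using *[OF u v S(1)] *[OF v u S(1)[symmetric]] by (rule subg_le_antisym)
    then show ?thesis using T.ev_eq_iff[OF u v] S by simp
  qed
  then show "\<exists>f. cmor S \<iota>S T \<iota>T f" using ex_cmor[OF assms] by blast
qed

end

lemma (in cayley_closure) cayley_obj_Sc: "cayley_obj G \<iota> X L N gen snd"
proof
  show "gen x \<in> carrier N" if "x \<in> X" for x using gen_closed that by auto
  show "snd a \<in> carrier G" if "a \<in> carrier N" for a using that by (auto simp: carrier_Sc)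
  show "snd (a \<otimes>\<^bsub>N\<^esub> b) = snd a \<otimes> snd b" if "a \<in> carrier N" "b \<in> carrier N" for a b
    using that by (auto simp: carrier_Sc)
  show "snd (gen x) = \<iota> x" if "x \<in> X" for x by (simp add: Sc_gen_def)
  show "a \<in> idems N" if "a \<in> carrier N" "snd a = \<one>" for a
    using that by (auto simp: carrier_Sc E_idem_iff)
  show "carrier N \<subseteq> eev N gen ` W" by (auto simp: carrier_Sc eev_Sc)
  fix a assume m: "Inr [] \<in> L" and a: "a \<in> carrier N"
  obtain t where t: "t \<in> W" "a = E t" using a by (auto simp: carrier_Sc)
  obtain v where v: "v \<in> words X" "wval G \<iota> v = gv t" using ex_word[of "gv t"] t by auto
  then have L: "Inr v \<in> L" using m Inr_L by blast
  have "mop N a = E [Inr v]" using t v mop_E[of t v] L by simp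
  then show "mop N a \<in> carrier N \<and> snd (mop N a) = snd a \<and>
      (\<forall>b\<in>carrier N. snd b = snd a \<longrightarrow> nat_le N b (mop N a))"
    using t v L by (auto simp: gl_def carrier_Sc intro: nat_le_E)
qed

text \<open>By \<open>ev_eq_iff\<close>, \<open>S\<close> and the monoid of \<open>clS\<close>
  satisfy the same equations between words.\<close>

lemma (in cayley_obj) ex_cmor_Sc_cl:
  "\<exists>f. cmor (Sc LSub G clS) (Sc_gen G \<iota> clS) S \<iota>S f \<and> bij_betw f (carrier (Sc LSub G clS)) (carrier S)"
proof -
  interpret c: cayley_closure G \<iota> X L clS by (rule cayley_closure_cl)
  show ?thesis
  proof (rule ex_cmor_bij[OF c.cayley_obj_Sc cayley_obj_axioms])
    fix u v assume "u \<in> W" "v \<in> W"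
    then show "eev c.N c.gen u = eev c.N c.gen v \<longleftrightarrow> ev u = ev v"
      by (auto simp: c.eev_Sc ev_eq_iff c.E_def)
  qed
qed

text \<open>Since \<open>cl_Sc\<close> recovers \<open>c\<close> from its monoid, this is
  \<open>ex_cmor_iff_clo_le\<close> for the two monoids.\<close>

lemma (in cayley) clo_le_iff_ex_cmor_Sc:
  assumes "cayley_closure G \<iota> X L c" "cayley_closure G \<iota> X L c'"
  shows "clo_le LSub c c' \<longleftrightarrow> (\<exists>f. cmor (Sc LSub G c) (Sc_gen G \<iota> c) (Sc LSub G c') (Sc_gen G \<iota> c') f)"
proof -
  interpret c: cayley_closure G \<iota> X L c by fact
  interpret c': cayley_closure G \<iota> X L c' by fact
  have "clo_le LSub c c' \<longleftrightarrow> clo_le LSub (cl c.N c.gen) (cl c'.N c'.gen)"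
    by (simp add: clo_le_def c.cl_Sc c'.cl_Sc)
  then show ?thesis using ex_cmor_iff_clo_le[OF c.cayley_obj_Sc c'.cayley_obj_Sc] by simp
qed

section \<open>The two categories\<close>

lemma (in cayley_closure) objE_Sc:
  assumes "\<And>v. Inr v \<notin> L" shows "objE G \<iota> X N gen"
  unfolding objE_def
  using is_inverse_monoid_Sc gen_closed carrier_eq_invgen[OF assms] E_unitary_Sc group_image_Sc
  by blast

lemma (in cayley_closure) objF_Sc:
  assumes "Inr [] \<in> L" shows "objF G \<iota> X N gen"
  unfolding objF_def
  using is_inverse_monoid_Sc gen_closed carrier_eq_Fgen[OF assms] F_inverse_Sc[OF assms] group_image_Sc
  by blast

lemma (in cayley) cayley_obj_objE:
  assumes "objE G \<iota> X S \<iota>S" and noL: "\<And>v. Inr v \<notin> L"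
  shows "\<exists>\<phi>. cayley_obj G \<iota> X L S \<iota>S \<phi>"
proof -
  interpret S: inverse_monoid S using assms(1) by (intro inverse_monoidI) (simp add: objE_def)
  obtain \<phi> where \<phi>: "\<phi> \<in> carrier S \<rightarrow> carrier G"
    "\<forall>a\<in>carrier S. \<forall>b\<in>carrier S. \<phi> (a \<otimes>\<^bsub>S\<^esub> b) = \<phi> a \<otimes> \<phi> b" "\<phi> \<one>\<^bsub>S\<^esub> = \<one>"
    "\<forall>x\<in>X. \<phi> (\<iota>S x) = \<iota> x" "\<forall>a\<in>carrier S. \<forall>b\<in>carrier S. \<phi> a = \<phi> b \<longleftrightarrow> sigma S a b"
    using assms(1) unfolding objE_def group_image_is_def by auto
  have gen: "\<iota>S ` X \<subseteq> carrier S" "carrier S = invgen S \<iota>S X" and EU: "E_unitary S"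
    using assms(1) unfolding objE_def by blast+
  have pure: "a \<in> idems S" if a: "a \<in> carrier S" "\<phi> a = \<one>" for a
  proof -
    \<comment> \<open>Some idempotent \<open>e\<close> equalizes \<open>a\<close> and 1, so its
      product with \<open>a\<close> is \<open>e\<close> and E-unitarity applies.\<close>
    have "sigma S a \<one>\<^bsub>S\<^esub>" using \<phi>(3,5) a by (metis S.one_closed)
    then obtain e where e: "e \<in> idems S" "e \<otimes>\<^bsub>S\<^esub> a = e \<otimes>\<^bsub>S\<^esub> \<one>\<^bsub>S\<^esub>" by (auto simp: sigma_def)
    then have "e \<otimes>\<^bsub>S\<^esub> a \<in> idems S" by simp
    then show ?thesis using EU e a unfolding E_unitary_def by blast
  qed
  interpret S: cayley_image G \<iota> X L S \<iota>S \<phi>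
    by unfold_locales (use \<phi> gen pure noL in auto)
  have "cayley_obj G \<iota> X L S \<iota>S \<phi>"
    by unfold_locales (use S.invgen_subset_ev gen in blast)
  then show ?thesis by (intro exI[of _ \<phi>])
qed

text \<open>In an \<open>F\<close>-inverse monoid the greatest element of the class of \<open>1\<close> is \<open>1\<close> itself; hence
  that class consists of idempotents, that is, the monoid is \<open>E\<close>-unitary.\<close>

lemma (in cayley) cayley_obj_objF:
  assumes "objF G \<iota> X S \<iota>S" and mL: "Inr [] \<in> L"
  shows "\<exists>\<phi>. cayley_obj G \<iota> X L S \<iota>S \<phi>"
proof -
  interpret S: inverse_monoid S using assms(1) by (intro inverse_monoidI) (simp add: objF_def)
  obtain \<phi> where \<phi>: "\<phi> \<in> carrier S \<rightarrow> carrier G"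
    "\<forall>a\<in>carrier S. \<forall>b\<in>carrier S. \<phi> (a \<otimes>\<^bsub>S\<^esub> b) = \<phi> a \<otimes> \<phi> b" "\<phi> \<one>\<^bsub>S\<^esub> = \<one>"
    "\<forall>x\<in>X. \<phi> (\<iota>S x) = \<iota> x" "\<forall>a\<in>carrier S. \<forall>b\<in>carrier S. \<phi> a = \<phi> b \<longleftrightarrow> sigma S a b"
    using assms(1) unfolding objF_def group_image_is_def by auto
  have gen: "\<iota>S ` X \<subseteq> carrier S" "carrier S = Fgen S \<iota>S X" and FI: "F_inverse S"
    using assms(1) unfolding objF_def by blast+
  have ex: "\<exists>b\<in>carrier S. mop S a = b \<and> \<phi> b = \<phi> a \<and> (\<forall>c\<in>carrier S. \<phi> c = \<phi> a \<longrightarrow> nat_le S c b)"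
    if a: "a \<in> carrier S" for a
  proof -
    obtain b where b: "b \<in> carrier S" "sigma S a b" "\<And>c. c \<in> carrier S \<Longrightarrow> sigma S a c \<Longrightarrow> nat_le S c b"
      using FI a unfolding F_inverse_def by blast
    have "mop S a = b" using b by (rule S.mop_eqI)
    moreover have "\<phi> b = \<phi> a" "\<And>c. c \<in> carrier S \<Longrightarrow> \<phi> c = \<phi> a \<Longrightarrow> sigma S a c"
      using b(1,2) \<phi>(5) a by metis+
    ultimately show ?thesis using b by (intro bexI[of _ b]) auto
  qed
  have pure: "a \<in> idems S" if a: "a \<in> carrier S" "\<phi> a = \<one>" for a
  proof -
    obtain b where b: "b \<in> carrier S" "\<forall>c\<in>carrier S. \<phi> c = \<one> \<longrightarrow> nat_le S c b"
      using ex[OF S.one_closed] \<phi>(3) by auto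
    then have "b = \<one>\<^bsub>S\<^esub>" using \<phi>(3) by (intro S.one_nat_le_eq) auto
    then show ?thesis using b a by (intro S.nat_le_one_idem) auto
  qed
  interpret S: cayley_image G \<iota> X L S \<iota>S \<phi>
  proof
    show "mop S a \<in> carrier S \<and> \<phi> (mop S a) = \<phi> a \<and>
        (\<forall>b\<in>carrier S. \<phi> b = \<phi> a \<longrightarrow> nat_le S b (mop S a))" if "a \<in> carrier S" for a
      using ex[OF that] by auto
  qed (use \<phi> gen pure in auto)
  have "cayley_obj G \<iota> X L S \<iota>S \<phi>"
    by unfold_locales (use S.Fgen_subset_ev[OF mL] gen in blast)
  then show ?thesis by (intro exI[of _ \<phi>])
qed

section \<open>Paths and journeys as containment of swept graphs\<close>

context cayley
begin

lemma lpath_iff: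
  assumes "is_subgraph G \<iota> X \<Delta>" "g \<in> carrier G" "u \<in> words X"
  shows "lpath G \<iota> \<Delta> g u h \<longleftrightarrow> subg_le (pgraph g (map Inl u)) \<Delta> \<and> h = g \<otimes> gv (map Inl u)"
  using assms(2,3)
proof (induction u arbitrary: g)
  case Nil
  then show ?case by (auto simp: subg_le_def)
next
  case (Cons a u)
  have "(g, a) \<in> snd \<Delta> \<Longrightarrow> g \<in> fst \<Delta> \<and> (g \<otimes> lv a, flip a) \<in> snd \<Delta>"
    using subgraph_edge[OF assms(1)] by blast
  then show ?case using Cons
    by (auto simp: subg_le_def gl_def ledges_def m_assoc)
qed

text \<open>Bridges \<open>connected_graph\<close>, which admits arbitrary words, and
  \<open>reach\<close>: edges of a subgraph carry labels over \<open>X\<close> only.\<close>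

lemma lpath_words: "is_subgraph G \<iota> X \<Delta> \<Longrightarrow> lpath G \<iota> \<Delta> g u h \<Longrightarrow> u \<in> words X"
  by (induction u arbitrary: g) (auto dest: subgraph_edge(2))

fun flat :: "('x + 'x) list \<Rightarrow> (('x + 'x) list \<times> ('x + 'x) list) list \<Rightarrow> 'x elet list" where
  "flat u [] = map Inl u"
| "flat u ((v, u') # r) = map Inl u @ Inr v # flat u' r"

lemma mterms_simps [simp]:
  "(u, []) \<in> mterms X \<longleftrightarrow> u \<in> words X"
  "(u, (v, u') # r) \<in> mterms X \<longleftrightarrow> u \<in> words X \<and> v \<in> words X \<and> (u', r) \<in> mterms X"
  by (auto simp: mterms_def)

lemma flat_W:
  assumes "Inr [] \<in> L" "(u, r) \<in> mterms X" shows "flat u r \<in> W"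
  using assms(2) by (induction u r rule: flat.induct) (auto intro: Inr_L[OF assms(1)])

lemma flat_surj:
  assumes "w \<in> W" shows "\<exists>u r. (u, r) \<in> mterms X \<and> w = flat u r"
  using assms
proof (induction w)
  case Nil
  then show ?case by (intro exI[of _ "[]"]) auto
next
  case (Cons x w)
  then obtain u r where u: "(u, r) \<in> mterms X" "w = flat u r" by auto
  show ?case
  proof (cases x)
    case (Inl a)
    then have "(a # u, r) \<in> mterms X" "x # w = flat (a # u) r"
      using u Cons.prems by (cases r; auto)+
    then show ?thesis by blast
  next
    case (Inr v)
    \<comment> \<open>Terms alternate between words and jumps, so an empty word is put before the
      jump.\<close>
    then have "([], (v, u) # r) \<in> mterms X" "x # w = flat [] ((v, u) # r)"
      using u Cons.prems Inr_L_words by auto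
    then show ?thesis by blast
  qed
qed

lemma journey_iff:
  assumes "is_subgraph G \<iota> X \<Delta>" "Inr [] \<in> L" "g \<in> carrier G" "(u, r) \<in> mterms X"
  shows "journey G \<iota> \<Delta> g u r h \<longleftrightarrow> subg_le (pgraph g (flat u r)) \<Delta> \<and> h = g \<otimes> gv (flat u r)"
  using assms(3,4)
proof (induction u r arbitrary: g rule: flat.induct)
  case (1 u)
  then show ?case using lpath_iff[OF assms(1)] by simp
next
  case (2 u v u' r)
  have w: "u \<in> words X" "v \<in> words X" "(u', r) \<in> mterms X" using 2 by auto
  have L: "Inr v \<in> L" "flat u' r \<in> W" using Inr_L[OF assms(2)] w flat_W[OF assms(2)] by auto
  define k where "k = g \<otimes> wval G \<iota> u"
  have k: "k \<in> carrier G" "k \<otimes> wval G \<iota> v \<in> carrier G" using 2 w by (auto simp: k_def)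
  \<comment> \<open>A jump sweeps out just its two ends. The start \<open>k\<close> already ends the
    path labelled \<open>u\<close>, and the target begins the next path.\<close>
  have kin: "k \<in> fst \<Delta>" if "subg_le (pgraph g (map Inl u)) \<Delta>"
    using that end_in_pverts[of g "map Inl u"] w 2 by (auto simp: subg_le_def k_def)
  have "journey G \<iota> \<Delta> g u ((v, u') # r) h \<longleftrightarrow>
      subg_le (pgraph g (map Inl u)) \<Delta> \<and> journey G \<iota> \<Delta> (k \<otimes> wval G \<iota> v) u' r h"
    using lpath_iff[OF assms(1)] 2 w by (auto simp: k_def)
  also have "\<dots> \<longleftrightarrow> subg_le (pgraph g (map Inl u)) \<Delta> \<and>
      subg_le (pgraph (k \<otimes> wval G \<iota> v) (flat u' r)) \<Delta> \<and> h = k \<otimes> wval G \<iota> v \<otimes> gv (flat u' r)"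
    using 2(1)[OF k(2) w(3)] by simp
  also have "\<dots> \<longleftrightarrow> subg_le (pgraph g (flat u ((v, u') # r))) \<Delta> \<and> h = g \<otimes> gv (flat u ((v, u') # r))"
    using kin k w L 2 by (auto simp: subg_le_def gl_def ledges_def k_def m_assoc)
  finally show ?case .
qed

lemma LSub_eq_CSub:
  assumes "\<And>v. Inr v \<notin> L" shows "LSub = CSub G \<iota> X"
proof -
  note W = W_map_Inl[OF assms(1)]
  have "reach \<Delta> g h \<longleftrightarrow> (\<exists>w. lpath G \<iota> \<Delta> g w h)" if D: "is_subgraph G \<iota> X \<Delta>" "g \<in> carrier G" for \<Delta> g h
  proof
    assume "reach \<Delta> g h"
    then show "\<exists>w. lpath G \<iota> \<Delta> g w h" unfolding reach_def using W lpath_iff[OF D] by metis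
  next
    assume "\<exists>w. lpath G \<iota> \<Delta> g w h"
    then obtain w where w: "lpath G \<iota> \<Delta> g w h" by blast
    then show "reach \<Delta> g h"
      unfolding reach_def using lpath_words[OF D(1) w] lpath_iff[OF D] by (intro bexI[of _ "map Inl w"]) auto
  qed
  then show ?thesis
    unfolding LSub_def CSub_def connected_graph_def using subgraph_verts by blast
qed

lemma LSub_eq_Sub:
  assumes "Inr [] \<in> L" shows "LSub = Sub G \<iota> X"
proof -
  have "reach \<Delta> g h" if D: "is_subgraph G \<iota> X \<Delta>" and gh: "g \<in> fst \<Delta>" "h \<in> fst \<Delta>" for \<Delta> g h
  proof -
    have c: "g \<in> carrier G" "h \<in> carrier G" using subgraph_verts D gh by auto
    \<comment> \<open>The jump along \<open>v\<close> takes \<open>g\<close> to \<open>h\<close>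
      without any edge.\<close>
    then obtain v where v: "v \<in> words X" "wval G \<iota> v = inv g \<otimes> h" using ex_word[of "inv g \<otimes> h"] by auto
    then have "Inr v \<in> L" using Inr_L[OF assms] by blast
    then show ?thesis unfolding reach_def using v c gh
      by (intro bexI[of _ "[Inr v]"]) (auto simp: subg_le_def gl_def ledges_def m_assoc [symmetric])
  qed
  then show ?thesis unfolding LSub_def Sub_def by blast
qed

end

text \<open>Swapping \<open>u\<close> and \<open>v\<close> gives both directions of
  \<open>closedE\<close>, and the end point \<open>h\<close> is fixed by the group value, which
  agrees for words of equal value in \<open>S\<close>.\<close>

lemma (in cayley_image) clsd_iff_closedE:
  assumes "\<And>v. Inr v \<notin> L" "\<Delta> \<in> LSub"
  shows "closedE G \<iota> X S \<iota>S \<Delta> \<longleftrightarrow> clsd S \<iota>S \<Delta>"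
proof
  note W = W_map_Inl[OF assms(1)]
  note lp = lpath_iff[OF LSub_subgraph[OF assms(2)] LSub_verts[OF assms(2)]]
  assume cE: "closedE G \<iota> X S \<iota>S \<Delta>"
  show "clsd S \<iota>S \<Delta>"
  proof (rule clsdI)
    fix u v g assume u: "u \<in> W" "v \<in> W" "ev u = ev v" "gv u = gv v" and g: "g \<in> fst \<Delta>"
      and le: "subg_le (pgraph g u) \<Delta>"
    obtain u' v' where w: "u' \<in> words X" "v' \<in> words X" "u = map Inl u'" "v = map Inl v'"
      using W u by blast
    have "g \<otimes> gv u \<in> fst \<Delta>" using le end_in_pverts[of g u] LSub_verts[OF assms(2) g] u
      by (auto simp: subg_le_def)
    then have "lpath G \<iota> \<Delta> g v' (g \<otimes> gv u)"
      using cE w u g le lp[OF g] unfolding closedE_def weval_eq_eev by blast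
    then show "subg_le (pgraph g v) \<Delta>" using lp[OF g] w by blast
  qed
next
  note lp = lpath_iff[OF LSub_subgraph[OF assms(2)] LSub_verts[OF assms(2)]]
  assume c: "clsd S \<iota>S \<Delta>"
  have "lpath G \<iota> \<Delta> g v h" if u: "u \<in> words X" "v \<in> words X" "weval S \<iota>S u = weval S \<iota>S v"
    and g: "g \<in> fst \<Delta>" and p: "lpath G \<iota> \<Delta> g u h" for u v g h
  proof -
    have ev: "ev (map Inl u) = ev (map Inl v)" using u by (simp add: weval_eq_eev)
    then have "gv (map Inl u) = gv (map Inl v)" using u \<phi>_ev by (metis map_Inl_W)
    moreover have "subg_le (pgraph g (map Inl v)) \<Delta>"
      using c ev u g p lp[OF g] unfolding clsd_def by (meson map_Inl_W)
    ultimately show ?thesis using lp[OF g] u p by simp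
  qed
  then show "closedE G \<iota> X S \<iota>S \<Delta>" unfolding closedE_def by metis
qed

text \<open>The predicates under \<open>THE\<close> agree for every argument, as they only concern
  candidates in \<open>LSub\<close>; so the functions are equal outright and can be exchanged inside
  \<open>Sc\<close> and \<open>Sc_gen\<close>.\<close>

lemma (in cayley_image) cE_eq_cl:
  assumes "\<And>v. Inr v \<notin> L" shows "cE G \<iota> X S \<iota>S = clS"
proof
  fix \<Delta>
  have "(\<lambda>\<Theta>. \<Theta> \<in> LSub \<and> subg_le \<Delta> \<Theta> \<and> closedE G \<iota> X S \<iota>S \<Theta> \<and>
      (\<forall>\<Theta>'\<in>LSub. subg_le \<Delta> \<Theta>' \<and> closedE G \<iota> X S \<iota>S \<Theta>' \<longrightarrow> subg_le \<Theta> \<Theta>')) =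
    (\<lambda>\<Theta>. \<Theta> \<in> LSub \<and> subg_le \<Delta> \<Theta> \<and> clsd S \<iota>S \<Theta> \<and>
      (\<forall>\<Theta>'\<in>LSub. subg_le \<Delta> \<Theta>' \<and> clsd S \<iota>S \<Theta>' \<longrightarrow> subg_le \<Theta> \<Theta>'))"
    using clsd_iff_closedE[OF assms] by (intro ext) blast
  then show "cE G \<iota> X S \<iota>S \<Delta> = clS \<Delta>"
    unfolding cE_def cl_def LSub_eq_CSub[OF assms, symmetric] by (rule arg_cong)
qed

lemma (in cayley_image) teval_eq_ev:
  assumes "Inr [] \<in> L" "(u, r) \<in> mterms X"
  shows "teval S \<iota>S (u, r) = ev (flat u r)"
  using assms(2)
proof (induction u r rule: flat.induct)
  case (1 u)
  then show ?case by (simp add: teval_def weval_eq_eev)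
next
  case (2 u v u' r)
  define R where "R = foldr (\<lambda>(v, u) acc. mop S (weval S \<iota>S v) \<otimes>\<^bsub>S\<^esub> weval S \<iota>S u \<otimes>\<^bsub>S\<^esub> acc) r \<one>\<^bsub>S\<^esub>"
  have w: "u \<in> words X" "v \<in> words X" "u' \<in> words X" "(u', r) \<in> mterms X"
    using 2 by (auto simp: mterms_def)
  have L: "Inr v \<in> L" "flat u' r \<in> W" using Inr_L[OF assms(1)] w flat_W[OF assms(1)] by auto
  have mop: "mop S (weval S \<iota>S v) \<in> carrier S" using elval_props(1)[OF L(1)] by (simp add: elval_def)
  \<comment> \<open>Re-bracketing \<open>teval\<close> into the right-nested \<open>eev\<close>
    requires the tail to lie in the carrier.\<close>
  have R: "R \<in> carrier S" unfolding R_def using w(4)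
  proof (induction r arbitrary: u')
    case (Cons p r)
    obtain v1 u1 where p: "p = (v1, u1)" by force
    then have "v1 \<in> words X" "u1 \<in> words X" "(u1, r) \<in> mterms X" using Cons.prems by (auto simp: mterms_def)
    then show ?case using Cons.IH[of u1] p weval_closed elval_props(1)[of "Inr v1"] Inr_L[OF assms(1)]
      by (auto simp: elval_def)
  qed simp
  have IH: "weval S \<iota>S u' \<otimes>\<^bsub>S\<^esub> R = ev (flat u' r)" using 2(1)[OF w(4)] by (simp add: teval_def R_def)
  have "teval S \<iota>S (u, (v, u') # r) =
      weval S \<iota>S u \<otimes>\<^bsub>S\<^esub> (mop S (weval S \<iota>S v) \<otimes>\<^bsub>S\<^esub> weval S \<iota>S u' \<otimes>\<^bsub>S\<^esub> R)"
    by (simp add: teval_def R_def)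
  also have "\<dots> = weval S \<iota>S u \<otimes>\<^bsub>S\<^esub> (mop S (weval S \<iota>S v) \<otimes>\<^bsub>S\<^esub> ev (flat u' r))"
    using mop R w weval_closed IH by (simp add: S.m_assoc)
  also have "\<dots> = ev (flat u ((v, u') # r))"
    using w L by (simp add: weval_eq_eev elval_def)
  finally show ?case .
qed

text \<open>As in \<open>clsd_iff_closedE\<close>, with terms turned into words by
  \<open>flat\<close> and back by \<open>flat_surj\<close>.\<close>

lemma (in cayley_image) clsd_iff_closedF:
  assumes "Inr [] \<in> L" "\<Delta> \<in> LSub"
  shows "closedF G \<iota> X S \<iota>S \<Delta> \<longleftrightarrow> clsd S \<iota>S \<Delta>"
proof
  note jo = journey_iff[OF LSub_subgraph[OF assms(2)] assms(1) LSub_verts[OF assms(2)]]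
  assume cF: "closedF G \<iota> X S \<iota>S \<Delta>"
  show "clsd S \<iota>S \<Delta>"
  proof (rule clsdI)
    fix u v g assume u: "u \<in> W" "v \<in> W" "ev u = ev v" "gv u = gv v" and g: "g \<in> fst \<Delta>"
      and le: "subg_le (pgraph g u) \<Delta>"
    obtain a r b s where w: "(a, r) \<in> mterms X" "u = flat a r" "(b, s) \<in> mterms X" "v = flat b s"
      using flat_surj u(1,2) by metis
    have "g \<otimes> gv u \<in> fst \<Delta>" using le end_in_pverts[of g u] LSub_verts[OF assms(2) g] u
      by (auto simp: subg_le_def)
    moreover have "teval S \<iota>S (a, r) = teval S \<iota>S (b, s)" using w u teval_eq_ev[OF assms(1)] by simp
    moreover have "journey G \<iota> \<Delta> g a r (g \<otimes> gv u)" using jo[OF g w(1)] le w by simp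
    ultimately have "journey G \<iota> \<Delta> g b s (g \<otimes> gv u)"
      using cF w g unfolding closedF_def by (metis fst_conv snd_conv)
    then show "subg_le (pgraph g v) \<Delta>" using jo[OF g w(3)] w by blast
  qed
next
  note jo = journey_iff[OF LSub_subgraph[OF assms(2)] assms(1) LSub_verts[OF assms(2)]]
  assume c: "clsd S \<iota>S \<Delta>"
  have "journey G \<iota> \<Delta> g (fst v) (snd v) h"
    if u: "u \<in> mterms X" "v \<in> mterms X" "teval S \<iota>S u = teval S \<iota>S v"
    and g: "g \<in> fst \<Delta>" and p: "journey G \<iota> \<Delta> g (fst u) (snd u) h" for u v g h
  proof -
    obtain a r b s where w: "u = (a, r)" "v = (b, s)" by force
    have W: "flat a r \<in> W" "flat b s \<in> W" using u w flat_W[OF assms(1)] by auto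
    have ev: "ev (flat a r) = ev (flat b s)" using u w teval_eq_ev[OF assms(1)] by simp
    then have "gv (flat a r) = gv (flat b s)" using W \<phi>_ev by metis
    moreover have "subg_le (pgraph g (flat b s)) \<Delta>"
      using c ev W g p u w jo[OF g] unfolding clsd_def by (metis fst_conv snd_conv)
    ultimately show ?thesis using jo[OF g] u p w by simp
  qed
  then show "closedF G \<iota> X S \<iota>S \<Delta>" unfolding closedF_def by metis
qed

lemma (in cayley_image) cF_eq_cl:
  assumes "Inr [] \<in> L" shows "cF G \<iota> X S \<iota>S = clS"
proof
  fix \<Delta>
  have "(\<lambda>\<Theta>. \<Theta> \<in> LSub \<and> subg_le \<Delta> \<Theta> \<and> closedF G \<iota> X S \<iota>S \<Theta> \<and>
      (\<forall>\<Theta>'\<in>LSub. subg_le \<Delta> \<Theta>' \<and> closedF G \<iota> X S \<iota>S \<Theta>' \<longrightarrow> subg_le \<Theta> \<Theta>')) =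
    (\<lambda>\<Theta>. \<Theta> \<in> LSub \<and> subg_le \<Delta> \<Theta> \<and> clsd S \<iota>S \<Theta> \<and>
      (\<forall>\<Theta>'\<in>LSub. subg_le \<Delta> \<Theta>' \<and> clsd S \<iota>S \<Theta>' \<longrightarrow> subg_le \<Theta> \<Theta>'))"
    using clsd_iff_closedF[OF assms] by (intro ext) blast
  then show "cF G \<iota> X S \<iota>S \<Delta> = clS \<Delta>"
    unfolding cF_def cl_def LSub_eq_Sub[OF assms, symmetric] by (rule arg_cong)
qed

section \<open>Specialization to the two choices of letters\<close>

lemma (in cayley) objC_iff:
  assumes "\<And>v. Inr v \<notin> L" shows "objC G \<iota> X c \<longleftrightarrow> cayley_closure G \<iota> X L c"
  unfolding objC_def cayley_closure_def cayley_closure_axioms_def LSub_eq_CSub[OF assms]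
  using cayley_axioms by simp

lemma (in cayley) objS_iff:
  assumes "Inr [] \<in> L" shows "objS G \<iota> X c \<longleftrightarrow> cayley_closure G \<iota> X L c"
  unfolding objS_def cayley_closure_def cayley_closure_axioms_def LSub_eq_Sub[OF assms]
  using cayley_axioms by simp

lemma (in cayley) cmor_iff_inv:
  assumes "\<And>v. Inr v \<notin> L" shows "cmor S \<iota>S T \<iota>T f \<longleftrightarrow> canon_inv_mor X S \<iota>S T \<iota>T f"
  by (simp add: cmor_def assms)

lemma (in cayley) cmor_iff_F:
  assumes "Inr [] \<in> L" shows "cmor S \<iota>S T \<iota>T f \<longleftrightarrow> canon_F_mor X S \<iota>S T \<iota>T f"
  by (simp add: cmor_def canon_F_mor_def assms)

lemma (in cayley) E_unitary_equivalence:
  assumes noL: "\<And>v. Inr v \<notin> L"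
  shows objC_cE: "objE G \<iota> X S \<iota>S \<Longrightarrow> objC G \<iota> X (cE G \<iota> X S \<iota>S)"
    and objE_Sc_CSub: "objC G \<iota> X c \<Longrightarrow> objE G \<iota> X (Sc (CSub G \<iota> X) G c) (Sc_gen G \<iota> c)"
    and cE_Sc: "objC G \<iota> X c \<Longrightarrow> \<Delta> \<in> CSub G \<iota> X \<Longrightarrow>
      cE G \<iota> X (Sc (CSub G \<iota> X) G c) (Sc_gen G \<iota> c) \<Delta> = c \<Delta>"
    and Sc_cE_iso: "objE G \<iota> X S \<iota>S \<Longrightarrow>
      \<exists>f. canon_inv_mor X (Sc (CSub G \<iota> X) G (cE G \<iota> X S \<iota>S)) (Sc_gen G \<iota> (cE G \<iota> X S \<iota>S)) S \<iota>S f \<and>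
        bij_betw f (carrier (Sc (CSub G \<iota> X) G (cE G \<iota> X S \<iota>S))) (carrier S)"
    and canon_inv_mor_iff_cE: "objE G \<iota> X S \<iota>S \<Longrightarrow> objE G \<iota> X T \<iota>T \<Longrightarrow>
      (\<exists>f. canon_inv_mor X S \<iota>S T \<iota>T f) \<longleftrightarrow> clo_le (CSub G \<iota> X) (cE G \<iota> X S \<iota>S) (cE G \<iota> X T \<iota>T)"
    and clo_le_CSub_iff: "objC G \<iota> X c \<Longrightarrow> objC G \<iota> X c' \<Longrightarrow>
      clo_le (CSub G \<iota> X) c c' \<longleftrightarrow> (\<exists>f. canon_inv_mor X (Sc (CSub G \<iota> X) G c) (Sc_gen G \<iota> c)
        (Sc (CSub G \<iota> X) G c') (Sc_gen G \<iota> c') f)"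
proof -
  note eqs = LSub_eq_CSub[OF noL, symmetric] objC_iff[OF noL] cmor_iff_inv[OF noL, symmetric]
  show "objC G \<iota> X (cE G \<iota> X S \<iota>S)" if S: "objE G \<iota> X S \<iota>S"
  proof -
    obtain \<phi> where "cayley_obj G \<iota> X L S \<iota>S \<phi>" using cayley_obj_objE[OF S noL] by blast
    then interpret S: cayley_obj G \<iota> X L S \<iota>S \<phi> .
    show ?thesis unfolding eqs S.cE_eq_cl[OF noL] by (rule S.cayley_closure_cl)
  qed
  show "objE G \<iota> X (Sc (CSub G \<iota> X) G c) (Sc_gen G \<iota> c)" if c: "objC G \<iota> X c"
    unfolding eqs by (rule cayley_closure.objE_Sc[OF c[unfolded eqs] noL])
  show "cE G \<iota> X (Sc (CSub G \<iota> X) G c) (Sc_gen G \<iota> c) \<Delta> = c \<Delta>"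
    if c: "objC G \<iota> X c" and D: "\<Delta> \<in> CSub G \<iota> X"
  proof -
    interpret c: cayley_closure G \<iota> X L c using c unfolding eqs .
    interpret N: cayley_obj G \<iota> X L c.N c.gen snd by (rule c.cayley_obj_Sc)
    show ?thesis using D unfolding eqs N.cE_eq_cl[OF noL] by (rule c.cl_Sc)
  qed
  show "\<exists>f. canon_inv_mor X (Sc (CSub G \<iota> X) G (cE G \<iota> X S \<iota>S)) (Sc_gen G \<iota> (cE G \<iota> X S \<iota>S)) S \<iota>S f \<and>
      bij_betw f (carrier (Sc (CSub G \<iota> X) G (cE G \<iota> X S \<iota>S))) (carrier S)"
    if S: "objE G \<iota> X S \<iota>S"
  proof -
    obtain \<phi> where "cayley_obj G \<iota> X L S \<iota>S \<phi>" using cayley_obj_objE[OF S noL] by blast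
    then interpret S: cayley_obj G \<iota> X L S \<iota>S \<phi> .
    show ?thesis unfolding eqs S.cE_eq_cl[OF noL] by (rule S.ex_cmor_Sc_cl)
  qed
  show "(\<exists>f. canon_inv_mor X S \<iota>S T \<iota>T f) \<longleftrightarrow> clo_le (CSub G \<iota> X) (cE G \<iota> X S \<iota>S) (cE G \<iota> X T \<iota>T)"
    if S: "objE G \<iota> X S \<iota>S" and T: "objE G \<iota> X T \<iota>T"
  proof -
    obtain \<phi> where S': "cayley_obj G \<iota> X L S \<iota>S \<phi>" using cayley_obj_objE[OF S noL] by blast
    then interpret S: cayley_obj G \<iota> X L S \<iota>S \<phi> .
    obtain \<psi> where T': "cayley_obj G \<iota> X L T \<iota>T \<psi>" using cayley_obj_objE[OF T noL] by blast
    then interpret T: cayley_obj G \<iota> X L T \<iota>T \<psi> .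
    show ?thesis unfolding eqs S.cE_eq_cl[OF noL] T.cE_eq_cl[OF noL]
      by (rule ex_cmor_iff_clo_le[OF S' T'])
  qed
  show "clo_le (CSub G \<iota> X) c c' \<longleftrightarrow> (\<exists>f. canon_inv_mor X (Sc (CSub G \<iota> X) G c) (Sc_gen G \<iota> c)
        (Sc (CSub G \<iota> X) G c') (Sc_gen G \<iota> c') f)" if c: "objC G \<iota> X c" and c': "objC G \<iota> X c'"
    unfolding eqs by (rule clo_le_iff_ex_cmor_Sc[OF c[unfolded eqs] c'[unfolded eqs]])
qed

lemma (in cayley) F_inverse_equivalence:
  assumes mL: "Inr [] \<in> L"
  shows objS_cF: "objF G \<iota> X S \<iota>S \<Longrightarrow> objS G \<iota> X (cF G \<iota> X S \<iota>S)"
    and objF_Sc_Sub: "objS G \<iota> X c \<Longrightarrow> objF G \<iota> X (Sc (Sub G \<iota> X) G c) (Sc_gen G \<iota> c)"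
    and cF_Sc: "objS G \<iota> X c \<Longrightarrow> \<Delta> \<in> Sub G \<iota> X \<Longrightarrow>
      cF G \<iota> X (Sc (Sub G \<iota> X) G c) (Sc_gen G \<iota> c) \<Delta> = c \<Delta>"
    and Sc_cF_iso: "objF G \<iota> X S \<iota>S \<Longrightarrow>
      \<exists>f. canon_F_mor X (Sc (Sub G \<iota> X) G (cF G \<iota> X S \<iota>S)) (Sc_gen G \<iota> (cF G \<iota> X S \<iota>S)) S \<iota>S f \<and>
        bij_betw f (carrier (Sc (Sub G \<iota> X) G (cF G \<iota> X S \<iota>S))) (carrier S)"
    and canon_F_mor_iff_cF: "objF G \<iota> X S \<iota>S \<Longrightarrow> objF G \<iota> X T \<iota>T \<Longrightarrow>
      (\<exists>f. canon_F_mor X S \<iota>S T \<iota>T f) \<longleftrightarrow> clo_le (Sub G \<iota> X) (cF G \<iota> X S \<iota>S) (cF G \<iota> X T \<iota>T)"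
    and clo_le_Sub_iff: "objS G \<iota> X c \<Longrightarrow> objS G \<iota> X c' \<Longrightarrow>
      clo_le (Sub G \<iota> X) c c' \<longleftrightarrow> (\<exists>f. canon_F_mor X (Sc (Sub G \<iota> X) G c) (Sc_gen G \<iota> c)
        (Sc (Sub G \<iota> X) G c') (Sc_gen G \<iota> c') f)"
proof -
  note eqs = LSub_eq_Sub[OF mL, symmetric] objS_iff[OF mL] cmor_iff_F[OF mL, symmetric]
  show "objS G \<iota> X (cF G \<iota> X S \<iota>S)" if S: "objF G \<iota> X S \<iota>S"
  proof -
    obtain \<phi> where "cayley_obj G \<iota> X L S \<iota>S \<phi>" using cayley_obj_objF[OF S mL] by blast
    then interpret S: cayley_obj G \<iota> X L S \<iota>S \<phi> .
    show ?thesis unfolding eqs S.cF_eq_cl[OF mL] by (rule S.cayley_closure_cl)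
  qed
  show "objF G \<iota> X (Sc (Sub G \<iota> X) G c) (Sc_gen G \<iota> c)" if c: "objS G \<iota> X c"
    unfolding eqs by (rule cayley_closure.objF_Sc[OF c[unfolded eqs] mL])
  show "cF G \<iota> X (Sc (Sub G \<iota> X) G c) (Sc_gen G \<iota> c) \<Delta> = c \<Delta>"
    if c: "objS G \<iota> X c" and D: "\<Delta> \<in> Sub G \<iota> X"
  proof -
    interpret c: cayley_closure G \<iota> X L c using c unfolding eqs .
    interpret N: cayley_obj G \<iota> X L c.N c.gen snd by (rule c.cayley_obj_Sc)
    show ?thesis using D unfolding eqs N.cF_eq_cl[OF mL] by (rule c.cl_Sc)
  qed
  show "\<exists>f. canon_F_mor X (Sc (Sub G \<iota> X) G (cF G \<iota> X S \<iota>S)) (Sc_gen G \<iota> (cF G \<iota> X S \<iota>S)) S \<iota>S f \<and>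
      bij_betw f (carrier (Sc (Sub G \<iota> X) G (cF G \<iota> X S \<iota>S))) (carrier S)"
    if S: "objF G \<iota> X S \<iota>S"
  proof -
    obtain \<phi> where "cayley_obj G \<iota> X L S \<iota>S \<phi>" using cayley_obj_objF[OF S mL] by blast
    then interpret S: cayley_obj G \<iota> X L S \<iota>S \<phi> .
    show ?thesis unfolding eqs S.cF_eq_cl[OF mL] by (rule S.ex_cmor_Sc_cl)
  qed
  show "(\<exists>f. canon_F_mor X S \<iota>S T \<iota>T f) \<longleftrightarrow> clo_le (Sub G \<iota> X) (cF G \<iota> X S \<iota>S) (cF G \<iota> X T \<iota>T)"
    if S: "objF G \<iota> X S \<iota>S" and T: "objF G \<iota> X T \<iota>T"
  proof -
    obtain \<phi> where S': "cayley_obj G \<iota> X L S \<iota>S \<phi>" using cayley_obj_objF[OF S mL] by blast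
    then interpret S: cayley_obj G \<iota> X L S \<iota>S \<phi> .
    obtain \<psi> where T': "cayley_obj G \<iota> X L T \<iota>T \<psi>" using cayley_obj_objF[OF T mL] by blast
    then interpret T: cayley_obj G \<iota> X L T \<iota>T \<psi> .
    show ?thesis unfolding eqs S.cF_eq_cl[OF mL] T.cF_eq_cl[OF mL]
      by (rule ex_cmor_iff_clo_le[OF S' T'])
  qed
  show "clo_le (Sub G \<iota> X) c c' \<longleftrightarrow> (\<exists>f. canon_F_mor X (Sc (Sub G \<iota> X) G c) (Sc_gen G \<iota> c)
        (Sc (Sub G \<iota> X) G c') (Sc_gen G \<iota> c') f)" if c: "objS G \<iota> X c" and c': "objS G \<iota> X c'"
    unfolding eqs by (rule clo_le_iff_ex_cmor_Sc[OF c[unfolded eqs] c'[unfolded eqs]])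
qed

theorem mainTheorem9:
  fixes G :: "('g, 'b) monoid_scheme" and \<iota>G :: "'x \<Rightarrow> 'g" and X :: "'x set"
  assumes "group G" and "\<iota>G ` X \<subseteq> carrier G" and "generate G (\<iota>G ` X) = carrier G"
  shows
    \<comment> \<open>(1) E(X,G) equivalent to C(X,G) via S \<mapsto> c_S and c \<mapsto> S_c\<close>
    "(\<forall>(S :: 's monoid) \<iota>S. objE G \<iota>G X S \<iota>S \<longrightarrow> objC G \<iota>G X (cE G \<iota>G X S \<iota>S)) \<and>
     (\<forall>c. objC G \<iota>G X c \<longrightarrow> objE G \<iota>G X (Sc (CSub G \<iota>G X) G c) (Sc_gen G \<iota>G c)) \<and>
     (\<forall>c. objC G \<iota>G X c \<longrightarrow>
        (\<forall>\<Delta>\<in>CSub G \<iota>G X. cE G \<iota>G X (Sc (CSub G \<iota>G X) G c) (Sc_gen G \<iota>G c) \<Delta> = c \<Delta>)) \<and>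
     (\<forall>(S :: 's monoid) \<iota>S. objE G \<iota>G X S \<iota>S \<longrightarrow>
        (\<exists>f. canon_inv_mor X (Sc (CSub G \<iota>G X) G (cE G \<iota>G X S \<iota>S)) (Sc_gen G \<iota>G (cE G \<iota>G X S \<iota>S)) S \<iota>S f \<and>
             bij_betw f (carrier (Sc (CSub G \<iota>G X) G (cE G \<iota>G X S \<iota>S))) (carrier S))) \<and>
     (\<forall>(S :: 's monoid) \<iota>S (T :: 't monoid) \<iota>T. objE G \<iota>G X S \<iota>S \<and> objE G \<iota>G X T \<iota>T \<longrightarrow>
        ((\<exists>f. canon_inv_mor X S \<iota>S T \<iota>T f) \<longleftrightarrow>
         clo_le (CSub G \<iota>G X) (cE G \<iota>G X S \<iota>S) (cE G \<iota>G X T \<iota>T))) \<and>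
     (\<forall>c c'. objC G \<iota>G X c \<and> objC G \<iota>G X c' \<longrightarrow>
        (clo_le (CSub G \<iota>G X) c c' \<longleftrightarrow>
         (\<exists>f. canon_inv_mor X (Sc (CSub G \<iota>G X) G c) (Sc_gen G \<iota>G c) (Sc (CSub G \<iota>G X) G c') (Sc_gen G \<iota>G c') f))) \<and>
    \<comment> \<open>(2) F(X,G) equivalent to S(X,G) via S \<mapsto> c_S and c \<mapsto> S_c\<close>
     (\<forall>(S :: 's monoid) \<iota>S. objF G \<iota>G X S \<iota>S \<longrightarrow> objS G \<iota>G X (cF G \<iota>G X S \<iota>S)) \<and>
     (\<forall>c. objS G \<iota>G X c \<longrightarrow> objF G \<iota>G X (Sc (Sub G \<iota>G X) G c) (Sc_gen G \<iota>G c)) \<and>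
     (\<forall>c. objS G \<iota>G X c \<longrightarrow>
        (\<forall>\<Delta>\<in>Sub G \<iota>G X. cF G \<iota>G X (Sc (Sub G \<iota>G X) G c) (Sc_gen G \<iota>G c) \<Delta> = c \<Delta>)) \<and>
     (\<forall>(S :: 's monoid) \<iota>S. objF G \<iota>G X S \<iota>S \<longrightarrow>
        (\<exists>f. canon_F_mor X (Sc (Sub G \<iota>G X) G (cF G \<iota>G X S \<iota>S)) (Sc_gen G \<iota>G (cF G \<iota>G X S \<iota>S)) S \<iota>S f \<and>
             bij_betw f (carrier (Sc (Sub G \<iota>G X) G (cF G \<iota>G X S \<iota>S))) (carrier S))) \<and>
     (\<forall>(S :: 's monoid) \<iota>S (T :: 't monoid) \<iota>T. objF G \<iota>G X S \<iota>S \<and> objF G \<iota>G X T \<iota>T \<longrightarrow>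
        ((\<exists>f. canon_F_mor X S \<iota>S T \<iota>T f) \<longleftrightarrow>
         clo_le (Sub G \<iota>G X) (cF G \<iota>G X S \<iota>S) (cF G \<iota>G X T \<iota>T))) \<and>
     (\<forall>c c'. objS G \<iota>G X c \<and> objS G \<iota>G X c' \<longrightarrow>
        (clo_le (Sub G \<iota>G X) c c' \<longleftrightarrow>
         (\<exists>f. canon_F_mor X (Sc (Sub G \<iota>G X) G c) (Sc_gen G \<iota>G c) (Sc (Sub G \<iota>G X) G c') (Sc_gen G \<iota>G c') f)))"
proof -
  \<comment> \<open>Ordinary letters only: \<open>LSub\<close> is \<open>CSub\<close>.\<close>
  interpret E: cayley G \<iota>G X "Inl ` labels X"
    by (intro cayley.intro cayley_axioms.intro assms) auto
  have E: "\<And>v. Inr v \<notin> Inl ` labels X" by auto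
  \<comment> \<open>All jumps over \<open>X\<close> adjoined: \<open>LSub\<close> is
    \<open>Sub\<close>.\<close>
  interpret F: cayley G \<iota>G X "Inl ` labels X \<union> Inr ` words X"
    by (intro cayley.intro cayley_axioms.intro assms) auto
  have F: "Inr [] \<in> Inl ` labels X \<union> Inr ` words X" by auto
  show ?thesis
    by (intro conjI allI impI ballI; (elim conjE)?;
      (rule E.E_unitary_equivalence[OF E] F.F_inverse_equivalence[OF F]; assumption))
qed

end
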